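(* There exists a constant $C>0$, independent of the dimension, such that for every $n$ and every smooth convex body $K\subseteq\mathbb{R}^n$, $$\xi(K)\ \le\ C\,\sqrt{n}\ \mathrm{Vol}(K)^{\frac1n},$$ where $\xi(K)$ denotes the length of the shortest periodic billiard trajectory in $K$ and $\mathrm{Vol}$ is the $n$-dimensional Lebesgue volume.
   Context: A convex body in $\mathbb{R}^n$ is a compact convex set with non-empty interior; it is smooth if its boundary is smooth. Periodic billiard trajectories (this notion includes gliding trajectories along the boundary). Let $K\subset\mathbb{R}^n_q$ be a smooth convex body, translated so that $0\in \mathrm{int}(K)$ (all notions are translation invariant), and let $B\subset\mathbb{R}^n_p$ be the closed Euclidean unit ball. Let $g_K(q)=\inf\{r>0 : q\in rK\}$ and $g_B(p)=|p|$. A loop $\gamma:S^1\to\mathbb{R}^{2n}=\mathbb{R}^n_q\times\mathbb{R}^n_p$ is piecewise smooth if it is continuous, has left and right derivatives at all points, and is smooth outside some measure-zero subset of $S^1$. A closed $(K,B)$-billiard trajectory is (the image of) a piecewise smooth map $\gamma=(q,p):S^1\to\partial(K\times B)$ such that, with $\mathcal{B}_\gamma=\{t\in S^1: \gamma(t)\in\partial K\times\partial B\}$: (i) there is a constant $d>0$ such that for every $t\notin\mathcal{B}_\gamma$, $\dot\gamma(t)=d\,(-\nabla g_B(p(t)),0)$ if $\gamma(t)\in \mathrm{int}(K)\times\partial B$, and $\dot\gamma(t)=d\,(0,\nabla g_K(q(t)))$ if $\gamma(t)\in\partial K\times \mathrm{int}(B)$; (ii) for every $t\in\mathcal{B}_\gamma$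 the left and right derivatives $\dot\gamma^{\pm}(t)$ each belong to $\{\alpha(-\nabla g_B(p(t)),0)+\beta(0,\nabla g_K(q(t))) : \alpha,\beta\ge 0,\ (\alpha,\beta)\ne(0,0)\}$. A periodic billiard trajectory in $K$ is the closed curve $q$ (the projection of such a $\gamma$ to $\mathbb{R}^n_q$), and its length is its Euclidean length. $\xi(K)$ is the minimum of the lengths of all periodic billiard trajectories in $K$. *)

theory Defs
  imports "HOL-Analysis.Analysis"
begin

section \<open>A common ambient space for all \<open>\<real>\<^sup>n\<close>\<close>

text \<open>
  The constant in the theorem is chosen before the dimension, so the dimension has to be a natural
  number inside the formula and cannot be the cardinality of an index type. We realise
  \<open>\<real>\<^sup>n\<close> as the subspace of those finitely supported real sequences that vanish
  from index \<open>n\<close> on, with the standard scalar product. Restricted to this subspace, the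
  library's norm, topology, derivatives and convexity are those of Euclidean \<open>n\<close>-space.
\<close>

typedef fvec = "{x :: nat \<Rightarrow> real. finite {i. x i \<noteq> 0}}"
  morphisms coord Abs_fvec
  by (rule exI[of _ "\<lambda>_. 0"]) simp

lemma finite_coord [simp]: "finite {i. coord x i \<noteq> 0}"
  using coord[of x] by simp

lemma fvec_eqI: "(\<And>i. coord x i = coord y i) \<Longrightarrow> x = y"
  by (metis coord_inject ext)

instantiation fvec :: real_vector
begin

definition zero_fvec :: fvec where "0 = Abs_fvec (\<lambda>_. 0)"
definition plus_fvec :: "fvec \<Rightarrow> fvec \<Rightarrow> fvec" where
  "x + y = Abs_fvec (\<lambda>i. coord x i + coord y i)"
definition minus_fvec :: "fvec \<Rightarrow> fvec \<Rightarrow> fvec" where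
  "x - y = Abs_fvec (\<lambda>i. coord x i - coord y i)"
definition uminus_fvec :: "fvec \<Rightarrow> fvec" where
  "- x = Abs_fvec (\<lambda>i. - coord x i)"
definition scaleR_fvec :: "real \<Rightarrow> fvec \<Rightarrow> fvec" where
  "r *\<^sub>R x = Abs_fvec (\<lambda>i. r * coord x i)"

lemma coord_zero [simp]: "coord 0 i = 0"
  unfolding zero_fvec_def by (subst Abs_fvec_inverse) auto

lemma coord_add [simp]: "coord (x + y) i = coord x i + coord y i"
proof -
  have "finite {i. coord x i + coord y i \<noteq> 0}"
    by (rule finite_subset[of _ "{i. coord x i \<noteq> 0} \<union> {i. coord y i \<noteq> 0}"]) auto
  then show ?thesis unfolding plus_fvec_def by (subst Abs_fvec_inverse) auto
qed

lemma coord_diff [simp]: "coord (x - y) i = coord x i - coord y i"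
proof -
  have "finite {i. coord x i - coord y i \<noteq> 0}"
    by (rule finite_subset[of _ "{i. coord x i \<noteq> 0} \<union> {i. coord y i \<noteq> 0}"]) auto
  then show ?thesis unfolding minus_fvec_def by (subst Abs_fvec_inverse) auto
qed

lemma coord_uminus [simp]: "coord (- x) i = - coord x i"
  unfolding uminus_fvec_def by (subst Abs_fvec_inverse) auto

lemma coord_scaleR [simp]: "coord (r *\<^sub>R x) i = r * coord x i"
proof -
  have "finite {i. r * coord x i \<noteq> 0}"
    by (rule finite_subset[of _ "{i. coord x i \<noteq> 0}"]) auto
  then show ?thesis unfolding scaleR_fvec_def by (subst Abs_fvec_inverse) auto
qed

instance
  by standard (auto intro!: fvec_eqI simp: algebra_simps)

end

instantiation fvec :: real_inner
begin

definition inner_fvec :: "fvec \<Rightarrow> fvec \<Rightarrow> real" where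
  "inner_fvec x y = (\<Sum>i | coord x i \<noteq> 0. coord x i * coord y i)"
definition norm_fvec :: "fvec \<Rightarrow> real" where
  "norm_fvec x = sqrt (inner x x)"
definition dist_fvec :: "fvec \<Rightarrow> fvec \<Rightarrow> real" where
  "dist_fvec x y = norm (x - y)"
definition sgn_fvec :: "fvec \<Rightarrow> fvec" where
  "sgn_fvec x = x /\<^sub>R norm x"
definition uniformity_fvec :: "(fvec \<times> fvec) filter" where
  "uniformity_fvec = (INF e\<in>{0<..}. principal {(x, y). dist x y < e})"
definition open_fvec :: "fvec set \<Rightarrow> bool" where
  "open_fvec U \<longleftrightarrow> (\<forall>x\<in>U. \<forall>\<^sub>F (x', y) in uniformity. x' = x \<longrightarrow> y \<in> U)"

lemma inner_fvec_superset:
  assumes "finite S" "{i. coord x i \<noteq> 0} \<subseteq> S"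
  shows "inner x y = (\<Sum>i\<in>S. coord x i * coord y i)"
  unfolding inner_fvec_def using assms by (intro sum.mono_neutral_left) auto

instance
proof
  fix x y z :: fvec and r :: real
  let ?S = "{i. coord x i \<noteq> 0} \<union> {i. coord y i \<noteq> 0}"
  have "inner x y = (\<Sum>i\<in>?S. coord x i * coord y i)"
    by (rule inner_fvec_superset) auto
  moreover have "inner y x = (\<Sum>i\<in>?S. coord y i * coord x i)"
    by (rule inner_fvec_superset) auto
  ultimately show "inner x y = inner y x"
    by (simp add: mult.commute)
  have "inner (x + y) z = (\<Sum>i\<in>?S. coord (x + y) i * coord z i)"
    by (rule inner_fvec_superset) auto
  moreover have "inner x z = (\<Sum>i\<in>?S. coord x i * coord z i)"
    by (rule inner_fvec_superset) auto
  moreover have "inner y z = (\<Sum>i\<in>?S. coord y i * coord z i)"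
    by (rule inner_fvec_superset) auto
  ultimately show "inner (x + y) z = inner x z + inner y z"
    by (simp add: sum.distrib[symmetric] distrib_right)
  have "inner (r *\<^sub>R x) y = (\<Sum>i | coord x i \<noteq> 0. coord (r *\<^sub>R x) i * coord y i)"
    by (rule inner_fvec_superset) auto
  then show "inner (r *\<^sub>R x) y = r * inner x y"
    by (simp add: inner_fvec_def sum_distrib_left mult.assoc)
  show "0 \<le> inner x x"
    unfolding inner_fvec_def by (rule sum_nonneg) simp
  show "inner x x = 0 \<longleftrightarrow> x = 0"
  proof
    assume "inner x x = 0"
    then have "\<forall>i\<in>{i. coord x i \<noteq> 0}. coord x i * coord x i = 0"
      unfolding inner_fvec_def by (subst (asm) sum_nonneg_eq_0_iff) auto
    then show "x = 0" by (intro fvec_eqI) auto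
  qed (simp add: inner_fvec_def)
qed (simp_all add: norm_fvec_def dist_fvec_def sgn_fvec_def uniformity_fvec_def open_fvec_def)

end

definition Rn :: "nat \<Rightarrow> fvec set" where
  "Rn n = {x. \<forall>i\<ge>n. coord x i = 0}"

definition Vol :: "nat \<Rightarrow> fvec set \<Rightarrow> real" where
  "Vol n K = measure (\<Pi>\<^sub>M i\<in>{..<n}. lborel) ((\<lambda>x. \<lambda>i\<in>{..<n}. coord x i) ` K)"

text \<open>Interior and boundary are always taken relative to \<open>\<real>\<^sup>n\<close> (a subset of
  \<open>\<real>\<^sup>n\<close> has empty interior in the ambient space).\<close>

definition int_n :: "nat \<Rightarrow> fvec set \<Rightarrow> fvec set" where
  "int_n n K = top_of_set (Rn n) interior_of K"

definition bdry_n :: "nat \<Rightarrow> fvec set \<Rightarrow> fvec set" where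
  "bdry_n n K = top_of_set (Rn n) frontier_of K"

section \<open>Gradients, smooth functions, smooth convex bodies\<close>

definition has_gradient_n :: "nat \<Rightarrow> (fvec \<Rightarrow> real) \<Rightarrow> fvec \<Rightarrow> fvec \<Rightarrow> bool" where
  "has_gradient_n n f x v \<longleftrightarrow> v \<in> Rn n \<and> (f has_derivative (\<lambda>h. inner v h)) (at x within Rn n)"

text \<open>A gradient in \<open>\<real>\<^sup>n\<close> is unique if it exists.\<close>

definition gradient_n :: "nat \<Rightarrow> (fvec \<Rightarrow> real) \<Rightarrow> fvec \<Rightarrow> fvec" where
  "gradient_n n f x = (THE v. has_gradient_n n f x v)"

text \<open>\<open>Ck_on n k f U\<close>: for \<open>U\<close> open in \<open>\<real>\<^sup>n\<close>, the function \<open>f\<close> is of class \<open>C\<^sup>k\<close> on \<open>U\<close>.\<close>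

primrec Ck_on :: "nat \<Rightarrow> nat \<Rightarrow> (fvec \<Rightarrow> real) \<Rightarrow> fvec set \<Rightarrow> bool" where
  "Ck_on n 0 f U \<longleftrightarrow> continuous_on U f"
| "Ck_on n (Suc k) f U \<longleftrightarrow>
     (\<exists>G. (\<forall>x\<in>U. has_gradient_n n f x (G x)) \<and> (\<forall>i<n. Ck_on n k (\<lambda>x. coord (G x) i) U))"

definition convex_body :: "nat \<Rightarrow> fvec set \<Rightarrow> bool" where
  "convex_body n K \<longleftrightarrow> K \<subseteq> Rn n \<and> compact K \<and> convex K \<and> int_n n K \<noteq> {}"

text \<open>Smoothness of the boundary: near each of its points, the boundary is the zero set of a
  \<open>C\<^sup>\<infinity>\<close> function without critical points, that is, it is a smooth embedded hypersurface.\<close>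

definition smooth_boundary :: "nat \<Rightarrow> fvec set \<Rightarrow> bool" where
  "smooth_boundary n K \<longleftrightarrow>
     (\<forall>x\<in>bdry_n n K. \<exists>U f. openin (top_of_set (Rn n)) U \<and> x \<in> U \<and> (\<forall>k. Ck_on n k f U) \<and>
        (\<forall>y\<in>U. gradient_n n f y \<noteq> 0) \<and> bdry_n n K \<inter> U = {y\<in>U. f y = 0})"

definition smooth_convex_body :: "nat \<Rightarrow> fvec set \<Rightarrow> bool" where
  "smooth_convex_body n K \<longleftrightarrow> convex_body n K \<and> smooth_boundary n K"

definition gauge_fun :: "fvec set \<Rightarrow> fvec \<Rightarrow> real" where
  "gauge_fun K q = Inf {r. 0 < r \<and> q \<in> (\<lambda>x. r *\<^sub>R x) ` K}"

definition unit_ball :: "nat \<Rightarrow> fvec set" where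
  "unit_ball n = cball 0 1 \<inter> Rn n"

section \<open>Closed curves\<close>

text \<open>Maps on the circle \<open>\<real>/\<int>\<close> are represented by functions on \<open>\<real>\<close> of period 1.\<close>

definition smooth_near :: "(real \<Rightarrow> 'a::real_normed_vector) \<Rightarrow> real \<Rightarrow> bool" where
  "smooth_near \<gamma> t \<longleftrightarrow> (\<exists>e>0. \<exists>D :: nat \<Rightarrow> real \<Rightarrow> 'a. D 0 = \<gamma> \<and>
     (\<forall>k. \<forall>s\<in>{t-e<..<t+e}. (D k has_vector_derivative D (Suc k) s) (at s)))"

definition piecewise_smooth_loop :: "(real \<Rightarrow> 'a::real_normed_vector) \<Rightarrow> bool" where
  "piecewise_smooth_loop \<gamma> \<longleftrightarrow>
     (\<forall>t. \<gamma> (t + 1) = \<gamma> t) \<and> continuous_on UNIV \<gamma> \<and>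
     (\<forall>t. (\<exists>v. (\<gamma> has_vector_derivative v) (at_left t)) \<and>
          (\<exists>v. (\<gamma> has_vector_derivative v) (at_right t))) \<and>
     (\<exists>N. negligible N \<and> (\<forall>t. t \<notin> N \<longrightarrow> smooth_near \<gamma> t))"

text \<open>Euclidean length over one period, as the supremum of the lengths of inscribed polygons;
  the value is infinite for a curve that is not rectifiable.\<close>

definition loop_length :: "(real \<Rightarrow> fvec) \<Rightarrow> ennreal" where
  "loop_length q = (SUP ts \<in> {ts. sorted ts \<and> set ts \<subseteq> {0..1}}.
     (\<Sum>i<length ts - 1. ennreal (dist (q (ts ! i)) (q (ts ! Suc i)))))"

section \<open>Billiard trajectories\<close>

definition bounce_cone :: "nat \<Rightarrow> fvec set \<Rightarrow> fvec \<times> fvec \<Rightarrow> (fvec \<times> fvec) set" where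
  "bounce_cone n K z =
     {\<alpha> *\<^sub>R (- gradient_n n norm (snd z), 0) + \<beta> *\<^sub>R (0, gradient_n n (gauge_fun K) (fst z)) | \<alpha> \<beta>.
        0 \<le> \<alpha> \<and> 0 \<le> \<beta> \<and> (\<alpha>, \<beta>) \<noteq> (0, 0)}"

text \<open>Here \<open>K\<close> is assumed to contain the origin in its interior; the gauge of the Euclidean unit
  ball is \<open>norm\<close>.\<close>

definition closed_KB_trajectory :: "nat \<Rightarrow> fvec set \<Rightarrow> (real \<Rightarrow> fvec \<times> fvec) \<Rightarrow> bool" where
  "closed_KB_trajectory n K \<gamma> \<longleftrightarrow>
     piecewise_smooth_loop \<gamma> \<and>
     (\<forall>t. \<gamma> t \<in> top_of_set (Rn n \<times> Rn n) frontier_of (K \<times> unit_ball n)) \<and>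
     (\<exists>d>0. \<forall>t. \<gamma> t \<notin> bdry_n n K \<times> bdry_n n (unit_ball n) \<longrightarrow>
        (\<gamma> t \<in> int_n n K \<times> bdry_n n (unit_ball n) \<longrightarrow>
           (\<gamma> has_vector_derivative d *\<^sub>R (- gradient_n n norm (snd (\<gamma> t)), 0)) (at t)) \<and>
        (\<gamma> t \<in> bdry_n n K \<times> int_n n (unit_ball n) \<longrightarrow>
           (\<gamma> has_vector_derivative d *\<^sub>R (0, gradient_n n (gauge_fun K) (fst (\<gamma> t)))) (at t))) \<and>
     (\<forall>t. \<gamma> t \<in> bdry_n n K \<times> bdry_n n (unit_ball n) \<longrightarrow>
        (\<exists>v\<in>bounce_cone n K (\<gamma> t). (\<gamma> has_vector_derivative v) (at_left t)) \<and>
        (\<exists>v\<in>bounce_cone n K (\<gamma> t). (\<gamma> has_vector_derivative v) (at_right t)))"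

text \<open>A body is first translated so that the origin becomes an interior point.\<close>

definition periodic_billiard_trajectory :: "nat \<Rightarrow> fvec set \<Rightarrow> (real \<Rightarrow> fvec) \<Rightarrow> bool" where
  "periodic_billiard_trajectory n K q \<longleftrightarrow>
     (\<exists>c\<in>int_n n K. \<exists>p. closed_KB_trajectory n ((\<lambda>x. x - c) ` K) (\<lambda>t. (q t - c, p t)))"

text \<open>\<open>LEAST\<close> rather than an infimum: nothing can be said about \<open>xi n K\<close> unless a shortest
  periodic billiard trajectory exists.\<close>

definition xi :: "nat \<Rightarrow> fvec set \<Rightarrow> ennreal" where
  "xi n K = (LEAST l. \<exists>q. periodic_billiard_trajectory n K q \<and> l = loop_length q)"

end

theory Submission
  imports Defs "HOL-Library.Sublist"
begin

text \<open>
  Following Bezdek and Bezdek, the shortest periodic billiard trajectory is a shortest closed polygon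
  that cannot be translated into the interior of \<open>K\<close>. A shortest such polygon exists by
  compactness, since Caratheodory's theorem for the normals at the contact points bounds the number of
  vertices by \<open>n + 1\<close>; if it also has as few vertices as possible, the first variation of its
  length gives the reflection law. Conversely, no trajectory, gliding or not, can be translated into
  the interior of \<open>K\<close>, so inscribed polygons show that it is at least as long.

  For the upper bound it suffices to find a short vector \<open>v\<close> outside \<open>K - K\<close>, because the
  2-gon with vertices \<open>0\<close> and \<open>v\<close> is then such a polygon. If \<open>K - K\<close> contains the ball of
  radius \<open>w\<close>, a crude form of the Rogers-Shephard argument gives
  \<open>(w / (2 \<surd>n))\<^sup>n \<le> Vol K\<close>, so that the constant 4 works.
\<close>

section \<open>The subspaces \<open>\<real>\<^sup>n\<close> and relative interiors\<close>

text \<open>\<open>xi\<close> is a \<open>LEAST\<close>, so even an upper bound needs a trajectory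
  that attains the minimum, not merely short ones. The competitors are smooth only off a null set,
  so they are controlled through right derivatives of inner products alone.

  Smoothness of \<open>K\<close> enters as first-order information at a boundary point: the defining
  function yields a supporting hyperplane and interior points in every narrower cone on its inner
  side. This makes the gauge differentiable and lets the normals at the contact points decide
  whether a finite set can be pushed inside. If positively weighted normals sum to zero, touching
  their hyperplanes anywhere prevents a translation, so a vertex may slide in its hyperplane;
  minimality of the vertex number excludes the degenerate case of no reflection.

  The constant: doubling the cube of half-side \<open>s = w / (2 \<surd>n)\<close> stays in the ball
  of radius \<open>w\<close>. The volume argument compares \<open>(2 s)^n * 2^-n * Vol K\<close>
  with \<open>(Vol K)^2\<close>, so the critical \<open>w\<close> is
  \<open>2 \<surd>n (Vol K)^(1/n)\<close>, and the 2-gon traverses its edge twice.\<close>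

lemma subspace_Rn: "subspace (Rn n)"
  by (auto simp: subspace_def Rn_def)

lemmas Rn_add = subspace_add[OF subspace_Rn]
  and Rn_diff = subspace_diff[OF subspace_Rn]
  and Rn_scale = subspace_scale[OF subspace_Rn]
  and Rn_neg = subspace_neg[OF subspace_Rn]
  and Rn_0 = subspace_0[OF subspace_Rn]

lemma convex_Rn: "convex (Rn n)"
  by (rule subspace_imp_convex[OF subspace_Rn])

lemma ex_fvec_coord:
  "\<exists>x\<in>Rn n. \<forall>i<n. coord x i = f i"
proof -
  have "finite {i. (if i < n then f i else 0) \<noteq> 0}"
    by (rule finite_subset[of _ "{..<n}"]) auto
  then have "coord (Abs_fvec (\<lambda>i. if i < n then f i else 0)) = (\<lambda>i. if i < n then f i else 0)"
    by (intro Abs_fvec_inverse) auto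
  then show ?thesis
    by (intro bexI[of _ "Abs_fvec (\<lambda>i. if i < n then f i else 0)"]) (auto simp: Rn_def)
qed

lemma inner_Rn: "x \<in> Rn n \<Longrightarrow> inner x y = (\<Sum>i<n. coord x i * coord y i)"
  by (rule inner_fvec_superset) (auto simp: Rn_def not_le[symmetric])

lemma norm_Rn: "x \<in> Rn n \<Longrightarrow> (norm x)\<^sup>2 = (\<Sum>i<n. (coord x i)\<^sup>2)"
  using inner_Rn[of x n x] by (simp add: power2_norm_eq_inner) (simp add: power2_eq_square)

lemma abs_coord_le_norm: "\<bar>coord x i\<bar> \<le> norm x"
proof -
  have "(\<Sum>j\<in>{i}. (coord x j)\<^sup>2) \<le> (\<Sum>j\<in>insert i {j. coord x j \<noteq> 0}. (coord x j)\<^sup>2)"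
    by (rule sum_mono2) auto
  also have "\<dots> = inner x x"
    by (subst inner_fvec_superset[of "insert i {j. coord x j \<noteq> 0}"]) (auto simp: power2_eq_square)
  finally have "\<bar>coord x i\<bar>\<^sup>2 \<le> (norm x)\<^sup>2"
    by (simp add: power2_norm_eq_inner)
  then show ?thesis
    by (rule power2_le_imp_le) simp
qed

lemma bounded_linear_coord: "bounded_linear (\<lambda>x. coord x i)"
  by (rule bounded_linear_intro[of _ 1]) (auto simp: abs_coord_le_norm)

lemmas continuous_on_coord [continuous_intros] = bounded_linear.continuous_on[OF bounded_linear_coord]

lemma closed_Rn: "closed (Rn n)"
proof -
  have "Rn n = (\<Inter>i\<in>{n..}. (\<lambda>x. coord x i) -` {0})"
    by (auto simp: Rn_def)
  moreover have "closed ((\<lambda>x. coord x i) -` {0})" for i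
    by (intro closed_vimage continuous_intros)
  ultimately show ?thesis
    by auto
qed

lemma mem_int_n:
  "x \<in> int_n n K \<longleftrightarrow> x \<in> Rn n \<and> (\<exists>e>0. ball x e \<inter> Rn n \<subseteq> K)"
proof
  assume "x \<in> int_n n K"
  then obtain T where "openin (top_of_set (Rn n)) T" "x \<in> T" "T \<subseteq> K"
    by (auto simp: int_n_def interior_of_def)
  then obtain W where "open W" "T = Rn n \<inter> W"
    by (auto simp: openin_open)
  then obtain e where "e > 0" "ball x e \<subseteq> W"
    using \<open>x \<in> T\<close> by (auto simp: open_contains_ball)
  then show "x \<in> Rn n \<and> (\<exists>e>0. ball x e \<inter> Rn n \<subseteq> K)"
    using \<open>x \<in> T\<close> \<open>T = Rn n \<inter> W\<close> \<open>T \<subseteq> K\<close> by blast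
next
  assume "x \<in> Rn n \<and> (\<exists>e>0. ball x e \<inter> Rn n \<subseteq> K)"
  then obtain e where "x \<in> Rn n" "e > 0" "ball x e \<inter> Rn n \<subseteq> K"
    by blast
  moreover have "openin (top_of_set (Rn n)) (Rn n \<inter> ball x e)"
    by auto
  ultimately show "x \<in> int_n n K"
    unfolding int_n_def interior_of_def by (auto intro!: exI[of _ "Rn n \<inter> ball x e"])
qed

lemma mem_int_nE:
  assumes "x \<in> int_n n K"
  obtains e where "e > 0" "\<And>y. y \<in> Rn n \<Longrightarrow> norm (y - x) < e \<Longrightarrow> y \<in> K"
  using assms unfolding mem_int_n by (force simp: dist_norm norm_minus_commute)

lemma mem_int_nI:
  assumes "x \<in> Rn n" "e > 0" "\<And>y. y \<in> Rn n \<Longrightarrow> norm (y - x) < e \<Longrightarrow> y \<in> K"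
  shows "x \<in> int_n n K"
  using assms unfolding mem_int_n
  by (force simp: dist_norm norm_minus_commute)

lemma int_n_subset: "int_n n K \<subseteq> K"
  by (simp add: int_n_def interior_of_subset)

lemma openin_int_n: "openin (top_of_set (Rn n)) (int_n n K)"
  by (simp add: int_n_def)

lemma bdry_n_eq: "closed K \<Longrightarrow> K \<subseteq> Rn n \<Longrightarrow> bdry_n n K = K - int_n n K"
  unfolding bdry_n_def frontier_of_def int_n_def
  by (metis closedin_closed_subset closure_of_closedin closedin_subtopology Int_absorb1 Int_absorb2
      closed_closedin)

lemma int_n_translation:
  assumes "c \<in> Rn n"
  shows "int_n n ((\<lambda>x. x - c) ` K) = (\<lambda>x. x - c) ` int_n n K"
proof -
  have *: "(\<lambda>x. x - c) ` int_n n K \<subseteq> int_n n ((\<lambda>x. x - c) ` K)" if "c \<in> Rn n" for c K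
  proof clarify
    fix x assume "x \<in> int_n n K"
    then obtain e where "e > 0" and e: "\<And>y. y \<in> Rn n \<Longrightarrow> norm (y - x) < e \<Longrightarrow> y \<in> K"
      and "x \<in> Rn n"
      by (metis mem_int_n mem_int_nE)
    show "x - c \<in> int_n n ((\<lambda>x. x - c) ` K)"
    proof (rule mem_int_nI)
      show "x - c \<in> Rn n" "e > 0"
        using \<open>x \<in> Rn n\<close> that \<open>e > 0\<close> by (auto intro: Rn_diff)
      fix y assume "y \<in> Rn n" "norm (y - (x - c)) < e"
      then have "y + c \<in> K"
        using e[of "y + c"] that by (auto intro: Rn_add simp: algebra_simps)
      then show "y \<in> (\<lambda>x. x - c) ` K"
        by (rule rev_image_eqI) simp
    qed
  qed
  have "(\<lambda>x. x - (- c)) ` int_n n ((\<lambda>x. x - c) ` K)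
          \<subseteq> int_n n ((\<lambda>x. x - (- c)) ` ((\<lambda>x. x - c) ` K))"
    by (rule *) (use assms in \<open>auto intro: Rn_neg\<close>)
  also have "(\<lambda>x. x - (- c)) ` ((\<lambda>x. x - c) ` K) = K"
    by (auto simp: image_image)
  finally have "int_n n ((\<lambda>x. x - c) ` K) \<subseteq> (\<lambda>x. x - c) ` int_n n K"
    by (force simp: image_iff)
  with *[OF assms] show ?thesis
    by blast
qed

section \<open>Convex bodies and segments into the interior\<close>

locale convex_body_n =
  fixes n :: nat and K :: "fvec set"
  assumes convex_body: "convex_body n K"
begin

lemma sub_Rn: "K \<subseteq> Rn n" and compact_K: "compact K" and convex_K: "convex K"
  and int_nonempty: "int_n n K \<noteq> {}"
  using convex_body by (auto simp: convex_body_def)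

lemma closed_K: "closed K"
  by (rule compact_imp_closed[OF compact_K])

lemma in_Rn: "x \<in> K \<Longrightarrow> x \<in> Rn n"
  using sub_Rn by blast

lemma in_K: "x \<in> int_n n K \<Longrightarrow> x \<in> K"
  using int_n_subset by blast

lemma bdry_eq: "bdry_n n K = K - int_n n K"
  by (rule bdry_n_eq[OF closed_K sub_Rn])

lemma int_segment:
  assumes a: "a \<in> int_n n K" and b: "b \<in> K" and t: "0 \<le> t" "t < 1"
  shows "a + t *\<^sub>R (b - a) \<in> int_n n K"
proof -
  obtain e where "e > 0" and e: "\<And>y. y \<in> Rn n \<Longrightarrow> norm (y - a) < e \<Longrightarrow> y \<in> K"
    using a by (rule mem_int_nE) blast
  have R: "a \<in> Rn n" "b \<in> Rn n"
    using a b in_Rn in_K by auto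
  show ?thesis
  proof (rule mem_int_nI)
    show "a + t *\<^sub>R (b - a) \<in> Rn n" "(1 - t) * e > 0"
      using R t \<open>e > 0\<close> by (auto intro!: Rn_add Rn_scale Rn_diff)
    fix y assume y: "y \<in> Rn n" "norm (y - (a + t *\<^sub>R (b - a))) < (1 - t) * e"
    \<comment> \<open>\<open>z\<close> is the preimage of \<open>y\<close> under the homothety with
      centre \<open>b\<close> and ratio \<open>1 - t\<close>, which sends \<open>a\<close> to the
      point in question.\<close>
    define z where "z = a + (1 / (1 - t)) *\<^sub>R (y - (a + t *\<^sub>R (b - a)))"
    have "norm (z - a) = norm (y - (a + t *\<^sub>R (b - a))) / (1 - t)"
      unfolding z_def using t by simp
    then have "norm (z - a) < e"
      using y t by (simp add: pos_divide_less_eq mult.commute)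
    moreover have "z \<in> Rn n"
      using y R by (auto simp: z_def intro!: Rn_add Rn_scale Rn_diff)
    ultimately have "z \<in> K"
      using e by blast
    moreover have "y = (1 - t) *\<^sub>R z + t *\<^sub>R b"
    proof -
      have "(1 - t) *\<^sub>R z = (1 - t) *\<^sub>R a + (y - (a + t *\<^sub>R (b - a)))"
        unfolding z_def scaleR_add_right scaleR_scaleR using t by simp
      then show ?thesis
        by (simp add: algebra_simps)
    qed
    ultimately show "y \<in> K"
      using convexD[OF convex_K \<open>z \<in> K\<close> b, of "1 - t" t] t by auto
  qed
qed

lemma int_segment':
  assumes a: "a \<in> int_n n K" and b: "b \<in> K" and t: "0 \<le> t" "t < 1"
  shows "(1 - t) *\<^sub>R a + t *\<^sub>R b \<in> int_n n K"
  using int_segment[OF assms] by (simp add: algebra_simps)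

lemma convex_int: "convex (int_n n K)"
proof (rule convexI)
  fix x y and u v :: real
  assume *: "x \<in> int_n n K" "y \<in> int_n n K" "0 \<le> u" "0 \<le> v" "u + v = 1"
  then have "u = 1 - v" "v \<le> 1"
    by auto
  then show "u *\<^sub>R x + v *\<^sub>R y \<in> int_n n K"
    using *(1-4) int_segment'[of x y v] by (cases "v = 1") (auto simp: in_K)
qed

lemma translate_body: "c \<in> Rn n \<Longrightarrow> convex_body_n n ((\<lambda>x. x - c) ` K)"
proof
  assume c: "c \<in> Rn n"
  have "compact ((\<lambda>x. x - c) ` K)"
    by (intro compact_continuous_image continuous_intros compact_K)
  moreover have "convex ((\<lambda>x. x - c) ` K)"
    using convex_translation[OF convex_K, of "- c"] by (simp add: image_def)
  ultimately show "convex_body n ((\<lambda>x. x - c) ` K)"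
    using c sub_Rn int_nonempty
    by (auto simp: convex_body_def int_n_translation intro!: Rn_diff)
qed

end

section \<open>Boundary normals and the gauge function\<close>

text \<open>On the line through \<open>x\<close> in the direction \<open>v - v'\<close> there is an
  ordinary two-sided derivative, and its uniqueness makes \<open>v - v'\<close> orthogonal to
  itself.\<close>

lemma has_gradient_unique:
  assumes v: "has_gradient_n n f x v" and v': "has_gradient_n n f x v'" and x: "x \<in> Rn n"
  shows "v = v'"
proof -
  define z where "z = v - v'"
  have z: "z \<in> Rn n"
    using v v' by (auto simp: z_def has_gradient_n_def intro: Rn_diff)
  have D: "((\<lambda>s. f (x + s *\<^sub>R z)) has_real_derivative inner u z) (at 0)"
    if "has_gradient_n n f x u" for u
  proof -
    have line: "((\<lambda>s. x + s *\<^sub>R z) has_derivative (\<lambda>s. s *\<^sub>R z)) (at 0 within UNIV)"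
      by (auto intro!: derivative_eq_intros)
    have "(f has_derivative (\<lambda>h. inner u h)) (at (x + 0 *\<^sub>R z) within range (\<lambda>s. x + s *\<^sub>R z))"
      using that x z by (auto simp: has_gradient_n_def intro!: has_derivative_subset[of _ _ _ "Rn n"] Rn_add Rn_scale)
    from has_derivative_in_compose[OF line this]
    show ?thesis
      by (simp add: has_field_derivative_def mult_commute_abs)
  qed
  have "inner v z = inner v' z"
    using D[OF v] D[OF v'] by (rule DERIV_unique)
  then have "inner z z = 0"
    by (simp add: z_def inner_diff_left)
  then show ?thesis
    by (simp add: z_def)
qed

lemma gradient_n_eqI:
  assumes "has_gradient_n n f x v" "x \<in> Rn n"
  shows "gradient_n n f x = v"
  unfolding gradient_n_def using assms has_gradient_unique by blast

lemma gradient_norm: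
  assumes "p \<in> Rn n" "p \<noteq> 0"
  shows "gradient_n n norm p = p /\<^sub>R norm p"
proof (rule gradient_n_eqI[OF _ assms(1)])
  have "(norm has_derivative (\<lambda>h. inner (sgn p) h)) (at p within Rn n)"
    using has_derivative_norm[OF assms(2)] by (simp add: inner_commute has_derivative_at_withinI)
  then show "has_gradient_n n norm p (p /\<^sub>R norm p)"
    using assms by (auto simp: has_gradient_n_def sgn_div_norm intro: Rn_scale)
qed

lemma connected_same_sign:
  fixes f :: "'a::topological_space \<Rightarrow> real"
  assumes "connected A" "continuous_on A f" "p \<in> A" "q \<in> A" "f p < 0" "f q > 0"
  shows "\<exists>z\<in>A. f z = 0"
proof -
  have "connected (f ` A)"
    using assms by (intro connected_continuous_image)
  then have "0 \<in> f ` A"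
    by (rule connectedD_interval[of _ "f p" "f q"]) (use assms in auto)
  then show ?thesis
    by force
qed

text \<open>First-order data at the boundary point and continuity nearby, in a form that passes to
  translates by composing \<open>f\<close> with a shift.\<close>

definition regular_boundary :: "nat \<Rightarrow> fvec set \<Rightarrow> bool" where
  "regular_boundary n K \<longleftrightarrow> (\<forall>x\<in>bdry_n n K. \<exists>f w r. r > 0 \<and> w \<noteq> 0 \<and> has_gradient_n n f x w \<and>
     continuous_on (ball x r \<inter> Rn n) f \<and> (\<forall>y\<in>ball x r \<inter> Rn n. y \<in> bdry_n n K \<longleftrightarrow> f y = 0))"

lemma smooth_imp_regular_boundary:
  assumes "smooth_boundary n K"
  shows "regular_boundary n K"
  unfolding regular_boundary_def
proof
  fix x assume "x \<in> bdry_n n K"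
  from bspec[OF assms[unfolded smooth_boundary_def] this]
  obtain U f where U: "openin (top_of_set (Rn n)) U" "x \<in> U" and f: "\<forall>k. Ck_on n k f U"
    and nz: "\<forall>y\<in>U. gradient_n n f y \<noteq> 0" and eq: "bdry_n n K \<inter> U = {y\<in>U. f y = 0}"
    by (elim exE conjE) rule
  from U(1) obtain W where W: "open W" "U = Rn n \<inter> W"
    by (auto simp: openin_open)
  then obtain r where r: "r > 0" "ball x r \<subseteq> W"
    using U(2) by (auto simp: open_contains_ball)
  from f[THEN spec, of "Suc 0"] obtain G where G: "\<forall>y\<in>U. has_gradient_n n f y (G y)"
    by auto
  have "gradient_n n f x = G x"
    using G U(2) W(2) by (intro gradient_n_eqI) auto
  moreover have "continuous_on (ball x r \<inter> Rn n) f"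
  proof -
    have "f differentiable (at y within Rn n)" if "y \<in> ball x r \<inter> Rn n" for y
    proof -
      have "y \<in> U"
        using that W(2) r(2) by blast
      then show ?thesis
        using G unfolding has_gradient_n_def differentiable_def by blast
    qed
    then have "f differentiable_on (ball x r \<inter> Rn n)"
      unfolding differentiable_on_def by (meson differentiable_within_subset inf_le2)
    then show ?thesis
      by (rule differentiable_imp_continuous_on)
  qed
  moreover have "\<forall>y\<in>ball x r \<inter> Rn n. y \<in> bdry_n n K \<longleftrightarrow> f y = 0"
  proof
    fix y assume "y \<in> ball x r \<inter> Rn n"
    then have "y \<in> U"
      using W(2) r(2) by blast
    then show "y \<in> bdry_n n K \<longleftrightarrow> f y = 0"
      using eq by blast
  qed
  ultimately show "\<exists>f w r. r > 0 \<and> w \<noteq> 0 \<and> has_gradient_n n f x w \<and>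
     continuous_on (ball x r \<inter> Rn n) f \<and> (\<forall>y\<in>ball x r \<inter> Rn n. y \<in> bdry_n n K \<longleftrightarrow> f y = 0)"
    using r(1) nz G U(2) by (intro exI[of _ f] exI[of _ "G x"] exI[of _ r]) auto
qed

lemma regular_boundary_translation:
  assumes c: "c \<in> Rn n" and K: "convex_body_n n K" and reg: "regular_boundary n K"
  shows "regular_boundary n ((\<lambda>x. x - c) ` K)"
  unfolding regular_boundary_def
proof
  interpret K: convex_body_n n K by fact
  interpret K': convex_body_n n "(\<lambda>x. x - c) ` K"
    by (rule K.translate_body[OF c])
  have bd: "y \<in> bdry_n n ((\<lambda>x. x - c) ` K) \<longleftrightarrow> y + c \<in> bdry_n n K" for y
    by (force simp: K'.bdry_eq K.bdry_eq int_n_translation[OF c] image_iff algebra_simps)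
  fix x assume "x \<in> bdry_n n ((\<lambda>x. x - c) ` K)"
  then have "x + c \<in> bdry_n n K"
    by (simp add: bd)
  from bspec[OF reg[unfolded regular_boundary_def] this]
  obtain f w r where f: "r > 0" "w \<noteq> 0" "has_gradient_n n f (x + c) w"
    "continuous_on (ball (x + c) r \<inter> Rn n) f"
    "\<forall>y\<in>ball (x + c) r \<inter> Rn n. y \<in> bdry_n n K \<longleftrightarrow> f y = 0"
    by (elim exE conjE) rule
  have sub: "(\<lambda>y. y + c) ` (ball x r \<inter> Rn n) \<subseteq> ball (x + c) r \<inter> Rn n"
    using c by (auto simp: dist_norm intro: Rn_add)
  have "((\<lambda>y. y + c) has_derivative (\<lambda>h. h)) (at x within Rn n)"
    by (auto intro!: derivative_eq_intros)
  moreover have "(f has_derivative (\<lambda>h. inner w h)) (at (x + c) within (\<lambda>y. y + c) ` Rn n)"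
    using f(3) c by (auto simp: has_gradient_n_def intro!: has_derivative_subset[of _ _ _ "Rn n"] Rn_add)
  ultimately have "((\<lambda>y. f (y + c)) has_derivative (\<lambda>h. inner w h)) (at x within Rn n)"
    by (rule has_derivative_in_compose)
  then have "has_gradient_n n (\<lambda>y. f (y + c)) x w"
    using f(3) by (simp add: has_gradient_n_def)
  moreover have "continuous_on (ball x r \<inter> Rn n) (\<lambda>y. f (y + c))"
    by (rule continuous_on_compose2[OF f(4) _ sub]) (intro continuous_intros)
  moreover have "\<forall>y\<in>ball x r \<inter> Rn n. y \<in> bdry_n n ((\<lambda>x. x - c) ` K) \<longleftrightarrow> f (y + c) = 0"
    using f(5) sub bd by blast
  ultimately show "\<exists>f w r. r > 0 \<and> w \<noteq> 0 \<and> has_gradient_n n f x w \<and>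
     continuous_on (ball x r \<inter> Rn n) f \<and>
     (\<forall>y\<in>ball x r \<inter> Rn n. y \<in> bdry_n n ((\<lambda>x. x - c) ` K) \<longleftrightarrow> f y = 0)"
    using f(1,2) by blast
qed

section \<open>Supporting hyperplanes and interior cones at boundary points\<close>

context convex_body_n
begin

lemma int_strict:
  assumes w: "w \<in> Rn n" "w \<noteq> 0" and le: "\<And>y. y \<in> K \<Longrightarrow> inner w y \<le> b" and c: "c \<in> int_n n K"
  shows "inner w c < b"
proof -
  obtain e where "e > 0" and e: "\<And>y. y \<in> Rn n \<Longrightarrow> norm (y - c) < e \<Longrightarrow> y \<in> K"
    using c by (rule mem_int_nE) blast
  define s where "s = e / (2 * norm w)"
  have "s > 0" "s * norm w < e"
    using w \<open>e > 0\<close> by (auto simp: s_def)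
  then have "c + s *\<^sub>R w \<in> K"
    using w c in_Rn in_K by (intro e) (auto intro!: Rn_add Rn_scale)
  then have "inner w c + s * inner w w \<le> b"
    using le[of "c + s *\<^sub>R w"] by (simp add: inner_add_right)
  moreover have "s * inner w w > 0"
    using \<open>s > 0\<close> w by simp
  ultimately show ?thesis
    by linarith
qed

lemma int_perturb:
  assumes y: "y \<in> K" "inner w y > b"
  shows "\<exists>z\<in>int_n n K. inner w z > b"
proof -
  obtain c where c: "c \<in> int_n n K"
    using int_nonempty by blast
  have "((\<lambda>t. inner w (c + t *\<^sub>R (y - c))) \<longlongrightarrow> inner w (c + 1 *\<^sub>R (y - c))) (at_left (1::real))"
    by (intro tendsto_intros)
  then have "\<forall>\<^sub>F t in at_left (1::real). inner w (c + t *\<^sub>R (y - c)) > b"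
    by (rule order_tendstoD) (use y in simp)
  moreover have "\<forall>\<^sub>F t in at_left (1::real). t \<in> {0<..<1}"
    by (intro eventually_at_left_real) simp
  ultimately have "\<forall>\<^sub>F t in at_left (1::real). \<exists>z\<in>int_n n K. inner w z > b"
    by eventually_elim (use int_segment[OF c y(1)] in \<open>force\<close>)
  then show ?thesis
    by simp
qed

text \<open>Interior points on both sides of the hyperplane through \<open>x\<close> orthogonal to
  \<open>w\<close> would give \<open>f\<close> both signs near \<open>x\<close>. The interior part
  of a ball is convex, hence connected, so \<open>f\<close> would vanish at an interior point,
  although its zeros are boundary points. So \<open>K\<close> lies on one side, and replacing
  \<open>f\<close> and \<open>w\<close> by their negatives makes it the required one.\<close>

lemma regular_normal:
  assumes reg: "regular_boundary n K" and x: "x \<in> bdry_n n K"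
  obtains f w r where "r > 0" "w \<noteq> 0" "has_gradient_n n f x w"
     "continuous_on (ball x r \<inter> Rn n) f" "\<And>y. y \<in> ball x r \<inter> Rn n \<Longrightarrow> y \<in> bdry_n n K \<longleftrightarrow> f y = 0"
     "\<And>y. y \<in> K \<Longrightarrow> inner w y \<le> inner w x"
proof -
  from bspec[OF reg[unfolded regular_boundary_def] x]
  obtain f w r where f: "r > 0" "w \<noteq> 0" "has_gradient_n n f x w"
    "continuous_on (ball x r \<inter> Rn n) f" and bd: "\<forall>y\<in>ball x r \<inter> Rn n. y \<in> bdry_n n K \<longleftrightarrow> f y = 0"
    by (elim exE conjE) rule
  have xK: "x \<in> K" "x \<in> Rn n"
    using x in_Rn by (auto simp: bdry_eq)
  have fx: "f x = 0"
    using bd x xK f(1) by auto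
  have wR: "w \<in> Rn n"
    using f(3) by (simp add: has_gradient_n_def)
  have False if ab: "a \<in> int_n n K" "b \<in> int_n n K" "inner w a > inner w x" "inner w b < inner w x" for a b
  proof -
    have lim: "((\<lambda>s. f (x + s *\<^sub>R z) / s) \<longlongrightarrow> inner w z) (at_right 0)" if "z \<in> Rn n" for z
    proof -
      have line: "((\<lambda>s. x + s *\<^sub>R z) has_derivative (\<lambda>s. s *\<^sub>R z)) (at 0 within UNIV)"
        by (auto intro!: derivative_eq_intros)
      have "(f has_derivative (\<lambda>h. inner w h)) (at (x + 0 *\<^sub>R z) within range (\<lambda>s. x + s *\<^sub>R z))"
        using f(3) xK that
        by (auto simp: has_gradient_n_def intro!: has_derivative_subset[of _ _ _ "Rn n"] Rn_add Rn_scale)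
      from has_derivative_in_compose[OF line this]
      have "((\<lambda>s. f (x + s *\<^sub>R z)) has_real_derivative inner w z) (at 0)"
        by (simp add: has_field_derivative_def mult_commute_abs)
      then have "((\<lambda>s. f (x + s *\<^sub>R z) / s) \<longlongrightarrow> inner w z) (at 0)"
        by (simp add: DERIV_def fx)
      then show ?thesis
        by (rule filterlim_mono) (auto simp: at_le)
    qed
    have near: "\<forall>\<^sub>F s in at_right (0::real). x + s *\<^sub>R (z - x) \<in> ball x r \<inter> int_n n K \<and> s > 0"
      if "z \<in> int_n n K" for z
    proof -
      have "((\<lambda>s. norm (s *\<^sub>R (z - x))) \<longlongrightarrow> norm (0 *\<^sub>R (z - x))) (at_right (0::real))"
        by (intro tendsto_intros)
      then have "\<forall>\<^sub>F s in at_right (0::real). norm (s *\<^sub>R (z - x)) < r"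
        by (rule order_tendstoD) (use f in simp)
      moreover have "\<forall>\<^sub>F s in at_right (0::real). s \<in> {0<..<1}"
        by (intro eventually_at_right_real) simp
      ultimately show ?thesis
      proof eventually_elim
        case (elim s)
        have "x + s *\<^sub>R (z - x) = z + (1 - s) *\<^sub>R (x - z)"
          by (simp add: algebra_simps)
        then show ?case
          using int_segment[OF that xK(1), of "1 - s"] elim by (simp flip: \<open>x + _ = _\<close> add: dist_norm)
      qed
    qed
    have aR: "a - x \<in> Rn n" "b - x \<in> Rn n"
      using ab xK in_K in_Rn by (auto intro!: Rn_diff)
    have "\<forall>\<^sub>F s in at_right (0::real). f (x + s *\<^sub>R (a - x)) / s > 0"
      by (rule order_tendstoD[OF lim[OF aR(1)]]) (use ab in \<open>simp add: inner_diff_right\<close>)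
    moreover have "\<forall>\<^sub>F s in at_right (0::real). f (x + s *\<^sub>R (b - x)) / s < 0"
      by (rule order_tendstoD[OF lim[OF aR(2)]]) (use ab in \<open>simp add: inner_diff_right\<close>)
    moreover note near[OF ab(1)] near[OF ab(2)]
    ultimately have "\<forall>\<^sub>F s in at_right (0::real). False"
    proof eventually_elim
      case (elim s)
      let ?A = "ball x r \<inter> int_n n K"
      have "?A \<subseteq> ball x r \<inter> Rn n"
        using in_K in_Rn by auto
      moreover have "connected ?A"
        by (intro convex_connected convex_Int convex_int) auto
      moreover have "f (x + s *\<^sub>R (a - x)) > 0" "f (x + s *\<^sub>R (b - x)) < 0"
        using elim by (auto simp: zero_less_divide_iff divide_less_0_iff)
      ultimately have "\<exists>z\<in>?A. f z = 0"
        using elim by (intro connected_same_sign[of ?A f "x + s *\<^sub>R (b - x)" "x + s *\<^sub>R (a - x)"])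
          (auto intro: continuous_on_subset[OF f(4)])
      then show ?case
        using bd in_K in_Rn by (force simp: bdry_eq)
    qed
    then show False
      by simp
  qed
  then consider "\<forall>y\<in>K. inner w y \<le> inner w x" | "\<forall>y\<in>K. inner (- w) y \<le> inner (- w) x"
    using int_perturb[of _ "inner w x" w] int_perturb[of _ "inner (- w) x" "- w"]
    by (simp add: not_le[symmetric]) (metis linorder_not_le)
  then show thesis
  proof cases
    case 1
    then show ?thesis
      using f bd that by blast
  next
    case 2
    have "has_gradient_n n (\<lambda>y. - f y) x (- w)"
      using f(3) by (auto simp: has_gradient_n_def inner_minus_left intro!: has_derivative_minus Rn_neg)
    moreover have "continuous_on (ball x r \<inter> Rn n) (\<lambda>y. - f y)"
      by (intro continuous_intros f)
    ultimately show ?thesis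
      using f bd 2 that[of r "- w" "\<lambda>y. - f y"] by auto
  qed
qed

text \<open>The defining function has no zero in such a cone, and the cone meets the interior.\<close>

lemma regular_cone:
  assumes reg: "regular_boundary n K" and x: "x \<in> bdry_n n K"
  obtains w where "w \<in> Rn n" "w \<noteq> 0" "\<And>y. y \<in> K \<Longrightarrow> inner w y \<le> inner w x"
    "\<And>e. e > 0 \<Longrightarrow> \<exists>d>0. \<forall>h\<in>Rn n. h \<noteq> 0 \<longrightarrow> norm h < d \<longrightarrow> inner w h \<le> - e * norm h \<longrightarrow> x + h \<in> int_n n K"
proof -
  obtain r w f where f: "r > 0" "w \<noteq> 0" "has_gradient_n n f x w"
    "continuous_on (ball x r \<inter> Rn n) f" and bd: "\<And>y. y \<in> ball x r \<inter> Rn n \<Longrightarrow> y \<in> bdry_n n K \<longleftrightarrow> f y = 0"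
    and le: "\<And>y. y \<in> K \<Longrightarrow> inner w y \<le> inner w x"
    by (rule regular_normal[OF assms], rule that)
  have xK: "x \<in> K" "x \<in> Rn n"
    using x in_Rn by (auto simp: bdry_eq)
  have fx: "f x = 0"
    using bd x xK f(1) by auto
  have wR: "w \<in> Rn n" and wD: "(f has_derivative (\<lambda>h. inner w h)) (at x within Rn n)"
    using f(3) by (auto simp: has_gradient_n_def)
  obtain c where c: "c \<in> int_n n K"
    using int_nonempty by blast
  define k where "k = c - x"
  have kR: "k \<in> Rn n"
    using c xK in_K in_Rn by (auto simp: k_def intro!: Rn_diff)
  have wk: "inner w k < 0"
    using int_strict[OF wR f(2) le c] by (simp add: k_def inner_diff_right)
  then have "k \<noteq> 0"
    by auto
  have "\<exists>d>0. \<forall>h\<in>Rn n. h \<noteq> 0 \<longrightarrow> norm h < d \<longrightarrow> inner w h \<le> - e * norm h \<longrightarrow> x + h \<in> int_n n K"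
    if "e > 0" for e
  proof -
    \<comment> \<open>Lowering the slope from \<open>e\<close> to \<open>e'\<close> only enlarges
      the cone, enough for it to contain the direction \<open>k\<close> towards an interior
      point.\<close>
    define e' where "e' = min e (- inner w k / norm k)"
    have e': "e' > 0" "e' \<le> e" "inner w k \<le> - e' * norm k"
      using \<open>e > 0\<close> wk \<open>k \<noteq> 0\<close> by (auto simp: e'_def min_def field_simps divide_less_0_iff)
    from wD[unfolded has_derivative_within_alt, THEN conjunct2, rule_format, of "e' / 2"] e'(1)
    obtain d0 where d0: "d0 > 0"
      "\<forall>y\<in>Rn n. norm (y - x) < d0 \<longrightarrow> norm (f y - f x - inner w (y - x)) \<le> e' / 2 * norm (y - x)"
      by auto
    define d where "d = min d0 r"
    define H where "H = {h \<in> Rn n. norm h < d \<and> h \<noteq> 0 \<and> inner w h \<le> - e' * norm h}"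
    have neg: "inner w h < 0" if "h \<in> H" for h
    proof -
      have "e' * norm h > 0"
        using that e' by (simp add: H_def)
      then show ?thesis
        using that by (simp add: H_def)
    qed
    have "convex H"
    proof (rule convexI)
      fix g h and u v :: real
      assume gh: "g \<in> H" "h \<in> H" and uv: "0 \<le> u" "0 \<le> v" "u + v = 1"
      let ?s = "u *\<^sub>R g + v *\<^sub>R h"
      have ns: "norm ?s \<le> u * norm g + v * norm h"
        using norm_triangle_ineq[of "u *\<^sub>R g" "v *\<^sub>R h"] uv by simp
      have "inner w ?s \<le> u * (- e' * norm g) + v * (- e' * norm h)"
        unfolding inner_add_right inner_scaleR_right using gh uv
        by (intro add_mono mult_left_mono) (auto simp: H_def)
      also have "\<dots> = - e' * (u * norm g + v * norm h)"
        by (simp add: algebra_simps)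
      also have "\<dots> \<le> - e' * norm ?s"
        using ns e' by simp
      finally have 1: "inner w ?s \<le> - e' * norm ?s" .
      have "norm ?s < d"
        using convexD[OF convex_ball[of 0 d], of g h u v] gh uv by (auto simp: H_def)
      \<comment> \<open>Strict negativity keeps the combination away from the excluded point
        \<open>0\<close>.\<close>
      moreover have "inner w ?s < 0"
      proof (cases "u = 0")
        case True
        then show ?thesis
          using uv neg[OF gh(2)] by simp
      next
        case False
        then have "u * inner w g < 0" "v * inner w h \<le> 0"
          using uv neg[OF gh(2)] neg[OF gh(1)] by (auto simp: mult_less_0_iff mult_le_0_iff)
        then show ?thesis
          by (simp add: inner_add_right)
      qed
      moreover have "?s \<in> Rn n"
        using gh by (auto simp: H_def intro!: Rn_add Rn_scale)
      ultimately show "?s \<in> H"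
        using 1 by (auto simp: H_def)
    qed
    define C where "C = (\<lambda>h. x + h) ` H"
    have "connected C"
      unfolding C_def by (intro convex_connected convex_translation \<open>convex H\<close>)
    have nb: "x + h \<notin> bdry_n n K" if h: "h \<in> H" for h
    proof -
      have hR: "h \<in> Rn n" "norm h < d0" "norm h < r" "h \<noteq> 0"
        using h by (auto simp: H_def d_def)
      have "\<bar>f (x + h) - inner w h\<bar> \<le> e' / 2 * norm h"
        using d0(2)[rule_format, of "x + h"] hR xK by (auto simp: fx intro: Rn_add)
      then have "f (x + h) \<le> inner w h + e' / 2 * norm h"
        by linarith
      also have "\<dots> \<le> - e' * norm h + e' / 2 * norm h"
        using h by (simp add: H_def)
      also have "\<dots> < 0"
        using e' hR by (simp add: field_simps)
      finally show ?thesis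
        using bd[of "x + h"] hR xK by (auto simp: dist_norm intro: Rn_add)
    qed
    have CR: "C \<subseteq> Rn n"
      using xK by (auto simp: C_def H_def intro: Rn_add)
    obtain W where W: "open W" "int_n n K = Rn n \<inter> W"
      using openin_int_n by (metis openin_open)
    define s where "s = min (1/2) (d / (2 * norm k))"
    have d: "d > 0"
      using d0 f by (simp add: d_def)
    have s: "0 < s" "s < 1" "s * norm k < d"
    proof -
      show "0 < s" "s < 1"
        using d \<open>k \<noteq> 0\<close> by (auto simp: s_def)
      have "s * norm k \<le> d / (2 * norm k) * norm k"
        by (intro mult_right_mono) (auto simp: s_def)
      also have "\<dots> < d"
        using d \<open>k \<noteq> 0\<close> by simp
      finally show "s * norm k < d" .
    qed
    have "inner w (s *\<^sub>R k) \<le> - e' * norm (s *\<^sub>R k)"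
      using mult_left_mono[OF e'(3), of s] s by (simp add: algebra_simps)
    then have "s *\<^sub>R k \<in> H"
      using s kR \<open>k \<noteq> 0\<close> by (simp add: H_def Rn_scale)
    then have "x + s *\<^sub>R k \<in> C"
      by (simp add: C_def)
    moreover have "x + s *\<^sub>R k \<in> int_n n K"
    proof -
      have "x + s *\<^sub>R k = c + (1 - s) *\<^sub>R (x - c)"
        by (simp add: algebra_simps k_def)
      then show ?thesis
        using int_segment[OF c xK(1), of "1 - s"] s by auto
    qed
    \<comment> \<open>The connected set \<open>C\<close> avoids the boundary, so the open sets
      \<open>W\<close> and \<open>- K\<close> split it; as it meets the interior, it lies there
      entirely.\<close>
    moreover have "C \<subseteq> W \<union> - K"
      using nb CR W by (auto simp: bdry_eq C_def)
    moreover have "W \<inter> - K \<inter> C = {}"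
      using W CR in_K by auto
    ultimately have "- K \<inter> C = {}"
      using connectedD[OF \<open>connected C\<close> W(1) open_Compl[OF closed_K]] W by blast
    then have "C \<subseteq> int_n n K"
      using nb by (auto simp: bdry_eq C_def)
    moreover have "x + h \<in> C"
      if "h \<in> Rn n" "h \<noteq> 0" "norm h < d" "inner w h \<le> - e * norm h" for h
    proof -
      have "e' * norm h \<le> e * norm h"
        using e' by (intro mult_right_mono) auto
      then have "inner w h \<le> - e' * norm h"
        using that(4) by linarith
      then have "h \<in> H"
        using that by (simp add: H_def)
      then show ?thesis
        by (simp add: C_def)
    qed
    ultimately show ?thesis
      using d by blast
  qed
  then show thesis
    using that wR f(2) le by blast
qed

end

section \<open>The gauge and its gradient\<close>

locale regular_body = convex_body_n +
  assumes regular: "regular_boundary n K" and zero_int: "0 \<in> int_n n K"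
begin

text \<open>The gradient of the gauge is the normal scaled so that the supporting hyperplane at a
  boundary point \<open>x\<close> is the level set \<open>inner (\<nu> x) y = 1\<close>.\<close>

definition \<nu> :: "fvec \<Rightarrow> fvec" where "\<nu> = gradient_n n (gauge_fun K)"

lemma zero_ball: obtains r where "r > 0" "\<And>y. y \<in> Rn n \<Longrightarrow> norm y < r \<Longrightarrow> y \<in> K"
  using zero_int by (rule mem_int_nE) auto

lemma gauge_le: "r > 0 \<Longrightarrow> y /\<^sub>R r \<in> K \<Longrightarrow> gauge_fun K y \<le> r"
  unfolding gauge_fun_def
  by (rule cInf_lower) (auto intro!: bdd_belowI[of _ 0] rev_image_eqI[of "y /\<^sub>R r"])

lemma gauge_ge:
  assumes y: "y \<in> Rn n" and w: "\<And>k. k \<in> K \<Longrightarrow> inner w k \<le> b" and b: "b > 0"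
  shows "gauge_fun K y \<ge> inner w y / b"
  unfolding gauge_fun_def
proof (rule cInf_greatest)
  obtain r where r: "r > 0" "\<And>y. y \<in> Rn n \<Longrightarrow> norm y < r \<Longrightarrow> y \<in> K"
    by (rule zero_ball, rule that)
  define s where "s = (norm y + 1) / r"
  have s: "s > 0" "norm (y /\<^sub>R s) < r"
    using r(1) by (auto simp: s_def field_simps add_pos_nonneg intro: add_nonneg_pos)
  then have "y /\<^sub>R s \<in> K"
    using y by (intro r(2) Rn_scale)
  then show "{r. 0 < r \<and> y \<in> (\<lambda>x. r *\<^sub>R x) ` K} \<noteq> {}"
    using s(1) by (auto intro!: exI[of _ s] rev_image_eqI[of "y /\<^sub>R s"])
  fix t assume "t \<in> {r. 0 < r \<and> y \<in> (\<lambda>x. r *\<^sub>R x) ` K}"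
  then obtain k where k: "t > 0" "k \<in> K" "y = t *\<^sub>R k"
    by auto
  then have "inner w y \<le> t * b"
    using w[OF k(2)] by simp
  then show "inner w y / b \<le> t"
    using b by (simp add: pos_divide_le_eq)
qed

text \<open>The supporting half-space bounds the gauge below by a linear function, with no error
  term. The cone condition bounds it above: dividing \<open>x + h\<close> by \<open>r\<close>, the
  linear value plus \<open>e * norm h\<close>, gives a point inside the cone and hence in
  \<open>K\<close>.\<close>

lemma gauge_has_gradient:
  assumes x: "x \<in> bdry_n n K" and w: "w \<in> Rn n" "w \<noteq> 0" "\<And>y. y \<in> K \<Longrightarrow> inner w y \<le> inner w x"
    and cone: "\<And>e. e > 0 \<Longrightarrow>
      \<exists>d>0. \<forall>h\<in>Rn n. h \<noteq> 0 \<longrightarrow> norm h < d \<longrightarrow> inner w h \<le> - e * norm h \<longrightarrow> x + h \<in> int_n n K"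
  shows "inner w x > 0" "has_gradient_n n (gauge_fun K) x (w /\<^sub>R inner w x)"
proof -
  have xK: "x \<in> K" "x \<in> Rn n"
    using x in_Rn by (auto simp: bdry_eq)
  define b where "b = inner w x"
  show "inner w x > 0"
    using int_strict[OF w zero_int] by simp
  then have b: "b > 0"
    by (simp add: b_def)
  have low: "gauge_fun K y \<ge> inner w y / b" if "y \<in> Rn n" for y
    using that b w(3) by (intro gauge_ge) (auto simp: b_def)
  have gx: "gauge_fun K x = 1"
    using gauge_le[of 1 x] xK low[OF xK(2)] b by (simp add: b_def)
  have "(gauge_fun K has_derivative (\<lambda>h. inner (w /\<^sub>R b) h)) (at x within Rn n)"
    unfolding has_derivative_within_alt
  proof (intro conjI allI impI bounded_linear_inner_right)
    fix e :: real assume e: "e > 0"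
    \<comment> \<open>\<open>M * norm h\<close> will bound \<open>r - 1\<close> in absolute value,
      and \<open>C * norm h\<close> will bound \<open>r\<close> times the displacement
      \<open>k\<close> of \<open>y / r\<close> from \<open>x\<close>.\<close>
    define M where "M = norm w / b + e"
    have we: "M > 0"
      using e b by (auto simp: M_def intro!: add_nonneg_pos)
    define C where "C = 1 + M * norm x"
    have C: "C > 0"
      using we by (auto simp: C_def intro!: add_pos_nonneg)
    have "e * b / C > 0"
      using e b C by simp
    then obtain d where d: "d > 0"
      "\<And>h. h \<in> Rn n \<Longrightarrow> h \<noteq> 0 \<Longrightarrow> norm h < d \<Longrightarrow> inner w h \<le> - (e * b / C) * norm h \<Longrightarrow> x + h \<in> int_n n K"
      using cone by blast
    \<comment> \<open>The second bound keeps \<open>r\<close> above \<open>1 / 2\<close>; with it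
      the first gives \<open>norm k < d\<close>.\<close>
    define D where "D = min (d / (2 * C)) (1 / (2 * M))"
    have "D > 0"
      using d C we by (simp add: D_def)
    moreover have "norm (gauge_fun K y - gauge_fun K x - inner (w /\<^sub>R b) (y - x)) \<le> e * norm (y - x)"
      if y: "y \<in> Rn n" "norm (y - x) < D" for y
    proof (cases "y = x")
      case False
      define h where "h = y - x"
      define r where "r = 1 + inner w h / b + e * norm h"
      have hR: "h \<in> Rn n" "h \<noteq> 0"
        using y xK False by (auto simp: h_def intro: Rn_diff)
      have hD: "C * norm h < d / 2" "M * norm h < 1 / 2"
        using y(2) C we by (auto simp: D_def h_def field_simps)
      have "\<bar>inner w h\<bar> / b \<le> norm w * norm h / b"
        using b Cauchy_Schwarz_ineq2[of w h] by (intro divide_right_mono) auto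
      then have r1: "\<bar>r - 1\<bar> \<le> M * norm h"
        using e b abs_triangle_ineq[of "inner w h / b" "e * norm h"]
        by (simp add: r_def M_def algebra_simps abs_mult)
      then have r: "r > 1 / 2"
        using hD by linarith
      define k where "k = (h - (r - 1) *\<^sub>R x) /\<^sub>R r"
      have xk: "x + k = y /\<^sub>R r"
      proof -
        have "r *\<^sub>R (x + k) = y"
          using r by (simp add: k_def scaleR_add_right) (simp add: h_def algebra_simps)
        then show ?thesis
          using r by (auto simp: field_simps)
      qed
      have "norm (h - (r - 1) *\<^sub>R x) \<le> norm h + \<bar>r - 1\<bar> * norm x"
        using norm_triangle_ineq4[of h "(r - 1) *\<^sub>R x"] by simp
      also have "\<dots> \<le> norm h + (M * norm h) * norm x"
        using r1 by (intro add_left_mono mult_right_mono) auto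
      also have "\<dots> = C * norm h"
        by (simp add: C_def algebra_simps)
      finally have nk: "r * norm k \<le> C * norm h"
        using r by (simp add: k_def mult.assoc[symmetric])
      have "norm k < d"
      proof -
        have "norm k / 2 \<le> r * norm k"
          using r mult_right_mono[of "1/2" r "norm k"] by simp
        then show ?thesis
          using nk hD by linarith
      qed
      \<comment> \<open>The summand \<open>e * norm h\<close> of \<open>r\<close> is there for this:
        it alone survives, so \<open>k\<close> points strictly inwards.\<close>
      moreover have wk: "r * inner w k = - (e * b * norm h)"
      proof -
        have "r * inner w k = inner w h - (r - 1) * b"
          using r by (simp add: k_def inner_diff_right b_def[symmetric])
        then show ?thesis
          using b by (simp add: r_def field_simps)
      qed
      have "inner w k \<le> - (e * b / C) * norm k"
      proof -
        have "r * (e * b / C * norm k) = e * b / C * (r * norm k)"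
          by simp
        also have "\<dots> \<le> e * b / C * (C * norm h)"
          using nk e b C by (intro mult_left_mono) auto
        also have "\<dots> = - (r * inner w k)"
          using wk C by simp
        finally have "r * (inner w k + e * b / C * norm k) \<le> 0"
          by (simp add: algebra_simps)
        then show ?thesis
          using r by (simp add: mult_le_0_iff)
      qed
      moreover have "k \<noteq> 0"
        using wk e b hR by auto
      moreover have "k \<in> Rn n"
        using hR xK by (auto simp: k_def intro!: Rn_scale Rn_diff)
      ultimately have "x + k \<in> K"
        using d(2) in_K by blast
      then have "gauge_fun K y \<le> r"
        using r xk by (intro gauge_le) auto
      moreover have "inner w y / b = 1 + inner w h / b"
        using b by (simp add: h_def inner_diff_right b_def[symmetric] field_simps)
      ultimately show ?thesis
        using low[OF y(1)] e
        by (auto simp: gx r_def h_def[symmetric] abs_le_iff divide_inverse_commute)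
    qed (simp add: gx)
    ultimately show "\<exists>d>0. \<forall>y\<in>Rn n. norm (y - x) < d \<longrightarrow>
      norm (gauge_fun K y - gauge_fun K x - inner (w /\<^sub>R b) (y - x)) \<le> e * norm (y - x)"
      by blast
  qed
  then show "has_gradient_n n (gauge_fun K) x (w /\<^sub>R inner w x)"
    using w by (auto simp: has_gradient_n_def b_def intro: Rn_scale)
qed

lemma normal:
  assumes x: "x \<in> bdry_n n K"
  shows normal_Rn: "\<nu> x \<in> Rn n" and normal_one: "inner (\<nu> x) x = 1"
    and normal_le: "\<And>y. y \<in> K \<Longrightarrow> inner (\<nu> x) y \<le> 1"
    and normal_less: "\<And>y. y \<in> int_n n K \<Longrightarrow> inner (\<nu> x) y < 1"
    and normal_cone: "\<And>h. h \<in> Rn n \<Longrightarrow> inner (\<nu> x) h < 0 \<Longrightarrow>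
      \<exists>d>0. \<forall>t. 0 < t \<longrightarrow> t < d \<longrightarrow> x + t *\<^sub>R h \<in> int_n n K"
proof -
  obtain w where w: "w \<in> Rn n" "w \<noteq> 0"
    "\<And>y. y \<in> K \<Longrightarrow> inner w y \<le> inner w x" and cone: "\<And>e. e > 0 \<Longrightarrow>
      \<exists>d>0. \<forall>h\<in>Rn n. h \<noteq> 0 \<longrightarrow> norm h < d \<longrightarrow> inner w h \<le> - e * norm h \<longrightarrow> x + h \<in> int_n n K"
    by (rule regular_cone[OF regular x], rule that)
  note g = gauge_has_gradient[OF x w cone]
  have "x \<in> Rn n"
    using x in_Rn by (auto simp: bdry_eq)
  then have nu: "\<nu> x = w /\<^sub>R inner w x"
    unfolding \<nu>_def using g(2) by (rule gradient_n_eqI[rotated])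
  show "\<nu> x \<in> Rn n" "inner (\<nu> x) x = 1"
    using g(1) w by (auto simp: nu intro: Rn_scale)
  show le: "inner (\<nu> x) y \<le> 1" if "y \<in> K" for y
    using w(3)[OF that] g(1) by (simp add: nu field_simps)
  have "\<nu> x \<noteq> 0"
    using g(1) w by (auto simp: nu)
  then show "inner (\<nu> x) y < 1" if "y \<in> int_n n K" for y
    using int_strict[OF \<open>\<nu> x \<in> Rn n\<close> _ le that] by blast
  fix h assume h: "h \<in> Rn n" "inner (\<nu> x) h < 0"
  then have wh: "inner w h < 0" "h \<noteq> 0"
    using g(1) by (auto simp: nu mult_less_0_iff)
  define e where "e = - inner w h / norm h"
  have "e > 0"
    using wh by (simp add: e_def divide_pos_neg divide_less_0_iff)
  then obtain d where d: "d > 0" "\<And>h. h \<in> Rn n \<Longrightarrow> h \<noteq> 0 \<Longrightarrow> norm h < d \<Longrightarrow>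
      inner w h \<le> - e * norm h \<Longrightarrow> x + h \<in> int_n n K"
    using cone by blast
  have "x + t *\<^sub>R h \<in> int_n n K" if "0 < t" "t < d / norm h" for t
    by (rule d(2)) (use that h wh in \<open>auto simp: e_def field_simps intro: Rn_scale\<close>)
  then show "\<exists>d>0. \<forall>t. 0 < t \<longrightarrow> t < d \<longrightarrow> x + t *\<^sub>R h \<in> int_n n K"
    using d(1) wh by (intro exI[of _ "d / norm h"]) auto
qed

lemma bdry_Rn: "x \<in> bdry_n n K \<Longrightarrow> x \<in> Rn n"
  by (auto simp: bdry_eq in_Rn)

end

section \<open>Caratheodory's theorem and closed polygons\<close>

text \<open>Let \<open>z\<close> be the point of the hull nearest to the origin. If some
  \<open>inner z x\<close> were not positive, a move from \<open>z\<close> towards \<open>x\<close>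
  would lead closer to the origin.\<close>

lemma convex_hull_gordan:
  fixes V :: "'a::real_inner set"
  assumes "finite V" "V \<noteq> {}" "0 \<notin> convex hull V"
  shows "\<exists>z\<in>convex hull V. \<forall>x\<in>V. inner z x > 0"
proof -
  have "compact (convex hull V)" "convex hull V \<noteq> {}"
    using assms by (auto intro: finite_imp_compact_convex_hull)
  from continuous_attains_inf[OF this continuous_on_norm_id]
  obtain z where z: "z \<in> convex hull V" and min: "\<forall>y\<in>convex hull V. norm z \<le> norm y"
    by auto
  have "z \<noteq> 0"
    using z assms by auto
  have "inner z x > 0" if "x \<in> V" for x
  proof (rule ccontr)
    assume neg: "\<not> inner z x > 0"
    define d where "d = x - z"
    have zd: "inner z d < 0"
    proof -
      have "inner z z > 0"
        using \<open>z \<noteq> 0\<close> by simp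
      then show ?thesis
        using neg unfolding d_def inner_diff_right by linarith
    qed
    then have "d \<noteq> 0"
      by auto
    \<comment> \<open>The minimiser on \<open>{0..1}\<close> of the squared norm of
      \<open>z + t *\<^sub>R d\<close>.\<close>
    define t where "t = min 1 (- inner z d / inner d d)"
    have t: "0 < t" "t \<le> 1"
      using zd \<open>d \<noteq> 0\<close> by (auto simp: t_def divide_less_0_iff)
    have "t \<le> - inner z d / inner d d"
      by (simp add: t_def)
    then have td: "t * inner d d \<le> - inner z d"
      using \<open>d \<noteq> 0\<close> by (subst (asm) pos_le_divide_eq) auto
    have "x \<in> convex hull V"
      using that by (rule hull_inc)
    then have "(1 - t) *\<^sub>R z + t *\<^sub>R x \<in> convex hull V"
      using z t by (intro convexD[OF convex_convex_hull]) auto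
    also have "(1 - t) *\<^sub>R z + t *\<^sub>R x = z + t *\<^sub>R d"
      by (simp add: d_def algebra_simps)
    finally have "norm z \<le> norm (z + t *\<^sub>R d)"
      using min by blast
    then have "inner z z \<le> inner (z + t *\<^sub>R d) (z + t *\<^sub>R d)"
      by (simp add: norm_le)
    also have "\<dots> = inner z z + t * (2 * inner z d + t * inner d d)"
      by (simp add: inner_add_left inner_add_right inner_commute algebra_simps)
    finally have "0 \<le> t * (2 * inner z d + t * inner d d)"
      by simp
    moreover have "t * (2 * inner z d + t * inner d d) < 0"
      using t td zd by (intro mult_pos_neg) auto
    ultimately show False
      by simp
  qed
  with z show ?thesis
    by blast
qed

lemma coord_sum: "coord (sum g A) i = (\<Sum>a\<in>A. coord (g a) i)"
  by (rule linear_sum[OF bounded_linear.linear[OF bounded_linear_coord]])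

text \<open>Stated for an indexed family, since different contact points may share a normal; two
  equal members already give a relation with coefficients \<open>1\<close> and
  \<open>- 1\<close>.\<close>

lemma Rn_dependent:
  fixes f :: "'a \<Rightarrow> fvec"
  assumes Y: "finite Y" "card Y > m" and f: "\<And>y. y \<in> Y \<Longrightarrow> f y \<in> Rn m"
  shows "\<exists>u. (\<exists>y\<in>Y. u y \<noteq> 0) \<and> (\<Sum>y\<in>Y. u y *\<^sub>R f y) = 0"
proof (cases "inj_on f Y")
  case False
  then obtain a b where ab: "a \<in> Y" "b \<in> Y" "a \<noteq> b" "f a = f b"
    by (auto simp: inj_on_def)
  define u :: "'a \<Rightarrow> real" where "u = (\<lambda>y. if y = a then 1 else if y = b then - 1 else 0)"
  have "(\<Sum>y\<in>Y. u y *\<^sub>R f y) = (\<Sum>y\<in>{a, b}. u y *\<^sub>R f y)"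
    using ab Y by (intro sum.mono_neutral_right) (auto simp: u_def)
  also have "\<dots> = 0"
    using ab by (simp add: u_def)
  finally show ?thesis
    using ab(1) by (intro exI[of _ u]) (auto simp: u_def)
next
  case True
  obtain e where e: "\<And>i. i < m \<Longrightarrow> e i \<in> Rn m" "\<And>i j. i < m \<Longrightarrow> j < m \<Longrightarrow> coord (e i) j = (if i = j then 1 else 0)"
  proof -
    have "\<forall>i. \<exists>x. x \<in> Rn m \<and> (\<forall>j<m. coord x j = (if i = j then 1 else 0))"
      using ex_fvec_coord[of m] by (simp add: Bex_def)
    from choice[OF this] show ?thesis
      using that by auto
  qed
  have "f ` Y \<subseteq> span (e ` {..<m})"
  proof clarify
    fix y assume "y \<in> Y"
    have "f y = (\<Sum>i<m. coord (f y) i *\<^sub>R e i)"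
    proof (rule fvec_eqI)
      fix j
      have "coord (\<Sum>i<m. coord (f y) i *\<^sub>R e i) j = (\<Sum>i<m. coord (f y) i * coord (e i) j)"
        by (simp add: coord_sum)
      also have "\<dots> = coord (f y) j"
      proof (cases "j < m")
        case True
        then have "(\<Sum>i<m. coord (f y) i * coord (e i) j) = (\<Sum>i<m. if i = j then coord (f y) j else 0)"
          by (intro sum.cong) (auto simp: e(2))
        then show ?thesis
          using True by simp
      next
        case False
        then show ?thesis
          using e(1) f[OF \<open>y \<in> Y\<close>] by (auto simp: Rn_def)
      qed
      finally show "coord (f y) j = coord (\<Sum>i<m. coord (f y) i *\<^sub>R e i) j"
        by simp
    qed
    also have "\<dots> \<in> span (e ` {..<m})"
      by (intro span_sum span_scale span_base) auto
    finally show "f y \<in> span (e ` {..<m})" .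
  qed
  moreover have "card (e ` {..<m}) \<le> m"
    using card_image_le[of "{..<m}" e] by simp
  moreover have "card (f ` Y) = card Y"
    by (rule card_image[OF True])
  ultimately have "dependent (f ` Y)"
    using real_vector.independent_span_bound[of "e ` {..<m}" "f ` Y"] Y by auto
  then obtain u where "\<exists>v\<in>f ` Y. u v \<noteq> 0" "(\<Sum>v\<in>f ` Y. u v *\<^sub>R v) = 0"
    using real_vector.dependent_finite[of "f ` Y"] Y by auto
  then show ?thesis
    using True by (intro exI[of _ "u \<circ> f"]) (auto simp: sum.reindex)
qed

text \<open>Take a smallest index set carrying positive weights. With more than \<open>n + 1\<close>
  elements, an affine relation among the vectors could be subtracted from the weights until one of
  them vanishes. The weights sit on indices so that they can be attached to vertices later.\<close>

lemma caratheodory_Rn: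
  fixes f :: "'a \<Rightarrow> fvec"
  assumes B: "finite B" and f: "\<And>y. y \<in> B \<Longrightarrow> f y \<in> Rn n" and hull: "0 \<in> convex hull (f ` B)"
  shows "\<exists>Y\<subseteq>B. \<exists>l::'a \<Rightarrow> real. Y \<noteq> {} \<and> card Y \<le> n + 1 \<and> (\<forall>y\<in>Y. l y > 0) \<and> (\<Sum>y\<in>Y. l y *\<^sub>R f y) = 0"
proof -
  define P where "P = (\<lambda>(Y, l :: 'a \<Rightarrow> real). Y \<subseteq> B \<and> Y \<noteq> {} \<and> (\<forall>y\<in>Y. l y > 0) \<and> (\<Sum>y\<in>Y. l y *\<^sub>R f y) = 0)"
  have "\<exists>Yl. P Yl"
  proof -
    obtain u where u: "\<forall>x\<in>f ` B. 0 \<le> u x" "sum u (f ` B) = 1" "(\<Sum>x\<in>f ` B. u x *\<^sub>R x) = 0"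
      using hull B by (auto simp: convex_hull_finite)
    define V where "V = {x \<in> f ` B. u x > 0}"
    define g where "g = inv_into B f"
    have g: "f (g v) = v" "g v \<in> B" if "v \<in> V" for v
      using that by (auto simp: V_def g_def f_inv_into_f inv_into_into)
    then have inj: "inj_on g V"
      by (metis inj_onI)
    have "(\<Sum>x\<in>V. u x *\<^sub>R x) = (\<Sum>x\<in>f ` B. u x *\<^sub>R x)" "sum u V = sum u (f ` B)"
      using u(1) B by (auto intro!: sum.mono_neutral_left simp: V_def order.strict_iff_order)
    then have *: "(\<Sum>x\<in>V. u x *\<^sub>R x) = 0" "sum u V = 1"
      using u by auto
    have "(\<Sum>y\<in>g ` V. u (f y) *\<^sub>R f y) = (\<Sum>x\<in>V. u x *\<^sub>R x)"
      using g by (simp add: sum.reindex[OF inj])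
    moreover have "V \<noteq> {}"
      using *(2) by auto
    ultimately have "P (g ` V, u \<circ> f)"
      using g * by (auto simp: P_def V_def)
    then show ?thesis ..
  qed
  then obtain Yl where Yl: "P Yl" and min: "\<And>Zl. P Zl \<Longrightarrow> card (fst Yl) \<le> card (fst Zl)"
    using ex_has_least_nat[of P _ "\<lambda>Yl. card (fst Yl)"] by blast
  obtain Y l where "Yl = (Y, l)"
    by force
  with Yl have Y: "Y \<subseteq> B" "Y \<noteq> {}" "\<forall>y\<in>Y. l y > 0" "(\<Sum>y\<in>Y. l y *\<^sub>R f y) = 0"
    by (auto simp: P_def)
  have fin: "finite Y"
    using Y(1) B by (rule finite_subset)
  have "card Y \<le> n + 1"
  proof (rule ccontr)
    assume "\<not> card Y \<le> n + 1"
    then have cY: "card Y > Suc n"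
      by simp
    \<comment> \<open>The extra coordinate \<open>n\<close>, equal to 1 on every
      \<open>f y + e\<close>, forces the coefficients of a linear relation to sum to 0.\<close>
    obtain e where e: "e \<in> Rn (Suc n)" "\<forall>i<Suc n. coord e i = (if i = n then 1 else 0)"
      using ex_fvec_coord[of "Suc n" "\<lambda>i. if i = n then 1 else 0"] by auto
    have "f y + e \<in> Rn (Suc n)" if "y \<in> Y" for y
      using f[of y] Y(1) that e(1) by (intro Rn_add) (auto simp: Rn_def)
    then obtain u where u: "\<exists>y\<in>Y. u y \<noteq> 0" "(\<Sum>y\<in>Y. u y *\<^sub>R (f y + e)) = 0"
      using Rn_dependent[OF fin cY, of "\<lambda>y. f y + e"] by blast
    have "coord (\<Sum>y\<in>Y. u y *\<^sub>R (f y + e)) n = (\<Sum>y\<in>Y. u y * (coord (f y) n + 1))"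
      using e(2) by (simp add: coord_sum)
    also have "\<dots> = sum u Y"
      using f Y(1) by (intro sum.cong) (auto simp: Rn_def)
    finally have u0: "sum u Y = 0"
      using u(2) by simp
    have "(\<Sum>y\<in>Y. u y *\<^sub>R (f y + e)) = (\<Sum>y\<in>Y. u y *\<^sub>R f y) + sum u Y *\<^sub>R e"
      by (simp add: scaleR_add_right sum.distrib scaleR_left.sum)
    then have uf: "(\<Sum>y\<in>Y. u y *\<^sub>R f y) = 0"
      using u(2) u0 by simp
    have "\<exists>y\<in>Y. u y > 0"
    proof (rule ccontr)
      assume "\<not> ?thesis"
      then have "\<forall>y\<in>Y. - u y \<ge> 0"
        by (simp add: not_less)
      moreover have "(\<Sum>y\<in>Y. - u y) = 0"
        using u0 by (simp add: sum_negf)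
      ultimately have "\<forall>y\<in>Y. - u y = 0"
        using sum_nonneg_eq_0_iff[OF fin, of "\<lambda>y. - u y"] by blast
      then show False
        using u(1) by simp
    qed
    then have P: "finite {y\<in>Y. u y > 0}" "{y\<in>Y. u y > 0} \<noteq> {}"
      using fin by auto
    \<comment> \<open>The largest multiple of \<open>u\<close> that can be subtracted while all
      weights stay nonnegative; the weight of a minimiser \<open>z\<close> becomes 0.\<close>
    define t where "t = Min ((\<lambda>y. l y / u y) ` {y\<in>Y. u y > 0})"
    have "t \<in> (\<lambda>y. l y / u y) ` {y\<in>Y. u y > 0}"
      unfolding t_def using P by (intro Min_in) auto
    then obtain z where z: "z \<in> Y" "u z > 0" "t = l z / u z"
      by auto
    have "t > 0"
      using z Y(3) by auto
    have tl: "t * u y \<le> l y" if "y \<in> Y" for y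
    proof (cases "u y > 0")
      case True
      have "t \<le> l y / u y"
        unfolding t_def using P that True by (intro Min_le) auto
      then show ?thesis
        using True by (simp add: pos_le_divide_eq)
    next
      case False
      then have "t * u y \<le> 0"
        using \<open>t > 0\<close> by (simp add: mult_le_0_iff)
      then show ?thesis
        using Y(3) that by force
    qed
    define l' where "l' = (\<lambda>y. l y - t * u y)"
    define Z where "Z = {y\<in>Y. l' y > 0}"
    have l'0: "\<forall>y\<in>Y - Z. l' y = 0"
      using tl by (auto simp: Z_def l'_def order.antisym not_less)
    have "Z \<subseteq> Y"
      by (simp add: Z_def)
    \<comment> \<open>The total weight is preserved because \<open>u\<close> sums to 0, so some
      weight stays positive.\<close>
    have "sum l' Z = sum l' Y"
      by (rule sum.mono_neutral_left[OF fin \<open>Z \<subseteq> Y\<close> l'0])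
    also have "\<dots> = sum l Y"
      using u0 by (simp add: l'_def sum_subtractf flip: sum_distrib_left)
    also have "\<dots> > 0"
      using fin Y by (intro sum_pos) auto
    finally have "Z \<noteq> {}"
      by auto
    moreover have "(\<Sum>y\<in>Z. l' y *\<^sub>R f y) = 0"
    proof -
      have "(\<Sum>y\<in>Z. l' y *\<^sub>R f y) = (\<Sum>y\<in>Y. l' y *\<^sub>R f y)"
        by (rule sum.mono_neutral_left[OF fin \<open>Z \<subseteq> Y\<close>]) (use l'0 in simp)
      also have "\<dots> = (\<Sum>y\<in>Y. l y *\<^sub>R f y) - t *\<^sub>R (\<Sum>y\<in>Y. u y *\<^sub>R f y)"
        by (simp add: l'_def scaleR_diff_left sum_subtractf scaleR_sum_right)
      finally show ?thesis
        using uf Y(4) by simp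
    qed
    ultimately have "P (Z, l')"
      using Y(1) by (auto simp: P_def Z_def)
    then have "card Y \<le> card Z"
      using min \<open>Yl = (Y, l)\<close> by fastforce
    moreover have "z \<notin> Z"
      using z by (simp add: Z_def l'_def)
    then have "Z \<subset> Y"
      using z(1) by (auto simp: Z_def)
    then have "card Z < card Y"
      using fin by (rule psubset_card_mono[rotated])
    ultimately show False
      by simp
  qed
  then show ?thesis
    using Y by blast
qed

section \<open>Lengths of open and closed polygons\<close>

fun chain_length :: "'a::metric_space list \<Rightarrow> real" where
  "chain_length (x # y # zs) = dist x y + chain_length (y # zs)"
| "chain_length _ = 0"

definition closed_length :: "'a::metric_space list \<Rightarrow> real" where
  "closed_length xs = chain_length (xs @ [hd xs])"

lemma chain_length_nonneg: "chain_length xs \<ge> 0"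
  by (induction xs rule: chain_length.induct) auto

lemma chain_length_eq_sum: "chain_length xs = (\<Sum>i<length xs - 1. dist (xs ! i) (xs ! Suc i))"
  by (induction xs rule: chain_length.induct) (auto simp: sum.lessThan_Suc_shift simp del: sum.lessThan_Suc)

lemma chain_length_append: "chain_length (xs @ y # zs) = chain_length (xs @ [y]) + chain_length (y # zs)"
proof (induction xs)
  case (Cons x xs)
  then show ?case
    by (cases xs) auto
qed simp

text \<open>Triangle inequality. The common starting point \<open>a\<close> is arbitrary in the
  induction, since a skipped entry becomes the new starting point.\<close>

lemma chain_length_subseq: "subseq ys xs \<Longrightarrow> chain_length (a # ys) \<le> chain_length (a # xs)"
proof (induction ys xs arbitrary: a rule: list_emb.induct)
  case (list_emb_Nil xs)
  then show ?case
    by (simp add: chain_length_nonneg)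
next
  case (list_emb_Cons ys xs x)
  have "chain_length (a # ys) \<le> dist a x + chain_length (x # ys)"
  proof (cases ys)
    case (Cons y zs)
    then show ?thesis
      using dist_triangle[of a y x] by simp
  qed simp
  then show ?case
    using list_emb_Cons.IH[of x] by simp
qed auto

lemma closed_length_rotate: "closed_length (xs @ ys) = closed_length (ys @ xs)"
proof (cases "xs = [] \<or> ys = []")
  case False
  then obtain x xs' y ys' where "xs = x # xs'" "ys = y # ys'"
    by (meson neq_Nil_conv)
  then show ?thesis
    using chain_length_append[of xs y "ys' @ [x]"] chain_length_append[of ys x "xs' @ [y]"]
    by (simp add: closed_length_def)
qed auto

text \<open>The first entry of \<open>xs\<close> may be dropped, so \<open>xs\<close> is rotated to
  begin at the first entry of \<open>ys\<close>; then both are chains from that point back to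
  itself.\<close>

lemma closed_length_subseq: "subseq ys xs \<Longrightarrow> closed_length ys \<le> closed_length xs"
proof (cases ys)
  case Nil
  then show ?thesis
    by (simp add: closed_length_def chain_length_nonneg)
next
  case (Cons y zs)
  assume "subseq ys xs"
  then obtain us vs where xs: "xs = us @ y # vs" "subseq zs vs"
    using Cons by (auto dest!: list_emb_ConsD)
  have "subseq (zs @ [y]) (vs @ us @ [y])"
    using xs(2) by (intro list_emb_append_mono) auto
  then have "closed_length ys \<le> closed_length ((y # vs) @ us)"
    using chain_length_subseq[of "zs @ [y]" "vs @ us @ [y]" y] by (simp add: closed_length_def Cons)
  then show ?thesis
    using xs closed_length_rotate[of us "y # vs"] by simp
qed

lemma closed_length_affine:
  fixes xs :: "'a::real_normed_vector list"
  shows "closed_length (map (\<lambda>x. c + r *\<^sub>R (x - a)) xs) = \<bar>r\<bar> * closed_length xs"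
proof -
  have *: "chain_length (map (\<lambda>x. c + r *\<^sub>R (x - a)) xs) = \<bar>r\<bar> * chain_length xs" for xs
  proof (induction xs rule: chain_length.induct)
    case (1 x y zs)
    have "c + r *\<^sub>R (x - a) - (c + r *\<^sub>R (y - a)) = r *\<^sub>R (x - y)"
      by (simp add: algebra_simps)
    then have "dist (c + r *\<^sub>R (x - a)) (c + r *\<^sub>R (y - a)) = \<bar>r\<bar> * dist x y"
      by (simp only: dist_norm norm_scaleR)
    then show ?case
      using 1 by (simp add: distrib_left)
  qed auto
  show ?thesis
    using *[of "xs @ [hd xs]"] by (cases xs) (auto simp: closed_length_def)
qed

text \<open>Brings polygons with at most \<open>n + 1\<close> vertices to lists of exactly that
  length, so that compactness applies to a fixed index set.\<close>

lemma closed_length_pad: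
  assumes "xs \<noteq> []"
  shows "closed_length (replicate k (hd xs) @ xs) = closed_length xs"
proof -
  obtain x zs where Cons: "xs = x # zs"
    using assms by (cases xs) auto
  have "chain_length (replicate k x @ x # ys) = chain_length (x # ys)" for ys
  proof (induction k)
    case (Suc k)
    then show ?case
      by (cases k) auto
  qed simp
  from this[of "zs @ [x]"] show ?thesis
    using Cons by (cases k) (auto simp: closed_length_def)
qed

lemma subseq_remdups: "subseq (remdups xs) xs"
  by (induction xs) auto

lemma continuous_on_closed_length_map:
  "continuous_on UNIV (\<lambda>f :: 'i \<Rightarrow> 'a::metric_space. closed_length (map f is))"
proof -
  have *: "continuous_on UNIV (\<lambda>f :: 'i \<Rightarrow> 'a. chain_length (map f js))" for js
  proof (induction js)
    case (Cons j js)
    then show ?case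
      by (cases js) (auto intro!: continuous_intros continuous_on_product_coordinates)
  qed simp
  show ?thesis
    using *[of "is @ [hd is]"] by (cases "is") (auto simp: closed_length_def)
qed

section \<open>Polygons that cannot be translated into the interior\<close>

definition untranslatable :: "nat \<Rightarrow> fvec set \<Rightarrow> fvec set \<Rightarrow> bool" where
  "untranslatable n K X \<longleftrightarrow> \<not> (\<exists>v\<in>Rn n. \<forall>y\<in>X. y + v \<in> int_n n K)"

lemma untranslatableI: "(\<And>v. v \<in> Rn n \<Longrightarrow> \<forall>y\<in>X. y + v \<in> int_n n K \<Longrightarrow> False) \<Longrightarrow> untranslatable n K X"
  unfolding untranslatable_def by blast

lemma untranslatableD: "untranslatable n K X \<Longrightarrow> v \<in> Rn n \<Longrightarrow> \<forall>y\<in>X. y + v \<in> int_n n K \<Longrightarrow> False"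
  unfolding untranslatable_def by blast

lemma untranslatable_shift:
  assumes "untranslatable n K X" "a \<in> Rn n"
  shows "untranslatable n K ((\<lambda>y. y + a) ` X)"
proof (rule untranslatableI)
  fix v assume v: "v \<in> Rn n" "\<forall>y\<in>(\<lambda>y. y + a) ` X. y + v \<in> int_n n K"
  show False
    by (rule untranslatableD[OF assms(1), of "a + v"]) (use v assms(2) in \<open>auto simp: add.assoc intro: Rn_add\<close>)
qed

lemma untranslatable_translate_body:
  assumes "c \<in> Rn n"
  shows "untranslatable n ((\<lambda>x. x - c) ` K) X \<longleftrightarrow> untranslatable n K X"
proof -
  have *: "y + v \<in> int_n n ((\<lambda>x. x - c) ` K) \<longleftrightarrow> y + (v + c) \<in> int_n n K" for y v
    by (force simp: int_n_translation[OF assms] image_iff algebra_simps)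
  have "(\<exists>v\<in>Rn n. \<forall>y\<in>X. y + (v + c) \<in> int_n n K) \<longleftrightarrow> (\<exists>v\<in>Rn n. \<forall>y\<in>X. y + v \<in> int_n n K)"
  proof
    assume "\<exists>v\<in>Rn n. \<forall>y\<in>X. y + (v + c) \<in> int_n n K"
    then show "\<exists>v\<in>Rn n. \<forall>y\<in>X. y + v \<in> int_n n K"
      using assms Rn_add by blast
  next
    assume "\<exists>v\<in>Rn n. \<forall>y\<in>X. y + v \<in> int_n n K"
    then obtain v where v: "v \<in> Rn n" "\<forall>y\<in>X. y + v \<in> int_n n K"
      by blast
    then show "\<exists>v\<in>Rn n. \<forall>y\<in>X. y + (v + c) \<in> int_n n K"
      using assms by (intro bexI[of _ "v - c"]) (auto intro: Rn_diff)
  qed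
  then show ?thesis
    by (simp add: untranslatable_def *)
qed

lemma (in convex_body_n) eventually_int_n:
  assumes "z \<in> int_n n K" "h \<in> Rn n"
  shows "\<forall>\<^sub>F s in at_right 0. z + s *\<^sub>R h \<in> int_n n K"
proof -
  obtain W where W: "open W" "int_n n K = Rn n \<inter> W"
    using openin_int_n by (metis openin_open)
  have "((\<lambda>s. z + s *\<^sub>R h) \<longlongrightarrow> z + 0 *\<^sub>R h) (at_right (0::real))"
    by (intro tendsto_intros)
  then have "\<forall>\<^sub>F s in at_right (0::real). z + s *\<^sub>R h \<in> W"
    by (rule topological_tendstoD) (use W assms in auto)
  then show ?thesis
    by eventually_elim (use assms W in_K in_Rn in \<open>auto intro: Rn_add Rn_scale\<close>)
qed

lemma eventually_at_right_witness:
  assumes "\<forall>\<^sub>F s in at_right (0::real). P s"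
  shows "\<exists>s>0. P s"
proof -
  have "\<forall>\<^sub>F s in at_right (0::real). s > 0"
    by (simp add: eventually_at_filter)
  with assms have "\<forall>\<^sub>F s in at_right (0::real). s > 0 \<and> P s"
    by eventually_elim simp
  from eventually_happens'[OF _ this] show ?thesis
    by auto
qed

section \<open>Contact normals and the reduction to at most \<open>n + 1\<close> vertices\<close>

context regular_body
begin

text \<open>Otherwise the negative of a suitable hull point is a direction \<open>h\<close> pointing
  strictly inwards at every contact point, and a short translation along \<open>h\<close> moves the
  finite set \<open>X\<close> into the interior. Without contact points, \<open>h = 0\<close>
  does.\<close>

lemma untranslatable_contact:
  assumes X: "finite X" "X \<subseteq> K" "untranslatable n K X"
  shows "0 \<in> convex hull (\<nu> ` (X \<inter> bdry_n n K))"
proof (rule ccontr)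
  assume no: "0 \<notin> convex hull (\<nu> ` (X \<inter> bdry_n n K))"
  let ?V = "\<nu> ` (X \<inter> bdry_n n K)"
  have "\<exists>h\<in>Rn n. \<forall>x\<in>X \<inter> bdry_n n K. inner (\<nu> x) h < 0"
  proof (cases "?V = {}")
    case True
    then show ?thesis
      using Rn_0 by auto
  next
    case False
    have "finite ?V"
      using X by simp
    from convex_hull_gordan[OF this False no]
    obtain z where z: "z \<in> convex hull ?V" "\<forall>v\<in>?V. inner z v > 0"
      by blast
    have "convex hull ?V \<subseteq> Rn n"
      by (rule hull_minimal) (use normal_Rn convex_Rn in auto)
    then show ?thesis
      using z by (intro bexI[of _ "- z"]) (auto simp: inner_commute[of z] intro: Rn_neg)
  qed
  then obtain h where h: "h \<in> Rn n" "\<forall>x\<in>X \<inter> bdry_n n K. inner (\<nu> x) h < 0"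
    by blast
  have "\<forall>\<^sub>F t in at_right (0::real). x + t *\<^sub>R h \<in> int_n n K" if "x \<in> X" for x
  proof (cases "x \<in> bdry_n n K")
    case True
    have "inner (\<nu> x) h < 0"
      using h(2) True that by blast
    from normal_cone[OF True h(1) this]
    obtain d where "d > 0" "\<forall>t. 0 < t \<longrightarrow> t < d \<longrightarrow> x + t *\<^sub>R h \<in> int_n n K"
      by auto
    then show ?thesis
      unfolding eventually_at_right_field by (intro exI[of _ d]) simp
  next
    case False
    then show ?thesis
      using that X(2) h(1) by (intro eventually_int_n) (auto simp: bdry_eq)
  qed
  then have "\<forall>\<^sub>F t in at_right (0::real). \<forall>x\<in>X. x + t *\<^sub>R h \<in> int_n n K"
    using X(1) by (intro eventually_ball_finite) auto
  from eventually_at_right_witness[OF this]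
  obtain t where "\<forall>x\<in>X. x + t *\<^sub>R h \<in> int_n n K"
    by auto
  then show False
    using untranslatableD[OF X(3), of "t *\<^sub>R h"] h(1) by (auto intro: Rn_scale)
qed

text \<open>A translation into the interior would have negative inner product with every normal,
  against the vanishing weighted sum. \<open>X\<close> may meet the supporting hyperplanes at any of
  their points, even outside \<open>K\<close>; the variation of a vertex relies on this.\<close>

lemma untranslatable_weights:
  assumes Y: "finite Y" "Y \<subseteq> bdry_n n K" "Y \<noteq> {}" "\<forall>y\<in>Y. l y > 0" "(\<Sum>y\<in>Y. l y *\<^sub>R \<nu> y) = 0"
    and X: "\<And>y. y \<in> Y \<Longrightarrow> \<exists>x\<in>X. inner (\<nu> y) x = 1"
  shows "untranslatable n K X"
proof (rule untranslatableI)
  fix v assume v: "v \<in> Rn n" "\<forall>y\<in>X. y + v \<in> int_n n K"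
  have neg: "inner (\<nu> y) v < 0" if "y \<in> Y" for y
  proof -
    obtain x where x: "x \<in> X" "inner (\<nu> y) x = 1"
      using X[OF \<open>y \<in> Y\<close>] by blast
    then have "inner (\<nu> y) (x + v) < 1"
      using v Y(2) that by (intro normal_less) auto
    then show ?thesis
      using x by (simp add: inner_add_right)
  qed
  have "(\<Sum>y\<in>Y. l y * inner (\<nu> y) v) < 0"
    using sum_strict_mono[of Y "\<lambda>y. l y * inner (\<nu> y) v" "\<lambda>_. 0"] Y neg
    by (simp add: mult_less_0_iff)
  moreover have "(\<Sum>y\<in>Y. l y * inner (\<nu> y) v) = inner (\<Sum>y\<in>Y. l y *\<^sub>R \<nu> y) v"
    by (simp add: inner_sum_left)
  ultimately show False
    using Y(5) by simp
qed

text \<open>Shrink the polygon to the largest homothetic copy that still fits into \<open>K\<close>.\<close>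

lemma untranslatable_rescale:
  assumes ys: "set ys \<subseteq> Rn n" "untranslatable n K (set ys)"
  shows "\<exists>zs. set zs \<subseteq> K \<and> untranslatable n K (set zs) \<and> closed_length zs \<le> closed_length ys \<and> zs \<noteq> []"
proof -
  have "ys \<noteq> []"
    using ys(2) Rn_0[of n] by (force simp: untranslatable_def)
  define a where "a = hd ys"
  have a: "a \<in> set ys" "a \<in> Rn n"
    using \<open>ys \<noteq> []\<close> ys(1) by (auto simp: a_def)
  \<comment> \<open>A pair \<open>(r, k)\<close> stands for the copy of the polygon scaled by
    \<open>r\<close> with \<open>a\<close> moved to \<open>k\<close>. The copies that fit into
    \<open>K\<close> form a compact set, and \<open>r \<le> 1\<close> keeps the length from
    growing.\<close>
  define L where "L = ({0..1} \<times> K) \<inter> (\<Inter>y\<in>set ys. (\<lambda>(r, k). k + r *\<^sub>R (y - a)) -` K)"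
  have "closed ((\<lambda>(r :: real, k). k + r *\<^sub>R (y - a)) -` K)" for y
    unfolding case_prod_beta by (intro closed_vimage closed_K continuous_intros)
  then have "compact L"
    unfolding L_def by (intro compact_Int_closed compact_Times compact_K closed_INT) auto
  moreover have "L \<noteq> {}"
  proof -
    have "(0, 0) \<in> L"
      using zero_int in_K by (auto simp: L_def)
    then show ?thesis
      by blast
  qed
  moreover have "continuous_on L fst"
    by (intro continuous_intros)
  ultimately obtain p where p: "p \<in> L" and pmax: "\<forall>q\<in>L. fst q \<le> fst p"
    using continuous_attains_sup[of L fst] by blast
  obtain r k where "p = (r, k)"
    by force
  then have rk: "(r, k) \<in> L"
    using p by simp
  have max: "s \<le> r" if "(s, m) \<in> L" for s m
    using bspec[OF pmax that] \<open>p = (r, k)\<close> by simp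
  define g where "g = (\<lambda>y. k + r *\<^sub>R (y - a))"
  have r: "0 \<le> r" "r \<le> 1" "k \<in> K" and gK: "\<And>y. y \<in> set ys \<Longrightarrow> g y \<in> K"
    using rk by (auto simp: L_def g_def)
  have "untranslatable n K (set (map g ys))"
  proof (cases "r = 1")
    case True
    have "g = (\<lambda>y. y + (k - a))"
      by (auto simp: g_def True)
    then show ?thesis
      using untranslatable_shift[OF ys(2), of "k - a"] a(2) in_Rn[OF r(3)] by (simp add: Rn_diff)
  next
    case False
    \<comment> \<open>If a translate of the largest copy lay in the interior, a slightly larger copy
      would still fit.\<close>
    show ?thesis
    proof (rule untranslatableI)
      fix v assume v: "v \<in> Rn n" "\<forall>y\<in>set (map g ys). y + v \<in> int_n n K"
      have "\<forall>\<^sub>F s in at_right (0::real). \<forall>y\<in>set ys. (g y + v) + s *\<^sub>R (y - a) \<in> int_n n K"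
        using v ys(1) a by (intro eventually_ball_finite ballI eventually_int_n) (auto intro: Rn_diff)
      moreover have "\<forall>\<^sub>F s in at_right (0::real). s \<in> {0<..<1 - r}"
        using False r by (intro eventually_at_right_real) simp
      ultimately have "\<forall>\<^sub>F s in at_right (0::real). s \<in> {0<..<1 - r} \<and> (r + s, k + v) \<in> L"
      proof eventually_elim
        case (elim s)
        have *: "k + v + (r + s) *\<^sub>R (y - a) \<in> K" if "y \<in> set ys" for y
        proof -
          have "k + v + (r + s) *\<^sub>R (y - a) = (g y + v) + s *\<^sub>R (y - a)"
            by (simp add: g_def algebra_simps)
          then show ?thesis
            using elim(1) that in_K by (simp only:)
        qed
        moreover from *[OF a(1)] have "k + v \<in> K"
          by simp
        ultimately show ?case
          using elim(2) r by (simp add: L_def)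
      qed
      from eventually_at_right_witness[OF this]
      obtain s where "s > 0" "(r + s, k + v) \<in> L"
        by auto
      then show False
        using max[of "r + s" "k + v"] by simp
    qed
  qed
  moreover have "closed_length (map g ys) \<le> closed_length ys"
  proof -
    have "closed_length (map g ys) = \<bar>r\<bar> * closed_length ys"
      unfolding g_def by (rule closed_length_affine)
    moreover have "closed_length ys \<ge> 0"
      by (simp add: closed_length_def chain_length_nonneg)
    ultimately show ?thesis
      using r mult_left_le_one_le[of "closed_length ys" r] by simp
  qed
  ultimately show ?thesis
    using gK \<open>ys \<noteq> []\<close> by (intro exI[of _ "map g ys"]) auto
qed

text \<open>Caratheodory's theorem selects the vertices from the contact points. They keep their
  order, so the selected polygon is a subsequence and therefore not longer.\<close>

lemma untranslatable_extract:
  assumes ys: "set ys \<subseteq> K" "untranslatable n K (set ys)"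
  obtains ws l where "subseq ws ys" "distinct ws" "length ws \<le> n + 1" "set ws \<subseteq> bdry_n n K"
    "ws \<noteq> []" "\<forall>y\<in>set ws. l y > (0::real)" "(\<Sum>y\<in>set ws. l y *\<^sub>R \<nu> y) = 0"
proof -
  have "0 \<in> convex hull (\<nu> ` (set ys \<inter> bdry_n n K))"
    using ys by (intro untranslatable_contact) auto
  moreover have "finite (set ys \<inter> bdry_n n K)" "\<And>y. y \<in> set ys \<inter> bdry_n n K \<Longrightarrow> \<nu> y \<in> Rn n"
    using normal_Rn by auto
  ultimately obtain Y l where Y: "Y \<subseteq> set ys \<inter> bdry_n n K" "Y \<noteq> {}" "card Y \<le> n + 1"
    "\<forall>y\<in>Y. l y > (0::real)" "(\<Sum>y\<in>Y. l y *\<^sub>R \<nu> y) = 0"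
    using caratheodory_Rn[of "set ys \<inter> bdry_n n K" \<nu> n] by blast
  define ws where "ws = remdups (filter (\<lambda>x. x \<in> Y) ys)"
  have "subseq ws ys"
    unfolding ws_def by (rule subseq_order.trans[OF subseq_remdups subseq_filter_left])
  moreover have set_ws: "set ws = Y" and dist: "distinct ws"
    using Y(1) by (auto simp: ws_def)
  moreover have "length ws \<le> n + 1"
    using Y(3) distinct_card[OF dist] set_ws by simp
  moreover have "ws \<noteq> []"
    using set_ws Y(2) by auto
  ultimately show thesis
    using that[of ws l] Y by simp
qed

lemma weights_untranslatable:
  assumes "set ws \<subseteq> bdry_n n K" "ws \<noteq> []" "\<forall>y\<in>set ws. l y > (0::real)"
    "(\<Sum>y\<in>set ws. l y *\<^sub>R \<nu> y) = 0"
  shows "untranslatable n K (set ws)"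
proof (rule untranslatable_weights[OF finite_set assms(1) _ assms(3,4)])
  show "\<exists>x\<in>set ws. inner (\<nu> y) x = 1" if "y \<in> set ws" for y
    using that assms(1) normal_one by blast
qed (use assms(2) in simp)

lemma untranslatable_reduce:
  assumes ys: "set ys \<subseteq> Rn n" "untranslatable n K (set ys)"
  shows "\<exists>zs. set zs \<subseteq> K \<and> untranslatable n K (set zs) \<and> closed_length zs \<le> closed_length ys \<and> length zs = n + 1"
proof -
  obtain xs where xs: "set xs \<subseteq> K" "untranslatable n K (set xs)" "closed_length xs \<le> closed_length ys"
    using untranslatable_rescale[OF ys] by blast
  obtain ws l where ws: "subseq ws xs" "distinct ws" "length ws \<le> n + 1" "set ws \<subseteq> bdry_n n K"
    "ws \<noteq> []" "\<forall>y\<in>set ws. l y > (0::real)" "(\<Sum>y\<in>set ws. l y *\<^sub>R \<nu> y) = 0"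
    by (rule untranslatable_extract[OF xs(1,2)])
  define zs where "zs = replicate (n + 1 - length ws) (hd ws) @ ws"
  have "set zs = set ws"
    using \<open>ws \<noteq> []\<close> by (auto simp: zs_def)
  moreover have "length zs = n + 1"
    using ws(3) by (simp add: zs_def)
  moreover have "closed_length zs = closed_length ws"
    unfolding zs_def by (rule closed_length_pad[OF \<open>ws \<noteq> []\<close>])
  moreover have "set ws \<subseteq> K"
    using ws(4) by (auto simp: bdry_eq)
  ultimately show ?thesis
    using xs(3) closed_length_subseq[OF ws(1)] weights_untranslatable[OF ws(4-7)] by (intro exI[of _ zs]) simp
qed

text \<open>Lengths are compared with all polygons in \<open>Rn n\<close>, because a varied vertex
  may leave \<open>K\<close>; the vertex number is then minimal among equally short polygons inside
  \<open>K\<close>.\<close>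

definition shortest_polygon :: "fvec list \<Rightarrow> bool" where
  "shortest_polygon xs \<longleftrightarrow> set xs \<subseteq> K \<and> untranslatable n K (set xs) \<and>
     (\<forall>ys. set ys \<subseteq> Rn n \<longrightarrow> untranslatable n K (set ys) \<longrightarrow> closed_length xs \<le> closed_length ys) \<and>
     (\<forall>ys. set ys \<subseteq> K \<longrightarrow> untranslatable n K (set ys) \<longrightarrow> closed_length ys \<le> closed_length xs \<longrightarrow> length xs \<le> length ys)"

lemma shortest_polygon_exists:
  assumes ys0: "set ys0 \<subseteq> Rn n" "untranslatable n K (set ys0)"
  shows "\<exists>xs. shortest_polygon xs"
proof -
  obtain W where W: "open W" "int_n n K = Rn n \<inter> W"
    using openin_int_n by (metis openin_open)
  \<comment> \<open>A polygon is a function into \<open>K\<close> of which the first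
    \<open>n + 1\<close> values are the vertices. The space of these functions is compact by
    Tychonoff's theorem, and being translatable by a given \<open>v\<close> is an open
    condition.\<close>
  define A where "A = {f :: nat \<Rightarrow> fvec. (\<forall>i. f i \<in> K) \<and> untranslatable n K (f ` {..<n+1})}"
  have "A = (\<Pi>\<^sub>E i\<in>UNIV. K) \<inter> - (\<Union>v\<in>Rn n. \<Inter>i\<in>{..<n+1}. (\<lambda>f. f i + v) -` W)"
  proof (rule set_eqI)
    fix f
    have "(\<forall>y\<in>f ` {..<n+1}. y + v \<in> int_n n K) \<longleftrightarrow> (\<forall>i\<in>{..<n+1}. f i + v \<in> W)"
      if "\<forall>i. f i \<in> K" "v \<in> Rn n" for v
      using that W(2) in_Rn by (auto intro: Rn_add)
    then have "f \<in> A \<longleftrightarrow> (\<forall>i. f i \<in> K) \<and> \<not> (\<exists>v\<in>Rn n. \<forall>i\<in>{..<n+1}. f i + v \<in> W)"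
      unfolding A_def untranslatable_def by blast
    then show "f \<in> A \<longleftrightarrow> f \<in> (\<Pi>\<^sub>E i\<in>UNIV. K) \<inter> - (\<Union>v\<in>Rn n. \<Inter>i\<in>{..<n+1}. (\<lambda>f. f i + v) -` W)"
      by (simp add: PiE_UNIV_domain Pi_iff)
  qed
  moreover have "compact ((\<Pi>\<^sub>E i\<in>UNIV. K) :: (nat \<Rightarrow> fvec) set)"
    using compactin_PiE[of "\<lambda>_::nat. euclidean :: fvec topology" UNIV "\<lambda>_. K"] compact_K
    by (simp add: euclidean_product_topology)
  moreover have "open (\<Union>v\<in>Rn n. \<Inter>i\<in>{..<n+1}. (\<lambda>f :: nat \<Rightarrow> fvec. f i + v) -` W)"
    by (intro open_UN ballI open_INT open_vimage W(1) continuous_intros continuous_on_product_coordinates) simp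
  ultimately have "compact A"
    by (metis compact_Int_closed closed_Compl)
  have to_fun: "\<exists>f\<in>A. closed_length (map f [0..<n+1]) \<le> closed_length ys"
    if ys: "set ys \<subseteq> Rn n" "untranslatable n K (set ys)" for ys
  proof -
    obtain zs where zs: "set zs \<subseteq> K" "untranslatable n K (set zs)" "closed_length zs \<le> closed_length ys" "length zs = n + 1"
      using untranslatable_reduce[OF ys] by blast
    \<comment> \<open>The filler \<open>0\<close> beyond the last vertex must lie in
      \<open>K\<close>, and does as an interior point.\<close>
    define f where "f = (\<lambda>i. if i < n + 1 then zs ! i else 0)"
    have "map f [0..<n+1] = zs"
      using zs(4) by (intro nth_equalityI) (auto simp: f_def simp del: upt_Suc)
    moreover from this have "f ` {..<n+1} = set zs"
      by (metis atLeast_upt set_map)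
    moreover have "\<forall>i. f i \<in> K"
      using zs zero_int in_K by (auto simp: f_def)
    ultimately show ?thesis
      using zs by (intro bexI[of _ f]) (auto simp: A_def simp del: upt_Suc)
  qed
  then have "A \<noteq> {}"
    using ys0 by blast
  from continuous_attains_inf[OF \<open>compact A\<close> this continuous_on_subset[OF continuous_on_closed_length_map subset_UNIV], of "[0..<n+1]"]
  obtain f where f: "f \<in> A" and fmin: "\<forall>g\<in>A. closed_length (map f [0..<n+1]) \<le> closed_length (map g [0..<n+1])"
    by blast
  define m where "m = closed_length (map f [0..<n+1])"
  have m: "m \<le> closed_length ys" if "set ys \<subseteq> Rn n" "untranslatable n K (set ys)" for ys
    using to_fun[OF that] fmin unfolding m_def by force
  \<comment> \<open>A second minimisation, now of the number of vertices among the polygons in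
    \<open>K\<close> of minimal length.\<close>
  define P where "P = (\<lambda>xs. set xs \<subseteq> K \<and> untranslatable n K (set xs) \<and> closed_length xs \<le> m)"
  have "P (map f [0..<n+1])"
    using f by (auto simp: P_def A_def m_def atLeast0LessThan simp del: upt_Suc)
  then obtain xs where xs: "P xs" "\<And>ys. P ys \<Longrightarrow> length xs \<le> length ys"
    using ex_has_least_nat[of P _ length] by blast
  then have "shortest_polygon xs"
    using m sub_Rn unfolding shortest_polygon_def P_def by (meson order_trans)
  then show ?thesis ..
qed

lemma shortest_polygon_rotate:
  assumes "shortest_polygon (xs @ ys)"
  shows "shortest_polygon (ys @ xs)"
  using assms by (auto simp: shortest_polygon_def closed_length_rotate[of ys xs] Un_commute)

end

section \<open>The reflection law\<close>

lemma closed_length_Cons: "zs \<noteq> [] \<Longrightarrow> closed_length (y # zs) = dist y (hd zs) + chain_length zs + dist (last zs) y"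
proof (cases zs rule: rev_cases)
  case (snoc ws z)
  then show ?thesis
    using chain_length_append[of ws z "[y]"] by (cases ws) (auto simp: closed_length_def)
qed simp

lemma closed_length_eq_sum:
  assumes "xs \<noteq> []"
  shows "closed_length xs = (\<Sum>i<length xs. dist (xs ! (i mod length xs)) (xs ! (Suc i mod length xs)))"
proof -
  have "dist ((xs @ [hd xs]) ! i) ((xs @ [hd xs]) ! Suc i) =
      dist (xs ! (i mod length xs)) (xs ! (Suc i mod length xs))" if "i < length xs" for i
    using that by (cases "Suc i = length xs") (auto simp: nth_append hd_conv_nth[OF assms])
  then show ?thesis
    by (simp add: closed_length_def chain_length_eq_sum)
qed

context regular_body
begin

lemma shortest_polygon_length: "shortest_polygon xs \<Longrightarrow> length xs \<ge> 2"
proof (rule ccontr)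
  assume "shortest_polygon xs" and "\<not> length xs \<ge> 2"
  then have nt: "untranslatable n K (set xs)" "set xs \<subseteq> K" and "length xs < 2"
    by (auto simp: shortest_polygon_def)
  then have "xs = [] \<or> (\<exists>x. xs = [x])"
    by (cases xs rule: chain_length.cases) auto
  then show False
  proof (elim disjE exE)
    assume "xs = []"
    then show False
      using untranslatableD[OF nt(1) Rn_0] by simp
  next
    fix x assume "xs = [x]"
    then show False
      using untranslatableD[OF nt(1), of "- x"] nt(2) zero_int in_Rn Rn_neg by auto
  qed
qed

lemma shortest_polygon_not_shorter:
  assumes "shortest_polygon xs" "subseq ys xs" "length ys < length xs"
  shows "\<not> untranslatable n K (set ys)"
proof -
  have "set ys \<subseteq> K"
    using assms(1,2) by (auto simp: shortest_polygon_def dest: list_emb_set)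
  then show ?thesis
    using assms closed_length_subseq[OF assms(2)] unfolding shortest_polygon_def by (meson not_le)
qed

text \<open>The selected vertices form an untranslatable subsequence, which by minimality of the
  vertex number is the whole polygon.\<close>

lemma shortest_polygon_weights:
  assumes "shortest_polygon xs"
  obtains l where "set xs \<subseteq> bdry_n n K" "distinct xs" "\<forall>y\<in>set xs. l y > (0::real)"
    "(\<Sum>y\<in>set xs. l y *\<^sub>R \<nu> y) = 0"
proof -
  have xs: "set xs \<subseteq> K" "untranslatable n K (set xs)"
    using assms by (auto simp: shortest_polygon_def)
  obtain ws l where ws: "subseq ws xs" "distinct ws" "length ws \<le> n + 1" "set ws \<subseteq> bdry_n n K"
    "ws \<noteq> []" "\<forall>y\<in>set ws. l y > (0::real)" "(\<Sum>y\<in>set ws. l y *\<^sub>R \<nu> y) = 0"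
    by (rule untranslatable_extract[OF xs])
  have "\<not> length ws < length xs"
    using shortest_polygon_not_shorter[OF assms ws(1)] weights_untranslatable[OF ws(4-7)] by blast
  then have "ws = xs"
    using ws(1) subseq_same_length list_emb_length[OF ws(1)] by force
  then show thesis
    using that ws by blast
qed

lemma open_edge_int:
  assumes y: "y \<in> bdry_n n K" and b: "b \<in> K" and neg: "inner (\<nu> y) (b - y) < 0"
    and t: "0 < t" "t < 1"
  shows "y + t *\<^sub>R (b - y) \<in> int_n n K"
proof -
  have yK: "y \<in> K"
    using y by (simp add: bdry_eq)
  have "b - y \<in> Rn n"
    using b yK in_Rn by (auto intro: Rn_diff)
  from normal_cone[OF y this neg] obtain d where d: "d > 0" "\<forall>t. 0 < t \<longrightarrow> t < d \<longrightarrow> y + t *\<^sub>R (b - y) \<in> int_n n K"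
    by auto
  define s where "s = min (d / 2) (t / 2)"
  have s: "0 < s" "s < d" "s < t"
    using d(1) t by (auto simp: s_def)
  define z where "z = y + s *\<^sub>R (b - y)"
  have z: "z \<in> int_n n K"
    using d(2) s by (simp add: z_def)
  define r where "r = (t - s) / (1 - s)"
  have r: "0 \<le> r" "r < 1" "s + r * (1 - s) = t"
    using s t by (auto simp: r_def field_simps)
  have "z + r *\<^sub>R (b - z) = y + (s + r * (1 - s)) *\<^sub>R (b - y)"
    by (simp add: z_def algebra_simps)
  then show ?thesis
    using int_segment[OF z b r(1,2)] r(3) by simp
qed

text \<open>\<open>d\<close> is the gradient of the length with respect to \<open>y\<close>. If its
  component \<open>v\<close> tangent to the supporting hyperplane at \<open>y\<close> were nonzero,
  sliding \<open>y\<close> along \<open>- v\<close> in that hyperplane would shorten the polygon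
  without making it translatable.\<close>

lemma shortest_polygon_variation:
  assumes min: "shortest_polygon (y # zs)"
  shows "\<exists>c. sgn (y - last zs) - sgn (hd zs - y) = c *\<^sub>R \<nu> y"
proof -
  obtain l where l: "set (y # zs) \<subseteq> bdry_n n K" "distinct (y # zs)" "\<forall>x\<in>set (y # zs). l x > (0::real)"
    "(\<Sum>x\<in>set (y # zs). l x *\<^sub>R \<nu> x) = 0"
    by (rule shortest_polygon_weights[OF min])
  have "zs \<noteq> []"
    using shortest_polygon_length[OF min] by auto
  define a b N where "a = last zs" and "b = hd zs" and "N = \<nu> y"
  have "a \<in> set zs" "b \<in> set zs"
    using \<open>zs \<noteq> []\<close> by (auto simp: a_def b_def)
  then have ab: "a \<noteq> y" "b \<noteq> y" "a \<in> Rn n" "b \<in> Rn n" "y \<in> Rn n"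
    using l(1,2) bdry_Rn by auto
  have yb: "y \<in> bdry_n n K"
    using l by simp
  note N = normal_Rn[OF yb] normal_one[OF yb]
  have N0: "inner N N \<noteq> 0"
    using N(2) by (auto simp: N_def)
  define d where "d = sgn (y - a) - sgn (b - y)"
  define v where "v = d - (inner N d / inner N N) *\<^sub>R N"
  have Nv: "inner N v = 0"
    using N0 by (simp add: v_def inner_diff_right)
  have vR: "v \<in> Rn n"
    using ab N(1) unfolding v_def d_def sgn_div_norm by (auto simp: N_def intro!: Rn_diff Rn_scale)
  have "v = 0"
  proof (rule ccontr)
    assume "v \<noteq> 0"
    have dv: "inner d v = inner v v"
    proof -
      have "d = v + (inner N d / inner N N) *\<^sub>R N"
        by (simp add: v_def)
      then have "inner d v = inner (v + (inner N d / inner N N) *\<^sub>R N) v"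
        by (rule arg_cong)
      then show ?thesis
        using Nv by (simp add: inner_add_left)
    qed
    define \<phi> where "\<phi> s = norm (y - s *\<^sub>R v - a) + norm (b - (y - s *\<^sub>R v))" for s :: real
    have "(\<phi> has_derivative (\<lambda>h. inner (sgn (y - a)) (- (h *\<^sub>R v)) + inner (sgn (b - y)) (h *\<^sub>R v))) (at 0)"
    proof -
      have n1: "(norm has_derivative (\<lambda>h. inner h (sgn (y - a)))) (at (y - (0::real) *\<^sub>R v - a))"
        and n2: "(norm has_derivative (\<lambda>h. inner h (sgn (b - y)))) (at (b - (y - (0::real) *\<^sub>R v)))"
        using has_derivative_norm[of "y - a"] has_derivative_norm[of "b - y"] ab by auto
      have "((\<lambda>s::real. y - s *\<^sub>R v - a) has_derivative (\<lambda>h. - (h *\<^sub>R v))) (at 0)"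
        "((\<lambda>s::real. b - (y - s *\<^sub>R v)) has_derivative (\<lambda>h. h *\<^sub>R v)) (at 0)"
        by (auto intro!: derivative_eq_intros)
      from has_derivative_add[OF has_derivative_compose[OF this(1) n1] has_derivative_compose[OF this(2) n2]]
      show ?thesis
        by (simp add: \<phi>_def[abs_def] inner_commute)
    qed
    then have "(\<phi> has_real_derivative (- inner v v)) (at 0)"
      unfolding has_field_derivative_def dv[symmetric]
      by (rule has_derivative_eq_rhs) (auto simp: d_def inner_diff_left algebra_simps)
    moreover have "- inner v v < 0"
      using \<open>v \<noteq> 0\<close> by simp
    ultimately obtain e where e: "e > 0" "\<forall>h>0. h < e \<longrightarrow> \<phi> (0 + h) < \<phi> 0"
      using DERIV_neg_dec_right by blast
    define s where "s = e / 2"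
    have less: "\<phi> s < \<phi> 0"
      using e by (simp add: s_def)
    define y' where "y' = y - s *\<^sub>R v"
    \<comment> \<open>The old contact points and weights still serve: \<open>y'\<close> lies on the
      hyperplane at \<open>y\<close>, though perhaps outside \<open>K\<close>.\<close>
    have "untranslatable n K (set (y' # zs))"
    proof (rule untranslatable_weights[OF finite_set l(1) _ l(3,4)])
      fix x assume x: "x \<in> set (y # zs)"
      show "\<exists>z\<in>set (y' # zs). inner (\<nu> x) z = 1"
      proof (cases "x = y")
        case True
        then have "inner (\<nu> x) y' = 1"
          using Nv N(2) by (simp add: y'_def N_def inner_diff_right)
        then show ?thesis
          by auto
      next
        case False
        then show ?thesis
          using x l(1) normal_one by auto
      qed
    qed simp
    moreover have "set (y' # zs) \<subseteq> Rn n"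
      using l(1) bdry_Rn ab vR by (auto simp: y'_def intro!: Rn_diff Rn_scale)
    ultimately have "closed_length (y # zs) \<le> closed_length (y' # zs)"
      using min by (simp add: shortest_polygon_def)
    then show False
      using less \<open>zs \<noteq> []\<close> by (simp add: closed_length_Cons a_def b_def \<phi>_def y'_def dist_norm norm_minus_commute)
  qed
  then have "d = (inner N d / inner N N) *\<^sub>R N"
    by (simp add: v_def)
  then show ?thesis
    unfolding d_def a_def b_def N_def by blast
qed

lemma shortest_polygon_reflection:
  assumes min: "shortest_polygon (y # zs)"
  shows "y \<in> bdry_n n K" "last zs \<noteq> y" "hd zs \<noteq> y"
    "\<exists>c>0. sgn (y - last zs) - sgn (hd zs - y) = c *\<^sub>R \<nu> y"
    "0 < t \<Longrightarrow> t < 1 \<Longrightarrow> y + t *\<^sub>R (hd zs - y) \<in> int_n n K"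
proof -
  obtain l where l: "set (y # zs) \<subseteq> bdry_n n K" "distinct (y # zs)" "\<forall>x\<in>set (y # zs). l x > (0::real)"
    "(\<Sum>x\<in>set (y # zs). l x *\<^sub>R \<nu> x) = 0"
    by (rule shortest_polygon_weights[OF min])
  have "zs \<noteq> []"
    using shortest_polygon_length[OF min] by auto
  define a b N where "a = last zs" and "b = hd zs" and "N = \<nu> y"
  have ab: "a \<noteq> y" "b \<noteq> y" "a \<in> set zs" "b \<in> set zs"
    using l(2) \<open>zs \<noteq> []\<close> by (auto simp: a_def b_def)
  show yb: "y \<in> bdry_n n K" and "last zs \<noteq> y" "hd zs \<noteq> y"
    using l ab by (simp_all add: a_def b_def)
  note N = normal_Rn[OF yb] normal_one[OF yb]
  have abK: "a \<in> K" "b \<in> K"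
    using ab l(1) by (auto simp: bdry_eq)
  define u1 u2 where "u1 = sgn (y - a)" and "u2 = sgn (b - y)"
  have unit: "inner u1 u1 = 1" "inner u2 u2 = 1"
    using ab by (auto simp: u1_def u2_def norm_sgn simp flip: power2_norm_eq_inner)
  obtain c where c: "u1 - u2 = c *\<^sub>R N"
    using shortest_polygon_variation[OF min] unfolding u1_def u2_def a_def b_def N_def by blast
  \<comment> \<open>If \<open>c = 0\<close>, then \<open>y\<close> lies between its neighbours. By
    minimality some translation moves all other vertices into the interior, and by convexity it
    moves \<open>y\<close> there too.\<close>
  have "c \<noteq> 0"
  proof
    assume "c = 0"
    then have eq: "u1 = u2"
      using c by simp
    have "\<not> untranslatable n K (set zs)"
      by (rule shortest_polygon_not_shorter[OF min]) auto
    then obtain v where v: "v \<in> Rn n" "\<forall>x\<in>set zs. x + v \<in> int_n n K"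
      by (auto simp: untranslatable_def)
    define p q where "p = norm (y - a)" and "q = norm (b - y)"
    have pq: "p > 0" "q > 0"
      using ab by (auto simp: p_def q_def)
    have "y - a = p *\<^sub>R u1" "b - y = q *\<^sub>R u2"
      using ab by (simp_all add: p_def q_def u1_def u2_def sgn_div_norm)
    then have e1: "y - a = p *\<^sub>R u1" "b - y = q *\<^sub>R u1"
      by (simp_all add: eq)
    have "(p + q) *\<^sub>R y = q *\<^sub>R a + p *\<^sub>R b"
    proof -
      have "q *\<^sub>R (y - a) = p *\<^sub>R (b - y)"
        by (simp add: e1)
      then show ?thesis
        by (simp add: algebra_simps)
    qed
    then have "(p + q) *\<^sub>R (y + v) = q *\<^sub>R (a + v) + p *\<^sub>R (b + v)"
      by (simp add: algebra_simps)
    then have "(1 / (p + q)) *\<^sub>R ((p + q) *\<^sub>R (y + v)) = (1 / (p + q)) *\<^sub>R (q *\<^sub>R (a + v) + p *\<^sub>R (b + v))"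
      by (rule arg_cong)
    then have "y + v = (q / (p + q)) *\<^sub>R (a + v) + (p / (p + q)) *\<^sub>R (b + v)"
      unfolding scaleR_scaleR scaleR_add_right[of "1 / (p + q)" "q *\<^sub>R (a + v)"] using pq by simp
    also have "\<dots> \<in> int_n n K"
    proof (rule convexD[OF convex_int])
      have "q / (p + q) + p / (p + q) = (q + p) / (p + q)"
        by (rule add_divide_distrib[symmetric])
      then show "q / (p + q) + p / (p + q) = 1"
        using pq by simp
    qed (use v(2) ab pq in auto)
    finally have "\<forall>x\<in>set (y # zs). x + v \<in> int_n n K"
      using v by simp
    then show False
      using min v(1) untranslatableD unfolding shortest_polygon_def by blast
  qed
  have u2: "u2 = u1 - c *\<^sub>R N"
    using c by (simp add: algebra_simps)
  \<comment> \<open>Comparing the norms of the two unit vectors expresses \<open>c\<close> through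
    \<open>inner u1 N\<close>, whose sign is known because \<open>a\<close> lies in
    \<open>K\<close>.\<close>
  then have "inner u2 u2 = inner (u1 - c *\<^sub>R N) (u1 - c *\<^sub>R N)"
    by simp
  also have "\<dots> = inner u1 u1 + c * (c * inner N N - 2 * inner u1 N)"
    by (simp add: inner_diff_left inner_diff_right inner_commute[of N u1] algebra_simps)
  finally have cN: "2 * inner u1 N = c * inner N N"
    using unit \<open>c \<noteq> 0\<close> by simp
  have "inner N u1 \<ge> 0"
    using normal_le[OF yb abK(1)] N(2)
    by (simp add: u1_def sgn_div_norm N_def inner_diff_right)
  then have "c * inner N N \<ge> 0"
    using cN by (simp add: inner_commute)
  moreover have NN: "inner N N > 0"
    using N(2) by (auto simp: N_def)
  ultimately have "c > 0"
    using \<open>c \<noteq> 0\<close> by (simp add: zero_le_mult_iff)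
  then show "\<exists>c>0. sgn (y - last zs) - sgn (hd zs - y) = c *\<^sub>R \<nu> y"
    using c unfolding u1_def u2_def a_def b_def N_def by blast
  assume t: "0 < t" "t < 1"
  \<comment> \<open>The normal component of \<open>u2\<close> is the negative of that of
    \<open>u1\<close>, so the outgoing edge points strictly inwards.\<close>
  have "inner u2 N = inner u1 N - c * inner N N"
    by (simp add: u2 inner_diff_left)
  also have "\<dots> < 0"
    using cN \<open>c > 0\<close> NN mult_pos_pos[OF \<open>c > 0\<close> NN] by linarith
  finally have "inner N (b - y) < 0"
    using ab(2) by (simp add: u2_def sgn_div_norm inner_commute mult_less_0_iff)
  then show "y + t *\<^sub>R (hd zs - y) \<in> int_n n K"
    using open_edge_int[OF yb abK(2) _ t] by (simp add: N_def b_def)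
qed

lemma shortest_polygon_cyclic:
  assumes min: "shortest_polygon xs"
  defines "x \<equiv> \<lambda>i. xs ! (i mod length xs)"
  shows "x i \<in> bdry_n n K" "x (Suc i) \<noteq> x i"
    "\<exists>c>0. sgn (x (Suc i) - x i) - sgn (x (Suc (Suc i)) - x (Suc i)) = c *\<^sub>R \<nu> (x (Suc i))"
    "0 < t \<Longrightarrow> t < 1 \<Longrightarrow> x i + t *\<^sub>R (x (Suc i) - x i) \<in> int_n n K"
proof -
  let ?m = "length xs"
  have m: "?m \<ge> 2"
    by (rule shortest_polygon_length[OF min])
  have rot: "\<exists>y zs. shortest_polygon (y # zs) \<and> y = x (Suc j) \<and> hd zs = x (Suc (Suc j)) \<and> last zs = x j" for j
  proof -
    have "shortest_polygon (rotate (Suc j) xs)"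
      unfolding rotate_drop_take using min by - (rule shortest_polygon_rotate, simp)
    moreover have nth: "rotate (Suc j) xs ! k = x (Suc j + k)" if "k < ?m" for k
      using that by (simp add: x_def nth_rotate del: rotate_Suc)
    moreover obtain y zs where yz: "rotate (Suc j) xs = y # zs"
      using m by (cases "rotate (Suc j) xs") auto
    moreover have len: "length zs = ?m - 1"
      using arg_cong[OF yz, of length] by simp
    moreover have "hd zs = x (Suc (Suc j))"
      using nth[of 1] yz m len by (cases zs) auto
    moreover have "last zs = x j"
    proof -
      have "zs \<noteq> []"
        using len m by auto
      then have "last zs = zs ! (?m - 2)"
        using len by (simp add: last_conv_nth numeral_2_eq_2)
      also have "\<dots> = (y # zs) ! (?m - 1)"
        using m by (simp add: nth_Cons' numeral_2_eq_2)
      also have "\<dots> = x (Suc j + (?m - 1))"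
        unfolding yz[symmetric] using m by (intro nth) simp
      also have "Suc j + (?m - 1) = j + ?m"
        using m by simp
      finally show ?thesis
        by (simp add: x_def)
    qed
    moreover have "y = x (Suc j)"
    proof -
      have "0 < ?m"
        using m by linarith
      from nth[OF this] show ?thesis
        by (simp add: yz del: rotate_Suc)
    qed
    ultimately show ?thesis
      by (intro exI[of _ y] exI[of _ zs]) (simp del: rotate_Suc)
  qed
  \<comment> \<open>A predecessor of \<open>i\<close> modulo the number of vertices, also when
    \<open>i = 0\<close>.\<close>
  define j where "j = i + (?m - 1)"
  have "Suc j = i + ?m" "Suc (Suc j) = Suc i + ?m"
    using m by (simp_all add: j_def)
  then have j: "x (Suc j) = x i" "x (Suc (Suc j)) = x (Suc i)"
    by (simp_all only: x_def mod_add_self2)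
  obtain y zs where y: "shortest_polygon (y # zs)" "y = x i" "hd zs = x (Suc i)"
    using rot[of j] j by metis
  show "x i \<in> bdry_n n K" "x (Suc i) \<noteq> x i"
    "0 < t \<Longrightarrow> t < 1 \<Longrightarrow> x i + t *\<^sub>R (x (Suc i) - x i) \<in> int_n n K"
    using shortest_polygon_reflection[OF y(1)] y(2,3) by auto
  show "\<exists>c>0. sgn (x (Suc i) - x i) - sgn (x (Suc (Suc i)) - x (Suc i)) = c *\<^sub>R \<nu> (x (Suc i))"
    using rot[of i] shortest_polygon_reflection(4) by metis
qed

end

section \<open>Piecewise affine loops\<close>

locale affine_loop =
  fixes z :: "nat \<Rightarrow> 'a::real_normed_vector" and h :: "nat \<Rightarrow> real" and M :: nat
  assumes z_closed: "z M = z 0" and h_pos: "\<And>i. i < M \<Longrightarrow> h i > 0" and h_sum: "(\<Sum>i<M. h i) = 1"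
begin

definition \<tau> :: "nat \<Rightarrow> real" where "\<tau> i = (\<Sum>j<i. h j)"
definition clamp :: "nat \<Rightarrow> real \<Rightarrow> real" where "clamp i s = max 0 (min 1 ((s - \<tau> i) / h i))"
text \<open>In the time of edge \<open>i\<close> the earlier edges contribute fully and the later
  ones not at all. As the clamps are monotone, distances along the curve are bounded by increments
  of one monotone function.\<close>

definition arc :: "real \<Rightarrow> 'a" where "arc s = z 0 + (\<Sum>i<M. clamp i s *\<^sub>R (z (Suc i) - z i))"
definition loop :: "real \<Rightarrow> 'a" where "loop t = arc (frac t)"
definition vel :: "nat \<Rightarrow> 'a" where "vel i = (1 / h i) *\<^sub>R (z (Suc i) - z i)"

lemma \<tau>_0 [simp]: "\<tau> 0 = 0" and \<tau>_Suc: "\<tau> (Suc i) = \<tau> i + h i" and \<tau>_M [simp]: "\<tau> M = 1"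
  using h_sum by (simp_all add: \<tau>_def)

lemma \<tau>_mono: "i \<le> j \<Longrightarrow> j \<le> M \<Longrightarrow> \<tau> i \<le> \<tau> j"
  unfolding \<tau>_def by (rule sum_mono2) (auto intro!: less_imp_le[OF h_pos])

lemma M_pos: "M > 0"
  using h_sum by (cases "M = 0") auto

lemma arc_piece:
  assumes i: "i < M" and s: "\<tau> i \<le> s" "s \<le> \<tau> (Suc i)"
  shows "arc s = z i + (s - \<tau> i) *\<^sub>R vel i"
proof -
  have c1: "clamp j s = 1" if "j < i" for j
  proof -
    have "\<tau> j + h j \<le> s"
      using \<tau>_mono[of "Suc j" i] that i s by (simp add: \<tau>_Suc)
    then have "1 \<le> (s - \<tau> j) / h j"
      using h_pos[of j] that i by (simp add: pos_le_divide_eq)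
    then show ?thesis
      by (simp add: clamp_def)
  qed
  have c0: "clamp j s = 0" if "i < j" "j < M" for j
  proof -
    have "s \<le> \<tau> j"
      using \<tau>_mono[of "Suc i" j] that s by simp
    then have "(s - \<tau> j) / h j \<le> 0"
      using h_pos[of j] that by (simp add: divide_nonpos_pos)
    then show ?thesis
      by (simp add: clamp_def)
  qed
  have ci: "clamp i s = (s - \<tau> i) / h i"
    using s h_pos[OF i] by (simp add: clamp_def \<tau>_Suc pos_divide_le_eq max_def min_def)
  have "(\<Sum>j<M. clamp j s *\<^sub>R (z (Suc j) - z j)) = (\<Sum>j<Suc i. clamp j s *\<^sub>R (z (Suc j) - z j))"
    using i c0 by (intro sum.mono_neutral_right) auto
  also have "\<dots> = (\<Sum>j<i. z (Suc j) - z j) + clamp i s *\<^sub>R (z (Suc i) - z i)"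
    using c1 by simp
  also have "(\<Sum>j<i. z (Suc j) - z j) = z i - z 0"
    by (rule sum_lessThan_telescope)
  finally show ?thesis
    by (simp add: arc_def ci vel_def)
qed

lemma arc_1: "arc 1 = arc 0"
proof -
  obtain i where i: "M = Suc i"
    using M_pos gr0_implies_Suc by blast
  have "\<tau> (Suc i) = 1" "i < M"
    using \<tau>_M by (simp_all only: i lessI)
  then have "arc 1 = z i + (\<tau> (Suc i) - \<tau> i) *\<^sub>R vel i"
    using arc_piece[of i 1] \<tau>_mono[of i M] by simp
  also have "\<dots> = z (Suc i)"
    using h_pos[OF \<open>i < M\<close>] by (simp add: \<tau>_Suc vel_def)
  also have "\<dots> = z M"
    by (simp only: i)
  also have "\<dots> = arc 0"
    using arc_piece[of 0 0] M_pos h_pos[of 0] z_closed \<tau>_mono[of 0 "Suc 0"] by simp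
  finally show ?thesis .
qed

lemma loop_arc: "0 \<le> s \<Longrightarrow> s \<le> 1 \<Longrightarrow> loop (of_int k + s) = arc s"
proof (cases "s = 1")
  case True
  then have "frac (of_int k + s) = 0"
    by (simp add: frac_eq_0_iff)
  then show ?thesis
    using True arc_1 by (simp add: loop_def)
next
  case False
  assume "0 \<le> s" "s \<le> 1"
  then have "frac (of_int k + s) = s"
    using False by (simp add: frac_unique_iff)
  then show ?thesis
    by (simp add: loop_def)
qed

lemma loop_piece:
  assumes "i < M" "\<tau> i \<le> s" "s \<le> \<tau> (Suc i)"
  shows "loop (of_int k + s) = z i + (s - \<tau> i) *\<^sub>R vel i"
  using assms \<tau>_mono[of 0 i] \<tau>_mono[of "Suc i" M] by (subst loop_arc) (auto simp: arc_piece)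

lemma loop_start: "i < M \<Longrightarrow> loop (of_int k + \<tau> i) = z i"
  using loop_piece[of i "\<tau> i" k] h_pos[of i] by (simp add: \<tau>_Suc)

lemma loop_end: "i < M \<Longrightarrow> loop (of_int k + \<tau> (Suc i)) = z (Suc i)"
  using loop_piece[of i "\<tau> (Suc i)" k] h_pos[of i] by (simp add: \<tau>_Suc vel_def)

lemma loop_periodic: "loop (t + 1) = loop t"
  by (simp add: loop_def frac_1_eq)

text \<open>A vertex is described twice, as the start of a piece for the right derivative and as the
  end of the preceding piece for the left one. At an integer the preceding piece is the last of the
  previous period.\<close>

lemma piece_cases:
  obtains (inner) k i s where "i < M" "\<tau> i < s" "s < \<tau> (Suc i)" "t = of_int k + s"
  | (vertex) k i k' i' where "i < M" "t = of_int k + \<tau> i" "i' < M" "t = of_int k' + \<tau> (Suc i')"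
proof -
  define s where "s = frac t"
  have s: "0 \<le> s" "s < 1" and t: "t = of_int \<lfloor>t\<rfloor> + s"
    by (simp add: s_def, simp add: s_def frac_lt_1, simp add: s_def frac_def)
  define j where "j = (LEAST j. s < \<tau> j)"
  have "s < \<tau> M"
    using s by simp
  then have j: "s < \<tau> j" "j \<le> M"
    unfolding j_def by (rule LeastI, rule Least_le)
  have "j \<noteq> 0"
    using j s by (metis \<tau>_0 not_le)
  then obtain i where i: "j = Suc i"
    using not0_implies_Suc by blast
  then have "\<tau> i \<le> s"
    using not_less_Least[of i "\<lambda>j. s < \<tau> j"] by (simp add: j_def not_less)
  show thesis
  proof (cases "\<tau> i = s")
    case False
    then show ?thesis
      using inner[of i s "\<lfloor>t\<rfloor>"] i j t \<open>\<tau> i \<le> s\<close> by simp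
  next
    case True
    show ?thesis
    proof (cases i)
      case 0
      then have "t = of_int (\<lfloor>t\<rfloor> - 1) + \<tau> (Suc (M - 1))"
        using t True M_pos by simp
      then show ?thesis
        using vertex[of i "\<lfloor>t\<rfloor>" "M - 1" "\<lfloor>t\<rfloor> - 1"] i j t True M_pos by simp
    next
      case (Suc i')
      then show ?thesis
        using vertex[of i "\<lfloor>t\<rfloor>" i' "\<lfloor>t\<rfloor>"] i j t True by simp
    qed
  qed
qed

lemma affine_deriv: "((\<lambda>t. z i + (t - a) *\<^sub>R v) has_vector_derivative v) (at t within S)"
  by (auto intro!: derivative_eq_intros)

lemma loop_deriv_right:
  assumes i: "i < M" "\<tau> i \<le> s" "s < \<tau> (Suc i)"
  shows "(loop has_vector_derivative vel i) (at_right (of_int k + s))"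
proof -
  let ?t = "of_int k + s"
  have "((\<lambda>t. z i + (t - (of_int k + \<tau> i)) *\<^sub>R vel i) has_vector_derivative vel i) (at ?t within {?t..})"
    by (rule affine_deriv)
  then have "(loop has_vector_derivative vel i) (at ?t within {?t..})"
  proof (rule has_vector_derivative_transform_within[where d = "\<tau> (Suc i) - s"])
    fix t assume "t \<in> {?t..}" "dist t ?t < \<tau> (Suc i) - s"
    then show "z i + (t - (of_int k + \<tau> i)) *\<^sub>R vel i = loop t"
      using loop_piece[of i "t - of_int k" k] i by (simp add: dist_real_def algebra_simps)
  qed (use i in auto)
  then show ?thesis
    by (rule has_vector_derivative_within_subset) auto
qed

lemma loop_deriv_left:
  assumes i: "i < M" "\<tau> i < s" "s \<le> \<tau> (Suc i)"
  shows "(loop has_vector_derivative vel i) (at_left (of_int k + s))"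
proof -
  let ?t = "of_int k + s"
  have "((\<lambda>t. z i + (t - (of_int k + \<tau> i)) *\<^sub>R vel i) has_vector_derivative vel i) (at ?t within {..?t})"
    by (rule affine_deriv)
  then have "(loop has_vector_derivative vel i) (at ?t within {..?t})"
  proof (rule has_vector_derivative_transform_within[where d = "s - \<tau> i"])
    fix t assume "t \<in> {..?t}" "dist t ?t < s - \<tau> i"
    then show "z i + (t - (of_int k + \<tau> i)) *\<^sub>R vel i = loop t"
      using loop_piece[of i "t - of_int k" k] i by (simp add: dist_real_def algebra_simps)
  qed (use i in auto)
  then show ?thesis
    by (rule has_vector_derivative_within_subset) auto
qed

lemma loop_deriv:
  assumes i: "i < M" "\<tau> i < s" "s < \<tau> (Suc i)"
  shows "(loop has_vector_derivative vel i) (at (of_int k + s))"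
proof -
  let ?t = "of_int k + s"
  have "((\<lambda>t. z i + (t - (of_int k + \<tau> i)) *\<^sub>R vel i) has_vector_derivative vel i) (at ?t)"
    by (rule affine_deriv)
  then show ?thesis
  proof (rule has_vector_derivative_transform_within[where d = "min (s - \<tau> i) (\<tau> (Suc i) - s)"])
    fix t assume "dist t ?t < min (s - \<tau> i) (\<tau> (Suc i) - s)"
    then have "\<tau> i \<le> t - of_int k" "t - of_int k \<le> \<tau> (Suc i)"
      by (auto simp: dist_real_def)
    then show "z i + (t - (of_int k + \<tau> i)) *\<^sub>R vel i = loop t"
      using loop_piece[of i "t - of_int k" k] i by (simp add: diff_diff_eq)
  qed (use i in auto)
qed

lemma loop_smooth_near:
  assumes i: "i < M" "\<tau> i < s" "s < \<tau> (Suc i)"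
  shows "smooth_near loop (of_int k + s)"
proof -
  define D where "D = (\<lambda>j::nat. if j = 0 then loop else if j = 1 then (\<lambda>_. vel i) else (\<lambda>_. 0))"
  define e where "e = min (s - \<tau> i) (\<tau> (Suc i) - s)"
  have "(D j has_vector_derivative D (Suc j) r) (at r)"
    if "r \<in> {of_int k + s - e<..<of_int k + s + e}" for j r
  proof -
    have "(loop has_vector_derivative vel i) (at (of_int k + (r - of_int k)))"
      using i(1) that by (intro loop_deriv) (auto simp: e_def)
    then show ?thesis
      by (auto simp: D_def)
  qed
  moreover have "e > 0" "D 0 = loop"
    using i by (auto simp: e_def D_def)
  ultimately show ?thesis
    unfolding smooth_near_def by blast
qed

lemma loop_piecewise_smooth: "piecewise_smooth_loop loop"
  unfolding piecewise_smooth_loop_def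
proof (intro conjI allI)
  have left: "\<exists>v. (loop has_vector_derivative v) (at_left t)" for t
  proof (cases t rule: piece_cases)
    case (inner k i s)
    then show ?thesis
      using loop_deriv_left[of i s k] by auto
  next
    case (vertex k i k' i')
    then show ?thesis
      using loop_deriv_left[of i' "\<tau> (Suc i')" k'] h_pos[of i'] by (auto simp: \<tau>_Suc)
  qed
  have right: "\<exists>v. (loop has_vector_derivative v) (at_right t)" for t
  proof (cases t rule: piece_cases)
    case (inner k i s)
    then show ?thesis
      using loop_deriv_right[of i s k] by auto
  next
    case (vertex k i k' i')
    then show ?thesis
      using loop_deriv_right[of i "\<tau> i" k] h_pos[of i] by (auto simp: \<tau>_Suc)
  qed
  show "\<exists>v. (loop has_vector_derivative v) (at_left t)" "\<exists>v. (loop has_vector_derivative v) (at_right t)" for t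
    by (rule left, rule right)
  show "continuous_on UNIV loop"
    unfolding continuous_on_eq_continuous_within
    using left right has_vector_derivative_continuous by (metis continuous_at_split)
  let ?N = "\<Union>(range (\<lambda>(k::int, i). {of_int k + \<tau> i}))"
  have "negligible ?N"
    by (rule negligible_countable_Union) auto
  moreover have "smooth_near loop t" if "t \<notin> ?N" for t
    using that by (cases t rule: piece_cases) (auto intro: loop_smooth_near)
  ultimately show "\<exists>N. negligible N \<and> (\<forall>t. t \<notin> N \<longrightarrow> smooth_near loop t)"
    by blast
qed (rule loop_periodic)

lemma clamp_mono: "i < M \<Longrightarrow> s \<le> t \<Longrightarrow> clamp i s \<le> clamp i t"
  unfolding clamp_def using h_pos[of i]
  by (intro max.mono min.mono divide_right_mono) auto

lemma arc_dist:
  assumes "s \<le> t"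
  shows "dist (arc s) (arc t) \<le> (\<Sum>i<M. clamp i t * dist (z i) (z (Suc i))) - (\<Sum>i<M. clamp i s * dist (z i) (z (Suc i)))"
proof -
  have "arc t - arc s = (\<Sum>i<M. (clamp i t - clamp i s) *\<^sub>R (z (Suc i) - z i))"
    by (simp add: arc_def scaleR_diff_left sum_subtractf)
  then have "dist (arc s) (arc t) = norm (\<Sum>i<M. (clamp i t - clamp i s) *\<^sub>R (z (Suc i) - z i))"
    by (simp only: dist_norm norm_minus_commute[of "arc s"])
  also have "\<dots> \<le> (\<Sum>i<M. norm ((clamp i t - clamp i s) *\<^sub>R (z (Suc i) - z i)))"
    by (rule norm_sum)
  also have "\<dots> = (\<Sum>i<M. (clamp i t - clamp i s) * dist (z i) (z (Suc i)))"
    using clamp_mono assms by (intro sum.cong) (auto simp: dist_norm norm_minus_commute)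
  finally show ?thesis
    by (simp add: left_diff_distrib sum_subtractf)
qed

text \<open>The bounds of \<open>arc_dist\<close> telescope. The bounds on \<open>S\<close> hold at
  every argument, so the unspecified \<open>ts ! 0\<close> of an empty list does no harm.\<close>

lemma arc_chain:
  assumes ts: "sorted ts" "set ts \<subseteq> {0..1}"
  shows "(\<Sum>i<length ts - 1. dist (loop (ts ! i)) (loop (ts ! Suc i))) \<le> (\<Sum>i<M. dist (z i) (z (Suc i)))"
proof -
  define S where "S t = (\<Sum>i<M. clamp i t * dist (z i) (z (Suc i)))" for t
  have S: "0 \<le> S t" "S t \<le> (\<Sum>i<M. dist (z i) (z (Suc i)))" for t
    unfolding S_def by (auto intro!: sum_nonneg sum_mono mult_left_le_one_le simp: clamp_def)
  have "(\<Sum>i<length ts - 1. dist (loop (ts ! i)) (loop (ts ! Suc i))) \<le> (\<Sum>i<length ts - 1. S (ts ! Suc i) - S (ts ! i))"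
  proof (rule sum_mono)
    fix i assume "i \<in> {..<length ts - 1}"
    then have i: "Suc i < length ts"
      by auto
    then have "ts ! i \<le> ts ! Suc i" "ts ! i \<in> {0..1}" "ts ! Suc i \<in> {0..1}"
      using ts(1) sorted_nth_mono[of ts i "Suc i"] subsetD[OF ts(2) nth_mem[of i]]
        subsetD[OF ts(2) nth_mem[of "Suc i"]] by auto
    then show "dist (loop (ts ! i)) (loop (ts ! Suc i)) \<le> S (ts ! Suc i) - S (ts ! i)"
      using arc_dist[of "ts ! i" "ts ! Suc i"] loop_arc[of _ 0] by (simp add: S_def)
  qed
  also have "\<dots> = S (ts ! (length ts - 1)) - S (ts ! 0)"
    by (rule sum_lessThan_telescope)
  also have "\<dots> \<le> (\<Sum>i<M. dist (z i) (z (Suc i)))"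
    using S(1)[of "ts ! 0"] S(2)[of "ts ! (length ts - 1)"] by linarith
  finally show ?thesis .
qed

end

lemma affine_loop_length:
  fixes z :: "nat \<Rightarrow> fvec"
  assumes "affine_loop z h M"
  shows "loop_length (affine_loop.loop z h M) \<le> ennreal (\<Sum>i<M. dist (z i) (z (Suc i)))"
  unfolding loop_length_def
proof (rule SUP_least)
  fix ts :: "real list"
  interpret affine_loop z h M by fact
  assume "ts \<in> {ts. sorted ts \<and> set ts \<subseteq> {0..1}}"
  then show "(\<Sum>i<length ts - 1. ennreal (dist (loop (ts ! i)) (loop (ts ! Suc i)))) \<le> ennreal (\<Sum>i<M. dist (z i) (z (Suc i)))"
    using arc_chain[of ts] by (subst sum_ennreal) (auto intro: ennreal_leI)
qed

section \<open>From a shortest polygon to a trajectory\<close>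

lemma unit_ball_eq: "unit_ball n = {p \<in> Rn n. norm p \<le> 1}"
  by (auto simp: unit_ball_def)

lemma closed_unit_ball: "closed (unit_ball n)"
  by (auto simp: unit_ball_def intro: closed_Int closed_Rn)

lemma int_unit_ball: "int_n n (unit_ball n) = {p \<in> Rn n. norm p < 1}"
proof (intro set_eqI iffI)
  fix p assume p: "p \<in> int_n n (unit_ball n)"
  then have pR: "p \<in> Rn n" "norm p \<le> 1"
    using int_n_subset by (auto simp: unit_ball_eq)
  have "norm p < 1"
  proof (rule ccontr)
    assume "\<not> norm p < 1"
    then have np: "norm p = 1"
      using pR by simp
    obtain e where e: "e > 0" "\<And>y. y \<in> Rn n \<Longrightarrow> norm (y - p) < e \<Longrightarrow> y \<in> unit_ball n"
      using p by (rule mem_int_nE) blast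
    have "p + (e / 2) *\<^sub>R p \<in> unit_ball n"
      using e(1) pR np by (intro e(2)) (auto intro: Rn_add Rn_scale)
    then have "norm ((1 + e / 2) *\<^sub>R p) \<le> 1"
      by (simp add: unit_ball_eq scaleR_add_left)
    then show False
      using e(1) np by simp
  qed
  with pR show "p \<in> {p \<in> Rn n. norm p < 1}"
    by simp
next
  fix p assume p: "p \<in> {p \<in> Rn n. norm p < 1}"
  show "p \<in> int_n n (unit_ball n)"
  proof (rule mem_int_nI)
    show "p \<in> Rn n" "1 - norm p > 0"
      using p by auto
    fix y assume "y \<in> Rn n" "norm (y - p) < 1 - norm p"
    then show "y \<in> unit_ball n"
      using norm_triangle_sub[of y p] by (simp add: unit_ball_eq)
  qed
qed

lemma bdry_unit_ball: "bdry_n n (unit_ball n) = {p \<in> Rn n. norm p = 1}"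
proof -
  have "bdry_n n (unit_ball n) = unit_ball n - int_n n (unit_ball n)"
    by (rule bdry_n_eq[OF closed_unit_ball]) (auto simp: unit_ball_eq)
  also have "\<dots> = {p \<in> Rn n. norm p = 1}"
    unfolding int_unit_ball unfolding unit_ball_eq by auto
  finally show ?thesis .
qed

lemma (in convex_body_n) frontier_times_unit_ball:
  "top_of_set (Rn n \<times> Rn n) frontier_of (K \<times> unit_ball n) =
     (K \<times> unit_ball n) - int_n n K \<times> int_n n (unit_ball n)"
proof -
  have "closedin (top_of_set (Rn n \<times> Rn n)) (K \<times> unit_ball n)"
    using sub_Rn by (intro closed_subset closed_Times closed_K closed_unit_ball) (auto simp: unit_ball_eq)
  then have "top_of_set (Rn n \<times> Rn n) closure_of (K \<times> unit_ball n) = K \<times> unit_ball n"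
    by (rule closure_of_closedin)
  moreover have "top_of_set (Rn n \<times> Rn n) interior_of (K \<times> unit_ball n) = int_n n K \<times> int_n n (unit_ball n)"
    unfolding int_n_def by (metis interior_of_Times prod_topology_subtopology_eu)
  ultimately show ?thesis
    by (simp add: frontier_of_def)
qed

lemma sum_even_odd: "(\<Sum>i<2 * m. f i) = (\<Sum>j<m. f (2 * j) + f (Suc (2 * j)))" for f :: "nat \<Rightarrow> 'a::comm_monoid_add"
  by (induction m) (simp_all add: add.assoc)

lemma sum_cyclic_shift: "f m = f 0 \<Longrightarrow> (\<Sum>j<m. f (Suc j)) = (\<Sum>j<m. f j)" for f :: "nat \<Rightarrow> real"
  using sum.lessThan_Suc_shift[of f m] by simp

lemma fst_affine_loop:
  "fst (affine_loop.loop z h M t) = affine_loop.loop (\<lambda>i. fst (z i)) h M t"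
  if "affine_loop z h M" "affine_loop (\<lambda>i. fst (z i)) h M"
  using that by (simp add: affine_loop.loop_def affine_loop.arc_def affine_loop.clamp_def affine_loop.\<tau>_def fst_sum)

text \<open>Strict convexity of the ball: while \<open>q\<close> rests at a vertex, \<open>p\<close>
  runs along a chord of the unit sphere and must be in the open ball meanwhile.\<close>

lemma norm_less_1_segment:
  fixes a b :: "'a::real_inner"
  assumes "norm a = 1" "norm b = 1" "a \<noteq> b" "0 < r" "r < 1"
  shows "norm (a + r *\<^sub>R (b - a)) < 1"
proof -
  have "inner a a = 1" "inner b b = 1"
    using assms by (simp_all flip: power2_norm_eq_inner)
  then have "inner (b - a) (b - a) = 2 - 2 * inner a b"
    and "inner (a + r *\<^sub>R (b - a)) (a + r *\<^sub>R (b - a)) = 1 - r * (1 - r) * (2 - 2 * inner a b)"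
    by (simp_all add: inner_diff_left inner_diff_right inner_add_left inner_add_right
        inner_commute[of b a] algebra_simps)
  moreover have "inner (b - a) (b - a) > 0"
    using assms by simp
  moreover have "r * (1 - r) > 0"
    using assms by simp
  ultimately have "(norm (a + r *\<^sub>R (b - a)))\<^sup>2 < 1"
    by (simp add: power2_norm_eq_inner)
  then show ?thesis
    by (simp add: power_less_one_iff)
qed

context regular_body
begin

text \<open>In phase space the edges alternate. At a vertex \<open>q\<close> rests while
  \<open>p\<close> moves between two negated edge directions, by the reflection law along the
  normal; then \<open>p\<close> rests while \<open>q\<close> runs along an edge. The durations are
  chosen so that one constant \<open>d\<close> serves both laws of motion.\<close>

lemma shortest_polygon_trajectory:
  assumes min: "shortest_polygon xs"
  shows "\<exists>q p. closed_KB_trajectory n K (\<lambda>t. (q t, p t)) \<and> loop_length q \<le> ennreal (closed_length xs)"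
proof -
  define m where "m = length xs"
  define x where "x i = xs ! (i mod length xs)" for i
  note cyc = shortest_polygon_cyclic[OF min, folded x_def]
  have m: "m \<ge> 2"
    using shortest_polygon_length[OF min] by (simp add: m_def)
  have x_per: "x (i + m) = x i" for i
    by (simp add: x_def m_def)
  define u where "u i = sgn (x (Suc i) - x i)" for i
  have "\<forall>i. \<exists>c. c > 0 \<and> u i - u (Suc i) = c *\<^sub>R \<nu> (x (Suc i))"
    using cyc(3) by (auto simp: u_def)
  from choice[OF this] obtain a where a: "\<And>i. a i > 0" "\<And>i. u i - u (Suc i) = a i *\<^sub>R \<nu> (x (Suc i))"
    by auto
  have xb: "x i \<in> bdry_n n K" for i
    by (rule cyc)
  have xR: "x i \<in> Rn n" "x i \<in> K" for i
    using xb[of i] in_Rn by (auto simp: bdry_eq)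
  have u1: "norm (u i) = 1" "u i \<in> Rn n" for i
    using cyc(2)[of i] xR by (auto simp: u_def norm_sgn sgn_div_norm intro!: Rn_scale Rn_diff)
  have u_ne: "u i \<noteq> u (Suc i)" for i
    using a[of i] normal_one[OF xb, of "Suc i"] by auto
  define e where "e i = dist (x (Suc i)) (x (Suc (Suc i)))" for i
  have e: "e i > 0" for i
    using cyc(2)[of "Suc i"] by (simp add: e_def)
  \<comment> \<open>The total time at velocities equal to the normals and the unit edge directions;
    dividing by it makes the period 1 and the speed factor \<open>d\<close>.\<close>
  define d where "d = (\<Sum>j<m. a j + e j)"
  have d: "d > 0"
    unfolding d_def using m a e by (intro sum_pos) (auto simp: lessThan_empty_iff intro: add_pos_pos)
  \<comment> \<open>Even indices begin a bounce, odd ones a flight. The minus sign comes from the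
    law that \<open>q\<close> moves in the direction \<open>- p\<close>.\<close>
  define z where "z i = (x (Suc (i div 2)), - u ((i + 1) div 2))" for i
  define h where "h i = (if even i then a (i div 2) else e (i div 2)) / d" for i
  have z_even: "z (2 * j) = (x (Suc j), - u j)" and z_odd: "z (Suc (2 * j)) = (x (Suc j), - u (Suc j))" for j
    by (simp_all add: z_def)
  have h_even: "h (2 * j) = a j / d" and h_odd: "h (Suc (2 * j)) = e j / d" for j
    by (simp_all add: h_def)
  have loop: "affine_loop z h (2 * m)"
  proof
    show "z (2 * m) = z 0"
      using x_per[of 0] x_per[of 1] by (simp add: z_even z_def u_def)
    show "h i > 0" for i
      using a e d by (simp add: h_def)
    have "(\<Sum>i<2 * m. h i) = (\<Sum>j<m. (a j + e j) / d)"
      by (simp add: sum_even_odd h_even h_odd add_divide_distrib)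
    also have "\<dots> = 1"
      using d by (simp add: d_def flip: sum_divide_distrib)
    finally show "(\<Sum>i<2 * m. h i) = 1" .
  qed
  interpret L: affine_loop z h "2 * m" by (rule loop)
  have vel_even: "L.vel (2 * j) = (0, d *\<^sub>R \<nu> (x (Suc j)))" for j
  proof -
    have "L.vel (2 * j) = (d / a j) *\<^sub>R (z (Suc (2 * j)) - z (2 * j))"
      by (simp add: L.vel_def h_even)
    also have "z (Suc (2 * j)) - z (2 * j) = (0, u j - u (Suc j))"
      by (simp add: z_even z_odd)
    finally show ?thesis
      using a(1)[of j] by (simp add: a(2))
  qed
  have vel_odd: "L.vel (Suc (2 * j)) = (d *\<^sub>R u (Suc j), 0)" for j
  proof -
    have "L.vel (Suc (2 * j)) = (d / e j) *\<^sub>R (z (2 * Suc j) - z (Suc (2 * j)))"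
      by (simp add: L.vel_def h_odd)
    also have "z (2 * Suc j) - z (Suc (2 * j)) = (x (Suc (Suc j)) - x (Suc j), 0)"
      unfolding z_even z_odd by simp
    also have "x (Suc (Suc j)) - x (Suc j) = e j *\<^sub>R u (Suc j)"
      using e[of j] by (simp add: u_def e_def sgn_div_norm dist_norm norm_minus_commute)
    finally show ?thesis
      using e[of j] by simp
  qed
  have grad: "gradient_n n norm (- u i) = - u i" for i
    using u1[of i] by (subst gradient_norm) (auto intro: Rn_neg)
  have z_bdry: "z i \<in> bdry_n n K \<times> bdry_n n (unit_ball n)" for i
    using xb u1 by (auto simp: z_def bdry_unit_ball intro: Rn_neg)
  have coneI: "v \<in> bounce_cone n K (y, - u i)"
    if "v = (d *\<^sub>R u i, 0) \<or> v = (0, d *\<^sub>R \<nu> y)" for v y i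
    unfolding bounce_cone_def using that
  proof (elim disjE)
    assume "v = (d *\<^sub>R u i, 0)"
    then show "v \<in> {\<alpha> *\<^sub>R (- gradient_n n norm (snd (y, - u i)), 0) + \<beta> *\<^sub>R (0, gradient_n n (gauge_fun K) (fst (y, - u i))) |\<alpha> \<beta>.
        0 \<le> \<alpha> \<and> 0 \<le> \<beta> \<and> (\<alpha>, \<beta>) \<noteq> (0, 0)}"
      using d by (intro CollectI exI[of _ d] exI[of _ 0]) (auto simp: grad)
  next
    assume "v = (0, d *\<^sub>R \<nu> y)"
    then show "v \<in> {\<alpha> *\<^sub>R (- gradient_n n norm (snd (y, - u i)), 0) + \<beta> *\<^sub>R (0, gradient_n n (gauge_fun K) (fst (y, - u i))) |\<alpha> \<beta>.
        0 \<le> \<alpha> \<and> 0 \<le> \<beta> \<and> (\<alpha>, \<beta>) \<noteq> (0, 0)}"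
      using d by (intro CollectI exI[of _ 0] exI[of _ d]) (auto simp: \<nu>_def)
  qed
  have cone_start: "L.vel i \<in> bounce_cone n K (z i)" for i
  proof (cases "even i")
    case True
    then obtain j where "i = 2 * j"
      by (elim evenE)
    then show ?thesis
      by (simp add: vel_even z_even coneI)
  next
    case False
    then obtain j where "i = Suc (2 * j)"
      by (metis oddE Suc_eq_plus1)
    then show ?thesis
      by (simp add: vel_odd z_odd coneI)
  qed
  have cone_end: "L.vel i \<in> bounce_cone n K (z (Suc i))" for i
  proof (cases "even i")
    case True
    then obtain j where "i = 2 * j"
      by (elim evenE)
    then show ?thesis
      by (simp add: vel_even z_odd coneI)
  next
    case False
    then obtain j where "i = Suc (2 * j)"
      by (metis oddE Suc_eq_plus1)
    then show ?thesis
      using z_even[of "Suc j"] by (simp add: vel_odd coneI)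
  qed
  \<comment> \<open>Inside an edge exactly one component is on its boundary: \<open>p\<close> is in
    the open ball by strict convexity, or \<open>q\<close> is in the interior by the reflection
    law.\<close>
  have flight: "L.loop t \<in> int_n n K \<times> bdry_n n (unit_ball n) \<and>
        (L.loop has_vector_derivative d *\<^sub>R (- gradient_n n norm (snd (L.loop t)), 0)) (at t) \<or>
      L.loop t \<in> bdry_n n K \<times> int_n n (unit_ball n) \<and>
        (L.loop has_vector_derivative d *\<^sub>R (0, gradient_n n (gauge_fun K) (fst (L.loop t)))) (at t)"
    if i: "i < 2 * m" "L.\<tau> i < s" "s < L.\<tau> (Suc i)" and t: "t = of_int k + s" for t i s k
  proof -
    define r where "r = (s - L.\<tau> i) / h i"
    have hi: "h i > 0"
      by (rule L.h_pos[OF i(1)])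
    have r: "0 < r" "r < 1"
      using i hi by (auto simp: r_def L.\<tau>_Suc pos_divide_less_eq)
    have lt: "L.loop t = z i + r *\<^sub>R (z (Suc i) - z i)"
      using L.loop_piece[of i s k] i by (simp add: t L.vel_def r_def)
    have der: "(L.loop has_vector_derivative L.vel i) (at t)"
      unfolding t by (rule L.loop_deriv[OF i])
    show ?thesis
    proof (cases "even i")
      case True
      then obtain j where j: "i = 2 * j"
        by (elim evenE)
      define w where "w = - u j + r *\<^sub>R (- u (Suc j) - - u j)"
      have l: "L.loop t = (x (Suc j), w)"
        unfolding lt j z_even z_odd by (simp add: w_def)
      have "norm w < 1"
        unfolding w_def using u1 u_ne[of j] r by (intro norm_less_1_segment) auto
      moreover have "w \<in> Rn n"
        unfolding w_def using u1 by (intro Rn_add Rn_scale Rn_diff Rn_neg) auto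
      ultimately show ?thesis
        using der xb by (simp add: l int_unit_ball j vel_even \<nu>_def)
    next
      case False
      then obtain j where j: "i = Suc (2 * j)"
        by (metis oddE Suc_eq_plus1)
      define y where "y = x (Suc j) + r *\<^sub>R (x (Suc (Suc j)) - x (Suc j))"
      have l: "L.loop t = (y, - u (Suc j))"
        using z_even[of "Suc j"] unfolding lt j z_odd by (simp add: y_def)
      have "y \<in> int_n n K"
        unfolding y_def by (rule cyc(4)[OF r])
      then show ?thesis
        using der u1 by (simp add: l bdry_unit_ball j vel_odd grad Rn_neg)
    qed
  qed
  have KB: "bdry_n n K \<times> bdry_n n (unit_ball n) \<subseteq> (K \<times> unit_ball n) - int_n n K \<times> int_n n (unit_ball n)"
    "int_n n K \<times> bdry_n n (unit_ball n) \<subseteq> (K \<times> unit_ball n) - int_n n K \<times> int_n n (unit_ball n)"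
    "bdry_n n K \<times> int_n n (unit_ball n) \<subseteq> (K \<times> unit_ball n) - int_n n K \<times> int_n n (unit_ball n)"
    unfolding bdry_unit_ball int_unit_ball unfolding unit_ball_eq using in_K by (auto simp: bdry_eq)
  have excl: "w \<notin> bdry_n n K \<times> int_n n (unit_ball n)" if "w \<in> int_n n K \<times> bdry_n n (unit_ball n)" for w
    using that by (auto simp: bdry_eq)
  have excl': "w \<notin> int_n n K \<times> bdry_n n (unit_ball n)" "w \<notin> bdry_n n K \<times> int_n n (unit_ball n)"
    if "w \<in> bdry_n n K \<times> bdry_n n (unit_ball n)" for w
    using that by (auto simp: bdry_eq bdry_unit_ball int_unit_ball)
  have traj: "closed_KB_trajectory n K L.loop"
    unfolding closed_KB_trajectory_def
  proof (intro conjI)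
    show "piecewise_smooth_loop L.loop"
      by (rule L.loop_piecewise_smooth)
    show "\<forall>t. L.loop t \<in> top_of_set (Rn n \<times> Rn n) frontier_of (K \<times> unit_ball n)"
    proof
      fix t
      show "L.loop t \<in> top_of_set (Rn n \<times> Rn n) frontier_of (K \<times> unit_ball n)"
        unfolding frontier_times_unit_ball
      proof (cases t rule: L.piece_cases)
        case (inner k i s)
        then show "L.loop t \<in> (K \<times> unit_ball n) - int_n n K \<times> int_n n (unit_ball n)"
          using flight[OF inner] subsetD[OF KB(2)] subsetD[OF KB(3)] by (elim disjE conjE)
      next
        case (vertex k i k' i')
        then have "L.loop t = z i"
          using L.loop_start by simp
        then show "L.loop t \<in> (K \<times> unit_ball n) - int_n n K \<times> int_n n (unit_ball n)"
          using z_bdry[of i] KB(1) by auto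
      qed
    qed
    show "\<exists>d>0. \<forall>t. L.loop t \<notin> bdry_n n K \<times> bdry_n n (unit_ball n) \<longrightarrow>
        (L.loop t \<in> int_n n K \<times> bdry_n n (unit_ball n) \<longrightarrow>
           (L.loop has_vector_derivative d *\<^sub>R (- gradient_n n norm (snd (L.loop t)), 0)) (at t)) \<and>
        (L.loop t \<in> bdry_n n K \<times> int_n n (unit_ball n) \<longrightarrow>
           (L.loop has_vector_derivative d *\<^sub>R (0, gradient_n n (gauge_fun K) (fst (L.loop t)))) (at t))"
    proof (intro exI[of _ d] conjI d allI impI)
      fix t assume nb: "L.loop t \<notin> bdry_n n K \<times> bdry_n n (unit_ball n)"
      show "(L.loop has_vector_derivative d *\<^sub>R (- gradient_n n norm (snd (L.loop t)), 0)) (at t)"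
        if "L.loop t \<in> int_n n K \<times> bdry_n n (unit_ball n)"
      proof (cases t rule: L.piece_cases)
        case (inner k i s)
        then show ?thesis
          using flight[OF inner] excl[OF that] by (elim disjE conjE) auto
      next
        case (vertex k i k' i')
        then show ?thesis
          using nb z_bdry[of i] L.loop_start[of i k] by simp
      qed
      show "(L.loop has_vector_derivative d *\<^sub>R (0, gradient_n n (gauge_fun K) (fst (L.loop t)))) (at t)"
        if "L.loop t \<in> bdry_n n K \<times> int_n n (unit_ball n)"
      proof (cases t rule: L.piece_cases)
        case (inner k i s)
        then show ?thesis
          using flight[OF inner] excl[of "L.loop t"] that by (elim disjE conjE) auto
      next
        case (vertex k i k' i')
        then show ?thesis
          using nb z_bdry[of i] L.loop_start[of i k] by simp
      qed
    qed
    show "\<forall>t. L.loop t \<in> bdry_n n K \<times> bdry_n n (unit_ball n) \<longrightarrow>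
        (\<exists>v\<in>bounce_cone n K (L.loop t). (L.loop has_vector_derivative v) (at_left t)) \<and>
        (\<exists>v\<in>bounce_cone n K (L.loop t). (L.loop has_vector_derivative v) (at_right t))"
    proof (intro allI impI)
      fix t assume tb: "L.loop t \<in> bdry_n n K \<times> bdry_n n (unit_ball n)"
      show "(\<exists>v\<in>bounce_cone n K (L.loop t). (L.loop has_vector_derivative v) (at_left t)) \<and>
        (\<exists>v\<in>bounce_cone n K (L.loop t). (L.loop has_vector_derivative v) (at_right t))"
      proof (cases t rule: L.piece_cases)
        case (inner k i s)
        then show ?thesis
          using flight[OF inner] excl'[OF tb] by (elim disjE conjE) auto
      next
        case (vertex k i k' i')
        have "(L.loop has_vector_derivative L.vel i') (at_left t)" "L.loop t = z (Suc i')"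
          using vertex L.loop_deriv_left[of i' "L.\<tau> (Suc i')" k'] L.h_pos[of i'] L.loop_end[of i' k']
          by (auto simp: L.\<tau>_Suc)
        moreover have "(L.loop has_vector_derivative L.vel i) (at_right t)" "L.loop t = z i"
          using vertex L.loop_deriv_right[of i "L.\<tau> i" k] L.h_pos[of i] L.loop_start[of i k]
          by (auto simp: L.\<tau>_Suc)
        ultimately show ?thesis
          using cone_start[of i] cone_end[of i'] by auto
      qed
    qed
  qed
  have fst_loop: "affine_loop (\<lambda>i. fst (z i)) h (2 * m)"
    by unfold_locales (auto simp: L.z_closed L.h_pos L.h_sum)
  have "(\<lambda>t. fst (L.loop t)) = affine_loop.loop (\<lambda>i. fst (z i)) h (2 * m)"
    by (rule ext) (rule fst_affine_loop[OF loop fst_loop])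
  moreover have "(\<Sum>i<2 * m. dist (fst (z i)) (fst (z (Suc i)))) = closed_length xs"
  proof -
    \<comment> \<open>Bounces do not move \<open>q\<close>, so only the flights contribute.\<close>
    have "(\<Sum>i<2 * m. dist (fst (z i)) (fst (z (Suc i)))) = (\<Sum>j<m. dist (x (Suc j)) (x (Suc (Suc j))))"
      by (simp add: sum_even_odd z_def)
    also have "\<dots> = (\<Sum>j<m. dist (x j) (x (Suc j)))"
      using sum_cyclic_shift[of "\<lambda>j. dist (x j) (x (Suc j))" m] x_per[of 0] x_per[of 1] by simp
    also have "\<dots> = closed_length xs"
    proof -
      have "length xs \<noteq> 0"
        using m unfolding m_def by linarith
      then show ?thesis
        by (simp add: closed_length_eq_sum x_def m_def)
    qed
    finally show ?thesis .
  qed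
  ultimately have "loop_length (\<lambda>t. fst (L.loop t)) \<le> ennreal (closed_length xs)"
    using affine_loop_length[OF fst_loop] by simp
  then show ?thesis
    using traj by (intro exI[of _ "\<lambda>t. fst (L.loop t)"] exI[of _ "\<lambda>t. snd (L.loop t)"]) simp
qed

end

section \<open>Lower bound for the length of trajectories\<close>

text \<open>An affine tilt makes all right derivatives strictly negative. At the last time where the
  tilted function is at most its initial value 0 it would still decrease, so this time is the end
  point.\<close>

lemma right_derivative_nonpos_antimono:
  fixes F :: "real \<Rightarrow> real"
  assumes cont: "continuous_on UNIV F" and der: "\<And>t. (F has_real_derivative D t) (at_right t)"
    and neg: "\<And>t. D t \<le> 0" and ab: "a \<le> b"
  shows "F b \<le> F a"
proof (rule field_le_epsilon)
  fix \<delta> :: real assume "\<delta> > 0"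
  define e where "e = \<delta> / (b - a + 1)"
  have e: "e > 0"
    using ab \<open>\<delta> > 0\<close> by (simp add: e_def)
  define G where "G t = F t - F a - e * (t - a)" for t
  have contG: "continuous_on S G" for S
    unfolding G_def by (intro continuous_intros continuous_on_subset[OF cont]) auto
  have "G b \<le> 0"
  proof (rule ccontr)
    assume Gb: "\<not> G b \<le> 0"
    define T where "T = {t\<in>{a..b}. G t \<le> 0}"
    have "T = {a..b} \<inter> G -` {..0}"
      by (auto simp: T_def)
    then have "closed T"
      using continuous_closed_preimage[OF contG, of "{a..b}" "{..0}"] by simp
    moreover have "{a..b} \<inter> T = T"
      by (auto simp: T_def)
    ultimately have "compact T"
      using compact_Int_closed[of "{a..b}" T] by simp
    moreover have "a \<in> T"
      using ab by (simp add: T_def G_def)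
    ultimately obtain c where c: "c \<in> T" "\<forall>t\<in>T. t \<le> c"
      using compact_attains_sup[of T] by blast
    then have "c < b"
      using Gb by (auto simp: T_def less_le)
    have "(G has_real_derivative D c - e) (at_right c)"
      unfolding G_def by (auto intro!: derivative_eq_intros der)
    moreover have "D c - e < 0"
      using neg[of c] e by simp
    ultimately obtain r where r: "r > 0" "\<And>h. h > 0 \<Longrightarrow> c + h \<in> {c<..} \<Longrightarrow> h < r \<Longrightarrow> G (c + h) < G c"
      using has_real_derivative_neg_dec_right by blast
    define h where "h = min (r / 2) (b - c)"
    have h: "0 < h" "h < r" "c + h \<le> b"
      using r(1) \<open>c < b\<close> by (auto simp: h_def)
    have "G (c + h) < G c"
      using r(2)[of h] h by simp
    then have "c + h \<in> T"
      using c(1) h by (simp add: T_def)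
    then show False
      using c(2) h by force
  qed
  moreover have "e * (b - a) \<le> \<delta>"
    using ab \<open>\<delta> > 0\<close> by (simp add: e_def field_simps)
  ultimately show "F b \<le> F a + \<delta>"
    by (simp add: G_def)
qed

text \<open>A strict decrease just after \<open>t\<close> could not be made up before
  \<open>t + 1\<close>.\<close>

lemma periodic_right_derivative_zero:
  fixes F :: "real \<Rightarrow> real"
  assumes cont: "continuous_on UNIV F" and der: "\<And>t. (F has_real_derivative D t) (at_right t)"
    and neg: "\<And>t. D t \<le> 0" and per: "\<And>t. F (t + 1) = F t"
  shows "D t = 0"
proof (rule ccontr)
  assume "D t \<noteq> 0"
  then have "D t < 0"
    using neg[of t] by simp
  from has_real_derivative_neg_dec_right[OF der this]
  obtain r where r: "r > 0" "\<forall>h>0. t + h \<in> {t<..} \<longrightarrow> h < r \<longrightarrow> F (t + h) < F t"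
    by blast
  define h where "h = min (r / 2) 1"
  have "F (t + h) < F t"
    using r by (simp add: h_def)
  moreover have "F (t + 1) \<le> F (t + h)"
    by (rule right_derivative_nonpos_antimono[OF cont der neg]) (simp add: h_def)
  ultimately show False
    using per[of t] by simp
qed

section \<open>Right derivatives along trajectories and the length bound\<close>

context regular_body
begin

lemma trajectory_frontier:
  assumes "closed_KB_trajectory n K \<gamma>"
  shows "\<gamma> t \<in> (K \<times> unit_ball n) - int_n n K \<times> int_n n (unit_ball n)"
  using assms[unfolded closed_KB_trajectory_def frontier_times_unit_ball, THEN conjunct2, THEN conjunct1]
  by (rule spec)

text \<open>Flights, motions of \<open>p\<close> alone, and bounces or gliding fit one formula with
  two nonnegative speeds, because on the unit sphere the gradient of the norm at \<open>p\<close> is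
  \<open>p\<close>.\<close>

lemma trajectory_right_derivative:
  assumes traj: "closed_KB_trajectory n K \<gamma>"
  shows "\<exists>\<alpha> \<beta>. 0 \<le> \<alpha> \<and> 0 \<le> \<beta> \<and> (\<alpha>, \<beta>) \<noteq> (0, 0) \<and> (\<alpha> \<noteq> 0 \<longrightarrow> norm (snd (\<gamma> t)) = 1) \<and>
    (\<beta> \<noteq> 0 \<longrightarrow> fst (\<gamma> t) \<in> bdry_n n K) \<and>
    (\<gamma> has_vector_derivative (- \<alpha> *\<^sub>R snd (\<gamma> t), \<beta> *\<^sub>R \<nu> (fst (\<gamma> t)))) (at_right t)"
proof -
  define q p where "q = fst (\<gamma> t)" and "p = snd (\<gamma> t)"
  have qp: "\<gamma> t = (q, p)"
    by (simp add: q_def p_def)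
  have fr: "(q, p) \<in> (K \<times> unit_ball n) - int_n n K \<times> int_n n (unit_ball n)"
    unfolding qp[symmetric] by (rule trajectory_frontier[OF traj])
  have grad: "gradient_n n norm p = p" "norm p = 1" if "p \<in> bdry_n n (unit_ball n)"
    using that gradient_norm[of p n] by (cases "p = 0"; auto simp: bdry_unit_ball)+
  have "bdry_n n (unit_ball n) = unit_ball n - int_n n (unit_ball n)"
    by (rule bdry_n_eq[OF closed_unit_ball]) (auto simp: unit_ball_eq)
  then consider (bounce) "q \<in> bdry_n n K" "p \<in> bdry_n n (unit_ball n)"
    | (flight) "q \<in> int_n n K" "p \<in> bdry_n n (unit_ball n)"
    | (reflect) "q \<in> bdry_n n K" "p \<in> int_n n (unit_ball n)"
    using fr by (auto simp: bdry_eq)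
  then show ?thesis
  proof cases
    case bounce
    then have "\<exists>v\<in>bounce_cone n K (q, p). (\<gamma> has_vector_derivative v) (at_right t)"
      using traj unfolding closed_KB_trajectory_def by (metis SigmaI qp)
    then obtain \<alpha> \<beta> where "0 \<le> \<alpha>" "0 \<le> \<beta>" "(\<alpha>, \<beta>) \<noteq> (0, 0)"
      "(\<gamma> has_vector_derivative (\<alpha> *\<^sub>R (- gradient_n n norm p, 0) + \<beta> *\<^sub>R (0, gradient_n n (gauge_fun K) q))) (at_right t)"
      by (auto simp: bounce_cone_def)
    then show ?thesis
      using bounce grad unfolding qp by (intro exI[of _ \<alpha>] exI[of _ \<beta>]) (simp add: \<nu>_def)
  next
    case flight
    then have "(q, p) \<notin> bdry_n n K \<times> bdry_n n (unit_ball n)" "(q, p) \<in> int_n n K \<times> bdry_n n (unit_ball n)"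
      by (auto simp: bdry_eq)
    then obtain d where "d > 0" "(\<gamma> has_vector_derivative d *\<^sub>R (- gradient_n n norm p, 0)) (at t)"
      using traj unfolding closed_KB_trajectory_def by (metis qp snd_conv)
    then have "(\<gamma> has_vector_derivative d *\<^sub>R (- p, 0)) (at_right t)"
      using grad flight by (auto intro: has_vector_derivative_at_within)
    then show ?thesis
      using flight grad \<open>d > 0\<close> unfolding qp by (intro exI[of _ d] exI[of _ 0]) simp
  next
    case reflect
    then have "(q, p) \<notin> bdry_n n K \<times> bdry_n n (unit_ball n)" "(q, p) \<in> bdry_n n K \<times> int_n n (unit_ball n)"
      by (auto simp: bdry_unit_ball int_unit_ball)
    then obtain d where "d > 0" "(\<gamma> has_vector_derivative d *\<^sub>R (0, gradient_n n (gauge_fun K) q)) (at t)"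
      using traj unfolding closed_KB_trajectory_def by (metis qp fst_conv)
    then have "(\<gamma> has_vector_derivative d *\<^sub>R (0, \<nu> q)) (at_right t)"
      by (auto simp: \<nu>_def intro: has_vector_derivative_at_within)
    then show ?thesis
      using reflect \<open>d > 0\<close> unfolding qp by (intro exI[of _ 0] exI[of _ d]) simp
  qed
qed

lemma trajectory_in_K:
  assumes "closed_KB_trajectory n K \<gamma>"
  shows "fst (\<gamma> t) \<in> K"
  using trajectory_frontier[OF assms, of t] by auto

text \<open>If a translate \<open>q + v\<close> stayed in the interior, \<open>\<langle>p, v\<rangle>\<close> would be monotone along the
  periodic trajectory and hence constant, which rules out all bounces; then \<open>\<langle>q, p\<rangle>\<close> would be
  strictly monotone.\<close>

lemma trajectory_untranslatable:
  assumes traj: "closed_KB_trajectory n K \<gamma>"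
  shows "untranslatable n K (range (\<lambda>t. fst (\<gamma> t)))"
proof (rule untranslatableI)
  fix v assume v: "v \<in> Rn n" "\<forall>y\<in>range (\<lambda>t. fst (\<gamma> t)). y + v \<in> int_n n K"
  define q p where "q t = fst (\<gamma> t)" and "p t = snd (\<gamma> t)" for t
  have loop: "piecewise_smooth_loop \<gamma>"
    using traj by (simp add: closed_KB_trajectory_def)
  then have per: "q (t + 1) = q t" "p (t + 1) = p t" for t
    by (simp_all add: piecewise_smooth_loop_def q_def p_def)
  have cont: "continuous_on UNIV q" "continuous_on UNIV p"
    using loop by (auto simp: piecewise_smooth_loop_def q_def p_def intro: continuous_intros)
  have "\<forall>t. \<exists>\<alpha> \<beta>. 0 \<le> \<alpha> \<and> 0 \<le> \<beta> \<and> (\<alpha>, \<beta>) \<noteq> (0, 0) \<and> (\<alpha> \<noteq> 0 \<longrightarrow> norm (p t) = 1) \<and>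
    (\<beta> \<noteq> 0 \<longrightarrow> q t \<in> bdry_n n K) \<and> (\<gamma> has_vector_derivative (- \<alpha> *\<^sub>R p t, \<beta> *\<^sub>R \<nu> (q t))) (at_right t)"
    unfolding q_def p_def using trajectory_right_derivative[OF traj] by blast
  then obtain \<alpha> \<beta> where ab: "\<And>t. 0 \<le> \<alpha> t" "\<And>t. 0 \<le> \<beta> t" "\<And>t. (\<alpha> t, \<beta> t) \<noteq> (0, 0)"
    "\<And>t. \<alpha> t \<noteq> 0 \<Longrightarrow> norm (p t) = 1" "\<And>t. \<beta> t \<noteq> 0 \<Longrightarrow> q t \<in> bdry_n n K"
    and der: "\<And>t. (\<gamma> has_vector_derivative (- \<alpha> t *\<^sub>R p t, \<beta> t *\<^sub>R \<nu> (q t))) (at_right t)"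
    by metis
  have dq: "(q has_vector_derivative - \<alpha> t *\<^sub>R p t) (at_right t)"
    and dp: "(p has_vector_derivative \<beta> t *\<^sub>R \<nu> (q t)) (at_right t)" for t
    using bounded_linear.has_vector_derivative[OF bounded_linear_fst der[of t]]
      bounded_linear.has_vector_derivative[OF bounded_linear_snd der[of t]]
    by (simp_all add: q_def[abs_def] p_def[abs_def])
  have neg: "inner (\<nu> (q t)) v < 0" if "\<beta> t \<noteq> 0" for t
  proof -
    have "q t + v \<in> int_n n K"
      using v(2) by (auto simp: q_def)
    from normal_less[OF ab(5)[OF that] this] show ?thesis
      by (simp add: inner_add_right normal_one[OF ab(5)[OF that]])
  qed
  have b0: "\<beta> t = 0" for t
  proof -
    have "((\<lambda>t. inner (p t) v) has_real_derivative inner (\<beta> t *\<^sub>R \<nu> (q t)) v) (at_right t)" for t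
      unfolding has_real_derivative_iff_has_vector_derivative
      by (rule bounded_linear.has_vector_derivative[OF bounded_linear_inner_left dp])
    then have "inner (\<beta> t *\<^sub>R \<nu> (q t)) v = 0"
    proof (rule periodic_right_derivative_zero[rotated])
      show "inner (\<beta> t *\<^sub>R \<nu> (q t)) v \<le> 0" for t
        using ab(2)[of t] neg[of t] by (cases "\<beta> t = 0") (auto simp: mult_le_0_iff)
      show "continuous_on UNIV (\<lambda>t. inner (p t) v)"
        by (intro continuous_intros cont)
    qed (simp add: per)
    then show ?thesis
      using neg[of t] by (metis inner_scaleR_left less_irrefl mult_eq_0_iff)
  qed
  have a_pos: "\<alpha> t > 0" and p1: "inner (p t) (p t) = 1" for t
    using ab(1,3)[of t] ab(4)[of t] b0[of t] by (auto simp: less_le simp flip: power2_norm_eq_inner)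
  have "((\<lambda>t. inner (q t) (p t)) has_real_derivative - \<alpha> t) (at_right t)" for t
    unfolding has_real_derivative_iff_has_vector_derivative
    using bounded_bilinear.has_vector_derivative[OF bounded_bilinear_inner dq[of t] dp[of t]]
    by (simp add: b0 p1)
  then have "- \<alpha> 0 = 0"
  proof (rule periodic_right_derivative_zero[rotated])
    show "- \<alpha> t \<le> 0" for t
      using a_pos[of t] by simp
    show "continuous_on UNIV (\<lambda>t. inner (q t) (p t))"
      by (intro continuous_intros cont)
  qed (simp add: per)
  then show False
    using a_pos[of 0] by simp
qed

text \<open>A fine inscribed polygon of \<open>q\<close> cannot be translated into \<open>r K\<close>, so after scaling by
  \<open>1 / r\<close> it competes with the shortest polygon.\<close>

lemma trajectory_length_ge_scaled:
  assumes traj: "closed_KB_trajectory n K \<gamma>"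
    and min: "\<And>ys. set ys \<subseteq> Rn n \<Longrightarrow> untranslatable n K (set ys) \<Longrightarrow> l \<le> closed_length ys"
    and r: "0 < r" "r < 1"
  shows "ennreal (r * l) \<le> loop_length (\<lambda>t. fst (\<gamma> t))"
proof -
  define q where "q t = fst (\<gamma> t)" for t
  have loop: "piecewise_smooth_loop \<gamma>"
    using traj by (simp add: closed_KB_trajectory_def)
  then have per1: "q (t + 1) = q t" for t
    by (simp add: piecewise_smooth_loop_def q_def)
  have "q (t + of_int k) = q t" for t k
    by (induction k rule: int_induct[where k = 0]) (use per1 in \<open>simp_all add: add.assoc[symmetric]\<close>,
      metis add.commute diff_add_cancel add_diff_eq per1)
  then have per: "q (frac t) = q t" for t
    using \<open>\<And>t k. q (t + of_int k) = q t\<close>[of "frac t" "\<lfloor>t\<rfloor>"] by (simp add: frac_def)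
  have cont: "continuous_on UNIV q"
    using loop by (auto simp: piecewise_smooth_loop_def q_def intro: continuous_intros)
  have qK: "q t \<in> K" "q t \<in> Rn n" for t
    using trajectory_in_K[OF traj] in_Rn by (auto simp: q_def)
  obtain e where e: "e > 0" "\<And>y. y \<in> Rn n \<Longrightarrow> norm y < e \<Longrightarrow> y \<in> K"
    by (rule zero_ball, rule that)
  have small: "y \<in> int_n n K" if "y \<in> Rn n" "norm y < e" for y
  proof (rule mem_int_nI[of _ _ "e - norm y"])
    fix w assume "w \<in> Rn n" "norm (w - y) < e - norm y"
    then show "w \<in> K"
      using norm_triangle_sub[of w y] by (intro e(2)) auto
  qed (use that in auto)
  \<comment> \<open>\<open>K\<close> contains the ball of radius \<open>e\<close> about 0, so a
    vector shorter than \<open>(1 - r) * e\<close> is \<open>1 - r\<close> times an interior point,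
    and convexity absorbs it.\<close>
  have near: "r *\<^sub>R k + w \<in> int_n n K" if "k \<in> K" "w \<in> Rn n" "norm w < (1 - r) * e" for k w
  proof -
    have "(1 / (1 - r)) *\<^sub>R w \<in> int_n n K"
      using that r by (intro small) (auto intro: Rn_scale simp: field_simps)
    from int_segment'[OF this that(1), of r] show ?thesis
      using r by (simp add: add.commute)
  qed
  have "uniformly_continuous_on {0..1} q"
    by (intro compact_uniformly_continuous continuous_on_subset[OF cont]) auto
  moreover have "(1 - r) * e > 0"
    using r e by simp
  ultimately obtain d where d: "d > 0" "\<And>s t. s \<in> {0..1} \<Longrightarrow> t \<in> {0..1} \<Longrightarrow> dist t s < d \<Longrightarrow> dist (q t) (q s) < (1 - r) * e"
    unfolding uniformly_continuous_on_def by metis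
  obtain N :: nat where N: "N > 0" "1 / real N < d"
    using d(1) reals_Archimedean[of d] by (metis inverse_eq_divide zero_less_Suc)
  \<comment> \<open>\<open>ts\<close> includes the time 1; \<open>ys\<close> omits its point because
    \<open>closed_length\<close> returns to the first vertex by itself.\<close>
  define ts where "ts = map (\<lambda>i. real i / real N) [0..<N+1]"
  define ys where "ys = map (\<lambda>i. q (real i / real N)) [0..<N]"
  \<comment> \<open>If \<open>v\<close> moved the scaled polygon into the interior,
    \<open>r *\<^sub>R v\<close> would move the whole curve there, as each of its points is within
    \<open>(1 - r) * e\<close> of a sample.\<close>
  have "untranslatable n K (set (map (\<lambda>y. 0 + (1 / r) *\<^sub>R (y - 0)) ys))"
  proof (rule untranslatableI)
    fix v assume v: "v \<in> Rn n" "\<forall>y\<in>set (map (\<lambda>y. 0 + (1 / r) *\<^sub>R (y - 0)) ys). y + v \<in> int_n n K"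
    have "q t + r *\<^sub>R v \<in> int_n n K" for t
    proof -
      define i where "i = nat \<lfloor>real N * frac t\<rfloor>"
      define s where "s = real i / real N"
      have "0 \<le> real N * frac t"
        by simp
      then have i1: "real i \<le> real N * frac t" "real N * frac t < real i + 1"
        by (simp_all add: i_def)
      moreover have "real N * frac t < real N"
        using N(1) by (simp add: frac_lt_1)
      ultimately have "i < N"
        by linarith
      have s: "0 \<le> s" "s \<le> frac t" "frac t - s < d"
      proof -
        show "0 \<le> s" "s \<le> frac t"
          using i1 N(1) by (auto simp: s_def pos_divide_le_eq mult.commute)
        have "frac t < s + 1 / real N"
          using i1(2) N(1) by (simp add: s_def pos_less_divide_eq mult.commute flip: add_divide_distrib)
        then show "frac t - s < d"
          using N(2) by linarith
      qed
      then have "dist (q (frac t)) (q s) < (1 - r) * e"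
        using frac_lt_1[of t] by (intro d(2)) (auto simp: dist_real_def)
      then have "norm (q t - q s) < (1 - r) * e"
        by (simp add: per dist_norm)
      moreover have "(1 / r) *\<^sub>R q s + v \<in> K"
        using v(2) \<open>i < N\<close> in_K by (auto simp: ys_def s_def)
      moreover have "q t - q s \<in> Rn n"
        using qK by (intro Rn_diff)
      ultimately have "r *\<^sub>R ((1 / r) *\<^sub>R q s + v) + (q t - q s) \<in> int_n n K"
        by (intro near)
      then show ?thesis
        using r by (simp add: scaleR_add_right algebra_simps)
    qed
    then show False
      using untranslatableD[OF trajectory_untranslatable[OF traj], of "r *\<^sub>R v"] v(1) by (auto simp: q_def intro: Rn_scale)
  qed
  moreover have "set (map (\<lambda>y. 0 + (1 / r) *\<^sub>R (y - 0)) ys) \<subseteq> Rn n"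
    using qK by (auto simp: ys_def intro: Rn_scale)
  ultimately have "l \<le> \<bar>1 / r\<bar> * closed_length ys"
    using min closed_length_affine by metis
  then have "r * l \<le> closed_length ys"
    using r by (simp add: field_simps)
  also have "closed_length ys = chain_length (map q ts)"
  proof -
    have "map q ts = ys @ [q 1]"
      using N(1) by (simp add: ts_def ys_def comp_def)
    moreover have "hd ys = q 1"
      using N(1) per1[of 0] by (simp add: ys_def hd_map)
    ultimately show ?thesis
      by (simp add: closed_length_def)
  qed
  also have "chain_length (map q ts) = (\<Sum>i<length ts - 1. dist (q (ts ! i)) (q (ts ! Suc i)))"
    by (simp add: chain_length_eq_sum)
  finally have "ennreal (r * l) \<le> ennreal (\<Sum>i<length ts - 1. dist (q (ts ! i)) (q (ts ! Suc i)))"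
    by (rule ennreal_leI)
  also have "\<dots> = (\<Sum>i<length ts - 1. ennreal (dist (q (ts ! i)) (q (ts ! Suc i))))"
    by (simp add: sum_ennreal)
  also have "\<dots> \<le> loop_length q"
    unfolding loop_length_def
  proof (rule SUP_upper)
    have "sorted ts"
      unfolding ts_def using N(1) by (auto simp: sorted_iff_nth_mono divide_right_mono simp del: upt_Suc)
    moreover have "set ts \<subseteq> {0..1}"
      using N(1) by (auto simp: ts_def simp del: upt_Suc)
    ultimately show "ts \<in> {ts. sorted ts \<and> set ts \<subseteq> {0..1}}"
      by simp
  qed
  finally show ?thesis
    by (simp add: q_def[abs_def])
qed

lemma trajectory_length_ge:
  assumes traj: "closed_KB_trajectory n K \<gamma>"
    and min: "\<And>ys. set ys \<subseteq> Rn n \<Longrightarrow> untranslatable n K (set ys) \<Longrightarrow> l \<le> closed_length ys"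
  shows "ennreal l \<le> loop_length (\<lambda>t. fst (\<gamma> t))"
proof (cases "loop_length (\<lambda>t. fst (\<gamma> t))")
  case (real b)
  have "l \<le> b"
  proof (rule field_le_mult_one_interval)
    fix r :: real assume "0 < r" "r < 1"
    from trajectory_length_ge_scaled[OF traj min this] show "r * l \<le> b"
      using real by (simp add: ennreal_le_iff)
  qed
  then show ?thesis
    using real by (simp add: ennreal_leI)
qed simp

end

section \<open>The volume bound\<close>

abbreviation leb_n :: "nat \<Rightarrow> (nat \<Rightarrow> real) measure" where
  "leb_n n \<equiv> \<Pi>\<^sub>M i\<in>{..<n}. lborel"

definition coords :: "nat \<Rightarrow> fvec \<Rightarrow> nat \<Rightarrow> real" where
  "coords n x = (\<lambda>i\<in>{..<n}. coord x i)"

text \<open>The set is the preimage, under extension by zero, of a compact and hence Borel set of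
  sequences.\<close>

lemma coords_image_measurable:
  assumes K: "compact K" "K \<subseteq> Rn n"
  shows "coords n ` K \<in> sets (leb_n n)"
proof -
  define T where "T f = (\<lambda>i. if i < n then f i else 0)" for f :: "nat \<Rightarrow> real"
  have "T \<in> measurable (leb_n n) (Pi\<^sub>M UNIV (\<lambda>_. borel))"
    unfolding T_def
  proof (rule measurable_PiM_single')
    fix i
    show "(\<lambda>f. if i < n then f i else 0) \<in> borel_measurable (leb_n n)"
      using measurable_component_singleton[of i "{..<n}" "\<lambda>_. lborel"] by (cases "i < n") auto
  qed auto
  moreover have "coord ` K \<in> sets (Pi\<^sub>M UNIV (\<lambda>_::nat. borel :: real measure))"
  proof -
    have "compact (coord ` K)"
      by (intro compact_continuous_image K continuous_on_coordinatewise_then_product continuous_on_coord continuous_on_id)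
    then show ?thesis
      by (simp add: sets_PiM_equal_borel compact_imp_closed)
  qed
  ultimately have "T -` (coord ` K) \<inter> space (leb_n n) \<in> sets (leb_n n)"
    by (rule measurable_sets)
  also have "T -` (coord ` K) \<inter> space (leb_n n) = coords n ` K"
  proof (intro set_eqI iffI)
    fix f assume "f \<in> T -` (coord ` K) \<inter> space (leb_n n)"
    then obtain x where "x \<in> K" "T f = coord x" "f \<in> extensional {..<n}"
      by (auto simp: space_PiM PiE_def)
    then have "f = coords n x"
    proof (intro ext)
      fix i
      have "T f i = coord x i"
        by (simp add: \<open>T f = coord x\<close>)
      then show "f i = coords n x i"
        using \<open>f \<in> extensional {..<n}\<close> by (cases "i < n") (simp_all add: T_def coords_def extensional_def)
    qed
    with \<open>x \<in> K\<close> show "f \<in> coords n ` K"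
      by blast
  next
    fix f assume "f \<in> coords n ` K"
    then obtain x where "x \<in> K" "f = coords n x"
      by blast
    moreover from this have "T f = coord x"
    proof (intro ext)
      fix i
      have "\<not> i < n \<Longrightarrow> coord x i = 0"
        using K(2) \<open>x \<in> K\<close> by (auto simp: Rn_def)
      then show "T f i = coord x i"
        by (simp add: T_def coords_def \<open>f = coords n x\<close>)
    qed
    ultimately show "f \<in> T -` (coord ` K) \<inter> space (leb_n n)"
      by (auto simp: coords_def space_PiM)
  qed
  finally show ?thesis .
qed

lemma coords_surj:
  assumes "f \<in> space (leb_n n)"
  obtains x where "x \<in> Rn n" "f = coords n x"
proof -
  obtain x where "x \<in> Rn n" "\<forall>i<n. coord x i = f i"
    using ex_fvec_coord by blast
  moreover from this have "f = coords n x"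
    using assms by (intro ext) (auto simp: coords_def space_PiM PiE_def extensional_def)
  ultimately show thesis
    using that by blast
qed

lemma norm_le_coords:
  assumes x: "x \<in> Rn n" and le: "\<And>i. i < n \<Longrightarrow> \<bar>coord x i\<bar> \<le> t" and t: "t \<ge> 0"
  shows "norm x \<le> sqrt (real n) * t"
proof -
  have "(norm x)\<^sup>2 \<le> (\<Sum>i<n. t\<^sup>2)"
    unfolding norm_Rn[OF x] using le by (intro sum_mono) (simp add: abs_le_square_iff[symmetric] t)
  also have "\<dots> = (sqrt (real n) * t)\<^sup>2"
    by (simp add: power_mult_distrib)
  finally show ?thesis
    by (rule power2_le_imp_le) (use t in simp)
qed

section \<open>Volume under coordinatewise affine maps\<close>

definition affine_map :: "nat \<Rightarrow> (nat \<Rightarrow> real) \<Rightarrow> real \<Rightarrow> (nat \<Rightarrow> real) \<Rightarrow> nat \<Rightarrow> real" where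
  "affine_map n b c f = (\<lambda>i\<in>{..<n}. b i + c * f i)"

lemma affine_map_measurable: "affine_map n b c \<in> measurable (leb_n n) (leb_n n)"
  unfolding affine_map_def by measurable

text \<open>The product measure is determined by its values on boxes, where the claim is the
  one-dimensional change of variables in each factor.\<close>

lemma emeasure_affine_map:
  assumes c: "c \<noteq> 0" and A: "A \<in> sets (leb_n n)"
  shows "emeasure (leb_n n) A = ennreal (\<bar>c\<bar> ^ n) * emeasure (leb_n n) (affine_map n b c -` A \<inter> space (leb_n n))"
proof -
  interpret product_sigma_finite "\<lambda>_::nat. lborel :: real measure" ..
  define N where "N = scale_measure (ennreal (\<bar>c\<bar> ^ n)) (distr (leb_n n) (leb_n n) (affine_map n b c))"
  have "N = leb_n n"
  proof (rule PiM_eqI)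
    show "finite {..<n}" "sets N = sets (leb_n n)"
      by (simp_all add: N_def)
    fix X :: "nat \<Rightarrow> real set" assume X: "\<And>i. i \<in> {..<n} \<Longrightarrow> X i \<in> sets lborel"
    have one: "emeasure lborel (X i) = ennreal \<bar>c\<bar> * emeasure lborel ((\<lambda>x. b i + c * x) -` X i)"
      if "i < n" for i
    proof -
      have Xi: "X i \<in> sets borel"
        using X that by simp
      have "emeasure lborel (X i) = emeasure (density (distr lborel borel (\<lambda>x. b i + c * x)) (\<lambda>_. ennreal \<bar>c\<bar>)) (X i)"
        using lborel_real_affine[OF c, of "b i"] by (rule arg_cong[where f = "\<lambda>M. emeasure M (X i)"])
      also have "\<dots> = ennreal \<bar>c\<bar> * emeasure lborel ((\<lambda>x. b i + c * x) -` X i)"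
        using Xi by (simp add: emeasure_density_const emeasure_distr)
      finally show ?thesis .
    qed
    have pre: "affine_map n b c -` Pi\<^sub>E {..<n} X \<inter> space (leb_n n) = Pi\<^sub>E {..<n} (\<lambda>i. (\<lambda>x. b i + c * x) -` X i)"
      by (auto simp: affine_map_def space_PiM PiE_iff)
    have "emeasure N (Pi\<^sub>E {..<n} X) = ennreal (\<bar>c\<bar> ^ n) * emeasure (leb_n n) (Pi\<^sub>E {..<n} (\<lambda>i. (\<lambda>x. b i + c * x) -` X i))"
      using X by (simp add: N_def emeasure_distr affine_map_measurable pre sets_PiM_I_finite)
    also have "emeasure (leb_n n) (Pi\<^sub>E {..<n} (\<lambda>i. (\<lambda>x. b i + c * x) -` X i)) =
        (\<Prod>i<n. emeasure lborel ((\<lambda>x. b i + c * x) -` X i))"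
    proof (rule emeasure_PiM)
      fix i assume "i \<in> {..<n}"
      then have "X i \<in> sets borel"
        using X by simp
      then show "(\<lambda>x. b i + c * x) -` X i \<in> sets lborel"
        using measurable_sets[of "\<lambda>x. b i + c * x" borel borel "X i"] by simp
    qed simp
    also have "ennreal (\<bar>c\<bar> ^ n) * (\<Prod>i<n. emeasure lborel ((\<lambda>x. b i + c * x) -` X i)) = (\<Prod>i<n. emeasure lborel (X i))"
      by (simp add: one prod.distrib ennreal_power)
    finally show "emeasure N (Pi\<^sub>E {..<n} X) = (\<Prod>i<n. emeasure lborel (X i))" .
  qed
  then have "emeasure (leb_n n) A = emeasure N A"
    by simp
  also have "\<dots> = ennreal (\<bar>c\<bar> ^ n) * emeasure (leb_n n) (affine_map n b c -` A \<inter> space (leb_n n))"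
    using A by (simp add: N_def emeasure_distr affine_map_measurable)
  finally show ?thesis .
qed

lemma emeasure_cube:
  assumes "t \<ge> 0"
  shows "emeasure (leb_n n) (Pi\<^sub>E {..<n} (\<lambda>i. {a i - t..a i + t})) = ennreal ((2 * t) ^ n)"
proof -
  interpret product_sigma_finite "\<lambda>_::nat. lborel :: real measure" ..
  have "emeasure (leb_n n) (Pi\<^sub>E {..<n} (\<lambda>i. {a i - t..a i + t})) = (\<Prod>i<n. emeasure lborel {a i - t..a i + t})"
    by (rule emeasure_PiM) auto
  also have "\<dots> = (\<Prod>i<n. ennreal (2 * t))"
    using assms by (intro prod.cong) auto
  finally show ?thesis
    using assms by (simp add: ennreal_power)
qed

section \<open>Volume and the difference body\<close>

context convex_body_n
begin

lemma coords_sets: "coords n ` K \<in> sets (leb_n n)"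
  by (rule coords_image_measurable[OF compact_K sub_Rn])

lemma volume_finite_pos: "0 < emeasure (leb_n n) (coords n ` K)" "emeasure (leb_n n) (coords n ` K) < \<infinity>"
proof -
  obtain c e where c: "c \<in> Rn n" "c \<in> K" and e: "e > 0" "\<And>y. y \<in> Rn n \<Longrightarrow> norm (y - c) < e \<Longrightarrow> y \<in> K"
    using int_nonempty in_K in_Rn by (metis all_not_in_conv mem_int_nE)
  \<comment> \<open>The corners of a cube of half-side \<open>t\<close> have distance
    \<open>sqrt n * t\<close> from its centre; the added 1 makes this strictly less than
    \<open>e\<close> and covers \<open>n = 0\<close>.\<close>
  define t where "t = e / (sqrt (real n) + 1)"
  have t: "t > 0" "sqrt (real n) * t < e"
  proof -
    have S: "sqrt (real n) + 1 > 0"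
      by (simp add: add_nonneg_pos)
    then show "t > 0"
      using e(1) by (simp add: t_def)
    have "t * (sqrt (real n) + 1) = e"
      using S by (simp add: t_def)
    then show "sqrt (real n) * t < e"
      using \<open>t > 0\<close> by (simp add: distrib_left mult.commute)
  qed
  have sub: "Pi\<^sub>E {..<n} (\<lambda>i. {coord c i - t..coord c i + t}) \<subseteq> coords n ` K"
  proof
    fix f assume f: "f \<in> Pi\<^sub>E {..<n} (\<lambda>i. {coord c i - t..coord c i + t})"
    then have "f \<in> space (leb_n n)"
      by (auto simp: space_PiM)
    then obtain x where x: "x \<in> Rn n" "f = coords n x"
      by (rule coords_surj)
    have "norm (x - c) \<le> sqrt (real n) * t"
    proof (rule norm_le_coords)
      show "\<bar>coord (x - c) i\<bar> \<le> t" if "i < n" for i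
      proof -
        have "f i \<in> {coord c i - t..coord c i + t}"
          using PiE_mem[OF f, of i] that by simp
        then show ?thesis
          using that by (auto simp: x(2) coords_def)
      qed
    qed (use x c t in \<open>auto intro: Rn_diff\<close>)
    then have "x \<in> K"
      using e(2) x(1) t(2) by force
    then show "f \<in> coords n ` K"
      using x(2) by blast
  qed
  have "ennreal ((2 * t) ^ n) = emeasure (leb_n n) (Pi\<^sub>E {..<n} (\<lambda>i. {coord c i - t..coord c i + t}))"
    using t(1) by (simp add: emeasure_cube)
  also have "\<dots> \<le> emeasure (leb_n n) (coords n ` K)"
    by (rule emeasure_mono[OF sub coords_sets])
  finally have "ennreal ((2 * t) ^ n) \<le> emeasure (leb_n n) (coords n ` K)" .
  moreover have "ennreal ((2 * t) ^ n) > 0"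
    using t(1) by simp
  ultimately show "0 < emeasure (leb_n n) (coords n ` K)"
    by (rule less_le_trans[rotated])
  obtain R where R: "R > 0" "\<forall>x\<in>K. norm x \<le> R"
    using compact_imp_bounded[OF compact_K] by (auto simp: bounded_pos)
  have "coords n ` K \<subseteq> Pi\<^sub>E {..<n} (\<lambda>i. {0 - R..0 + R})"
  proof clarify
    fix x assume "x \<in> K"
    then have "- R \<le> coord x i \<and> coord x i \<le> R" for i
      using R(2) abs_coord_le_norm[of x i] by (fastforce simp: abs_le_iff)
    then show "coords n x \<in> Pi\<^sub>E {..<n} (\<lambda>i. {0 - R..0 + R})"
      by (auto simp: coords_def)
  qed
  then have "emeasure (leb_n n) (coords n ` K) \<le> ennreal ((2 * R) ^ n)"
    using emeasure_mono[of "coords n ` K" "Pi\<^sub>E {..<n} (\<lambda>i. {0 - R..0 + R})" "leb_n n"]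
      emeasure_cube[of R n "\<lambda>_. 0"] R(1) by (simp add: sets_PiM_I_finite)
  then show "emeasure (leb_n n) (coords n ` K) < \<infinity>"
    using le_less_trans[OF _ ennreal_less_top] by simp
qed

text \<open>For \<open>x\<close> in the cube, \<open>2x = a - b\<close> with \<open>a, b \<in> K\<close>, so that \<open>K \<inter> (K + x)\<close> contains
  \<open>(K + a) / 2\<close>. The integral of \<open>Vol (K \<inter> (K + x))\<close> over all \<open>x\<close> is \<open>Vol K\<^sup>2\<close>.\<close>

lemma volume_ge_of_differences:
  assumes w: "w > 0" and n: "n \<ge> 1" and diff: "\<And>v. v \<in> Rn n \<Longrightarrow> norm v \<le> w \<Longrightarrow> \<exists>a\<in>K. \<exists>b\<in>K. v = a - b"
  shows "(w / (2 * sqrt (real n))) ^ n \<le> Vol n K"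
proof -
  interpret product_sigma_finite "\<lambda>_::nat. lborel :: real measure" ..
  interpret L: sigma_finite_measure "leb_n n"
    by (rule sigma_finite) simp
  interpret LL: pair_sigma_finite "leb_n n" "leb_n n" ..
  \<comment> \<open>The cube of half-side \<open>s\<close> lies in the ball of radius
    \<open>sqrt n * s = w / 2\<close>, so its doubled points satisfy the hypothesis
    \<open>diff\<close>.\<close>
  define s where "s = w / (2 * sqrt (real n))"
  have s: "s > 0"
    using w n by (simp add: s_def)
  define E where "E = coords n ` K"
  define V where "V = emeasure (leb_n n) E"
  note E = coords_sets[folded E_def]
  note V = volume_finite_pos[folded E_def, folded V_def]
  define Q where "Q = Pi\<^sub>E {..<n} (\<lambda>i. {0 - s..0 + s})"
  have Q: "Q \<in> sets (leb_n n)" "emeasure (leb_n n) Q = ennreal ((2 * s) ^ n)"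
    unfolding Q_def using emeasure_cube[of s n "\<lambda>_. 0"] s by (auto intro!: sets_PiM_I_finite)
  define sub where "sub x y = (\<lambda>i\<in>{..<n}. y i - x i)" for x y :: "nat \<Rightarrow> real"
  have sub_meas: "(\<lambda>p. sub (fst p) (snd p)) \<in> measurable (leb_n n \<Otimes>\<^sub>M leb_n n) (leb_n n)"
    unfolding sub_def by measurable
  define g where "g x y = indicator E y * (indicator E (sub x y) :: ennreal)" for x y
  have g_meas: "case_prod g \<in> borel_measurable (leb_n n \<Otimes>\<^sub>M leb_n n)"
    unfolding g_def case_prod_beta
    by (intro borel_measurable_times_ennreal measurable_compose[OF measurable_snd]
        measurable_compose[OF sub_meas] borel_measurable_indicator E)
  have lower: "ennreal ((1 / 2) ^ n) * V \<le> (\<integral>\<^sup>+ y. g x y \<partial>leb_n n)" if x: "x \<in> Q" for x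
  proof -
    have "x \<in> space (leb_n n)"
      using x by (auto simp: Q_def space_PiM)
    then obtain X where X: "X \<in> Rn n" "x = coords n X"
      by (rule coords_surj)
    have "norm X \<le> sqrt (real n) * s"
    proof (rule norm_le_coords[OF X(1)])
      show "\<bar>coord X i\<bar> \<le> s" if "i < n" for i
        using PiE_mem[OF x[unfolded Q_def], of i] that by (auto simp: X(2) coords_def)
    qed (use s in simp)
    then have "norm (2 *\<^sub>R X) \<le> w"
      using n by (simp add: s_def)
    then obtain a b where ab: "a \<in> K" "b \<in> K" "2 *\<^sub>R X = a - b"
      using diff[of "2 *\<^sub>R X"] X(1) by (auto intro: Rn_scale)
    define D where "D = {y\<in>space (leb_n n). y \<in> E \<and> sub x y \<in> E}"
    have sx: "sub x \<in> measurable (leb_n n) (leb_n n)"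
      unfolding sub_def by measurable
    have D_eq: "D = E \<inter> (sub x -` E \<inter> space (leb_n n))"
      using sets.sets_into_space[OF E] by (auto simp: D_def)
    then have D: "D \<in> sets (leb_n n)"
      using E measurable_sets[OF sx E] by auto
    have "E \<subseteq> affine_map n (\<lambda>i. coord a i / 2) (1 / 2) -` D \<inter> space (leb_n n)"
    proof
      fix f assume f: "f \<in> E"
      then obtain k where k: "k \<in> K" "f = coords n k"
        by (auto simp: E_def)
      have half: "(1 / 2) *\<^sub>R k + (1 / 2) *\<^sub>R c \<in> K" if "c \<in> K" for c
        using convexD[OF convex_K k(1) that, of "1/2" "1/2"] by simp
      have "affine_map n (\<lambda>i. coord a i / 2) (1 / 2) f = coords n ((1 / 2) *\<^sub>R k + (1 / 2) *\<^sub>R a)"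
        by (auto simp: affine_map_def coords_def k(2))
      \<comment> \<open>With \<open>y = (k + a) / 2\<close> one has
        \<open>y - x = (k + b) / 2\<close>, since \<open>2 x = a - b\<close>.\<close>
      moreover have "sub x (coords n ((1 / 2) *\<^sub>R k + (1 / 2) *\<^sub>R a)) = coords n ((1 / 2) *\<^sub>R k + (1 / 2) *\<^sub>R b)"
      proof
        fix i
        have "coord (2 *\<^sub>R X) i = coord (a - b) i"
          by (simp only: ab(3))
        then show "sub x (coords n ((1 / 2) *\<^sub>R k + (1 / 2) *\<^sub>R a)) i = coords n ((1 / 2) *\<^sub>R k + (1 / 2) *\<^sub>R b) i"
          by (auto simp: sub_def coords_def X(2))
      qed
      ultimately have "affine_map n (\<lambda>i. coord a i / 2) (1 / 2) f \<in> D"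
        using half ab sets.sets_into_space[OF E] by (auto simp: D_def E_def)
      then show "f \<in> affine_map n (\<lambda>i. coord a i / 2) (1 / 2) -` D \<inter> space (leb_n n)"
        using f sets.sets_into_space[OF E] by auto
    qed
    then have "V \<le> emeasure (leb_n n) (affine_map n (\<lambda>i. coord a i / 2) (1 / 2) -` D \<inter> space (leb_n n))"
      unfolding V_def by (rule emeasure_mono) (rule measurable_sets[OF affine_map_measurable D])
    then have "ennreal ((1 / 2) ^ n) * V \<le> emeasure (leb_n n) D"
      using emeasure_affine_map[of "1/2" D n "\<lambda>i. coord a i / 2"] D by (simp add: mult_left_mono)
    also have "\<dots> = (\<integral>\<^sup>+ y. indicator D y \<partial>leb_n n)"
      using D by simp
    also have "\<dots> = (\<integral>\<^sup>+ y. g x y \<partial>leb_n n)"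
      by (intro nn_integral_cong) (auto simp: g_def D_def indicator_def)
    finally show ?thesis .
  qed
  \<comment> \<open>For fixed \<open>y\<close>, sending \<open>x\<close> to \<open>y - x\<close> is
    an affine map with factor \<open>- 1\<close> and preserves volume.\<close>
  have inner: "(\<integral>\<^sup>+ x. indicator E (sub x y) \<partial>leb_n n) = V" for y
  proof -
    have "sub x y = affine_map n y (- 1) x" for x
      by (auto simp: sub_def affine_map_def)
    then have "(\<integral>\<^sup>+ x. indicator E (sub x y) \<partial>leb_n n) = (\<integral>\<^sup>+ x. indicator (affine_map n y (- 1) -` E \<inter> space (leb_n n)) x \<partial>leb_n n)"
      by (intro nn_integral_cong) (auto simp: indicator_def)
    also have "\<dots> = emeasure (leb_n n) (affine_map n y (- 1) -` E \<inter> space (leb_n n))"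
      by (rule nn_integral_indicator) (rule measurable_sets[OF affine_map_measurable E])
    also have "\<dots> = V"
      using emeasure_affine_map[of "- 1" E n y] E by (simp add: V_def)
    finally show ?thesis .
  qed
  \<comment> \<open>The factor \<open>(1/2)^n\<close> of the half-size copies cancels the
    \<open>2^n\<close> in the volume of the cube.\<close>
  have "ennreal (s ^ n) * V = ennreal ((1 / 2) ^ n) * V * emeasure (leb_n n) Q"
  proof -
    have "ennreal ((1 / 2) ^ n) * ennreal ((2 * s) ^ n) = ennreal ((1 / 2) ^ n * (2 * s) ^ n)"
      using s by (intro ennreal_mult[symmetric]) auto
    also have "(1 / 2) ^ n * (2 * s) ^ n = s ^ n"
      by (subst power_mult_distrib[symmetric]) simp
    finally show ?thesis
      unfolding Q(2) by (metis mult.assoc mult.commute)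
  qed
  also have "\<dots> = (\<integral>\<^sup>+ x. ennreal ((1 / 2) ^ n) * V * indicator Q x \<partial>leb_n n)"
    using Q by (simp add: nn_integral_cmult_indicator)
  also have "\<dots> \<le> (\<integral>\<^sup>+ x. \<integral>\<^sup>+ y. g x y \<partial>leb_n n \<partial>leb_n n)"
    by (intro nn_integral_mono) (auto simp: indicator_def lower)
  also have "\<dots> = (\<integral>\<^sup>+ y. \<integral>\<^sup>+ x. g x y \<partial>leb_n n \<partial>leb_n n)"
    by (rule LL.Fubini'[OF g_meas, symmetric])
  also have "\<dots> = (\<integral>\<^sup>+ y. V * indicator E y \<partial>leb_n n)"
  proof (intro nn_integral_cong)
    fix y
    show "(\<integral>\<^sup>+ x. g x y \<partial>leb_n n) = V * indicator E y"
      using inner[of y] by (cases "y \<in> E") (simp_all add: g_def)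
  qed
  also have "\<dots> = V * V"
    using E by (simp add: nn_integral_cmult_indicator V_def)
  finally have le: "ennreal (s ^ n) * V \<le> V * V" .
  \<comment> \<open>Finiteness and positivity of the volume allow one factor to be
    cancelled.\<close>
  obtain v where v: "V = ennreal v" "v \<ge> 0"
    using V(2) by (cases V) auto
  have "v > 0"
    using V(1) v by simp
  have "ennreal (s ^ n * v) \<le> ennreal (v * v)"
    using le v s by (simp add: ennreal_mult)
  then have "s ^ n * v \<le> v * v"
    using v by (simp add: ennreal_le_iff)
  then have "s ^ n \<le> v"
    using \<open>v > 0\<close> by simp
  moreover have "Vol n K = v"
    using v by (simp add: Vol_def measure_def V_def E_def coords_def[abs_def])
  ultimately show ?thesis
    by (simp add: s_def)
qed

end

section \<open>The bound with the constant 4\<close>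

theorem theorem1p2:
  shows "\<exists>C::real. C > 0 \<and> (\<forall>n::nat. n \<ge> 1 \<longrightarrow> (\<forall>K. smooth_convex_body n K \<longrightarrow>
           xi n K \<le> ennreal (C * sqrt (real n) * Vol n K powr (1 / real n))))"
proof (intro exI[of _ 4] conjI allI impI)
  fix n :: nat and K
  assume n: "n \<ge> 1" and smooth: "smooth_convex_body n K"
  interpret K: convex_body_n n K
    using smooth by unfold_locales (simp add: smooth_convex_body_def)
  have reg: "regular_boundary n K"
    using smooth by (intro smooth_imp_regular_boundary) (simp add: smooth_convex_body_def)
  have body: "regular_body n ((\<lambda>x. x - c) ` K)" if c: "c \<in> int_n n K" for c
  proof -
    have cR: "c \<in> Rn n"
      using c K.in_K K.in_Rn by blast
    show ?thesis
      unfolding regular_body_def regular_body_axioms_def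
    proof (intro conjI)
      show "convex_body_n n ((\<lambda>x. x - c) ` K)"
        by (rule K.translate_body[OF cR])
      show "regular_boundary n ((\<lambda>x. x - c) ` K)"
        by (rule regular_boundary_translation[OF cR K.convex_body_n_axioms reg])
      show "0 \<in> int_n n ((\<lambda>x. x - c) ` K)"
        using c by (auto simp: int_n_translation[OF cR] image_iff)
    qed
  qed
  define r where "r = Vol n K powr (1 / real n)"
  \<comment> \<open>For such \<open>w\<close> the volume bound fails, so some \<open>v\<close> of
    norm at most \<open>w\<close> is not a difference of points of \<open>K\<close>.\<close>
  have two_gon: "\<exists>ys. set ys \<subseteq> Rn n \<and> untranslatable n K (set ys) \<and> closed_length ys \<le> 2 * w"
    if w: "w > 2 * sqrt (real n) * r" for w
  proof -
    have r0: "r \<ge> 0"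
      by (simp add: r_def)
    then have w0: "w > 0"
      using w by (meson le_less_trans mult_nonneg_nonneg real_sqrt_ge_zero of_nat_0_le_iff zero_le_numeral)
    have "\<not> (w / (2 * sqrt (real n))) ^ n \<le> Vol n K"
    proof
      assume le: "(w / (2 * sqrt (real n))) ^ n \<le> Vol n K"
      have pos: "w / (2 * sqrt (real n)) > 0"
        using w0 n by simp
      have "w / (2 * sqrt (real n)) = ((w / (2 * sqrt (real n))) ^ n) powr (1 / real n)"
        using pos w0 n by (simp add: powr_realpow[symmetric] powr_powr)
      also have "\<dots> \<le> r"
        unfolding r_def using le pos by (intro powr_mono2) auto
      finally show False
        using w n by (simp add: pos_divide_le_eq mult_ac)
    qed
    then obtain v where v: "v \<in> Rn n" "norm v \<le> w" "\<not> (\<exists>a\<in>K. \<exists>b\<in>K. v = a - b)"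
      using K.volume_ge_of_differences[OF w0 n] by blast
    have "untranslatable n K (set [0, v])"
    proof (rule untranslatableI)
      fix y assume "\<forall>z\<in>set [0, v]. z + y \<in> int_n n K"
      then have "y \<in> K" "v + y \<in> K"
        using K.in_K by auto
      then show False
        using v(3) by (metis add_diff_cancel_right')
    qed
    moreover have "closed_length [0, v] = 2 * norm v"
      by (simp add: closed_length_def)
    ultimately show ?thesis
      using v Rn_0 by (intro exI[of _ "[0, v]"]) auto
  qed
  \<comment> \<open>Any interior point may serve as origin: untranslatability does not depend on it,
    so the polygon found with \<open>c\<close> also bounds trajectories set up with another
    \<open>c'\<close>.\<close>
  obtain c where c: "c \<in> int_n n K"
    using K.int_nonempty by blast
  have cR: "c \<in> Rn n"
    using c K.in_K K.in_Rn by blast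
  interpret B: regular_body n "(\<lambda>x. x - c) ` K"
    by (rule body[OF c])
  obtain ys where "set ys \<subseteq> Rn n" "untranslatable n K (set ys)"
    using two_gon[of "2 * sqrt (real n) * r + 1"] by auto
  then obtain xs where xs: "B.shortest_polygon xs"
    using B.shortest_polygon_exists untranslatable_translate_body[OF cR] by blast
  have min: "closed_length xs \<le> closed_length ys" if "set ys \<subseteq> Rn n" "untranslatable n K (set ys)" for ys
    using xs that untranslatable_translate_body[OF cR] unfolding B.shortest_polygon_def by blast
  have lower: "ennreal (closed_length xs) \<le> loop_length q" if traj: "periodic_billiard_trajectory n K q" for q
  proof -
    obtain c' p where c': "c' \<in> int_n n K" and tr: "closed_KB_trajectory n ((\<lambda>x. x - c') ` K) (\<lambda>t. (q t - c', p t))"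
      using traj by (auto simp: periodic_billiard_trajectory_def)
    have "c' \<in> Rn n"
      using c' K.in_K K.in_Rn by blast
    interpret B': regular_body n "(\<lambda>x. x - c') ` K"
      by (rule body[OF c'])
    have "ennreal (closed_length xs) \<le> loop_length (\<lambda>t. fst (q t - c', p t))"
      using min untranslatable_translate_body[OF \<open>c' \<in> Rn n\<close>] by (intro B'.trajectory_length_ge[OF tr]) blast
    also have "\<dots> = loop_length q"
      by (simp add: loop_length_def dist_norm)
    finally show ?thesis .
  qed
  obtain q p where traj: "closed_KB_trajectory n ((\<lambda>x. x - c) ` K) (\<lambda>t. (q t, p t))"
    and len: "loop_length q \<le> ennreal (closed_length xs)"
    using B.shortest_polygon_trajectory[OF xs] by blast
  define q' where "q' t = q t + c" for t
  have q': "periodic_billiard_trajectory n K q'"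
    using traj c unfolding periodic_billiard_trajectory_def
    by (intro bexI[of _ c] exI[of _ p]) (simp_all add: q'_def)
  have "loop_length q' = loop_length q"
    by (simp add: loop_length_def dist_norm q'_def)
  with len lower[OF q'] have "loop_length q' = ennreal (closed_length xs)"
    by simp
  \<comment> \<open>The trajectory \<open>q'\<close> attains the lower bound, which identifies the
    \<open>LEAST\<close> value.\<close>
  then have "xi n K = ennreal (closed_length xs)"
    unfolding xi_def using q' lower by (intro Least_equality) auto
  \<comment> \<open>The 2-gon is available only for \<open>w\<close> strictly above the critical
    value, hence the margin \<open>e\<close>.\<close>
  also have "closed_length xs \<le> 4 * sqrt (real n) * r"
  proof (rule field_le_epsilon)
    fix e :: real assume "e > 0"
    then obtain ys where "set ys \<subseteq> Rn n" "untranslatable n K (set ys)" "closed_length ys \<le> 2 * (2 * sqrt (real n) * r + e / 2)"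
      using two_gon[of "2 * sqrt (real n) * r + e / 2"] by auto
    then show "closed_length xs \<le> 4 * sqrt (real n) * r + e"
      using min[of ys] by simp
  qed
  finally show "xi n K \<le> ennreal (4 * sqrt (real n) * Vol n K powr (1 / real n))"
    by (simp add: r_def ennreal_leI)
qed simp

end
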